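(* Let $n \in \{1,2\}$. For all finitely presentable $n$-parameter persistence modules $M$ and $N$ we have $$\widehat{d_{W^1}}(\mathcal{HB}(M),\mathcal{HB}(N)) = \widehat{d_{W^1}}(\beta\mathcal{B}(M),\beta\mathcal{B}(N)) \leq n \cdot d_I^1(M,N).$$
   Context: Fix a field $\mathbb{k}$. $\mathbf{vec}$ is the category of finite-dimensional $\mathbb{k}$-vector spaces. $\mathbf{R}^n$ is the set $\mathbb{R}^n$ with the product order, viewed as a category. An $n$-parameter persistence module is a functor $\mathbf{R}^n \to \mathbf{vec}$; morphisms are natural transformations. Multisets are considered up to isomorphism; $\cup$ is disjoint union of multisets (multiplicities add). A barcode is a multiset of elements of $\mathbb{R}^n$, and a signed barcode is an ordered pair of barcodes. Free modules: for $i \in \mathbb{R}^n$, $F_i$ is $\mathbb{k}$ on $\{j : j \geq i\}$ and $0$ elsewhere, with identity structure maps inside the support. A module is free if it is a direct sum of modules $F_i$; the barcode $\mathcal{B}(P)$ of a free module is the unique multiset with $P \cong \bigoplus_{i \in \mathcal{B}(P)} F_i$, and its cardinality is the rank of $P$. A module is finitely presentable if it is the cokernel of a morphism between free modules of finite rank. Betti signed barcode: every finitely presentable $M$ has a minimal projective resolution $P_\bullet \to M$ (each $P_k$ is free of minimal rank among all possible $k$-th terms of projective resolutions of $M$), unique up to isomorphism and of finite length. $\beta\mathcal{B}(M) = \big(\bigcup_{k \text{ even}} \mathcal{B}(P_k), \bigcup_{k \text{ odd}} \mathcal{B}(P_k)\big)$. Minimal Hilbert decomposition signed barcode: the Hilbert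 function of $M$ is $\mathsf{Hil}(M) : \mathbb{R}^n \to \mathbb{Z}$, $i \mapsto \dim M(i)$. There is, up to isomorphism, a unique pair $(P^*,Q^* )$ of free modules of finite rank such that $\mathsf{Hil}(M) = \mathsf{Hil}(P^* ) - \mathsf{Hil}(Q^* )$ and the multisets $\mathcal{B}(P^* )$ and $\mathcal{B}(Q^* )$ are disjoint (no common element of $\mathbb{R}^n$). Put $\mathcal{HB}(M) = (\mathcal{B}(P^* ),\mathcal{B}(Q^* ))$. Signed $1$-Wasserstein distance: for finite barcodes, $d_{W^1}(\mathcal{B},\mathcal{C}) \in [0,\infty]$ is the infimum of $\sum_{i \in \mathcal{B}} \|i - h(i)\|_1$ over all bijections of multisets $h : \mathcal{B} \to \mathcal{C}$ ($\infty$ if there is none). For finite signed barcodes, $\widehat{d_{W^1}}\big((\mathcal{B}_+,\mathcal{B}_-),(\mathcal{C}_+,\mathcal{C}_-)\big) = d_{W^1}(\mathcal{B}_+\cup\mathcal{C}_-,\ \mathcal{C}_+\cup\mathcal{B}_-)$. $1$-presentation distance: a presentation matrix $P$ consists of $r,c \in \mathbb{N}$, an underlying matrix $\mu \in \mathbb{k}^{r\times c}$, and a labeling function $\mathcal{L}(P) : \{1,\dots,r+c\} \to \mathbb{R}^n$ such that $\mathcal{L}(P)(i) \leq \mathcal{L}(P)(r+j)$ whenever $\mu_{i,j} \neq 0$. It is a presentation matrix of $M$ if $M$ is isomorphic to the cokernel of the morphism $\bigoplus_{r+1\leq j\leq r+c} F_{\mathcal{L}(P)(j)} \to \bigoplus_{1\leq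 i\leq r} F_{\mathcal{L}(P)(i)}$ with matrix of coefficients $\mu$. For finitely presentable $M,N$ let $$\overline{d_I^1}(M,N) = \inf \sum_{i=1}^{r+c} \|\mathcal{L}(P_M)(i) - \mathcal{L}(P_N)(i)\|_1,$$ the infimum (in $[0,\infty]$) being over all pairs $(P_M,P_N)$ of presentation matrices of $M$ and $N$, respectively, having the same underlying matrix. The $1$-presentation distance $d_I^1$ is the largest extended pseudodistance (symmetric $[0,\infty]$-valued function, zero on the diagonal, satisfying the triangle inequality) on finitely presentable $n$-parameter persistence modules that is bounded above by $\overline{d_I^1}$. *)

theory Defs
  imports
    "HOL-Analysis.Analysis"
    "HOL-Library.Multiset"
    "HOL-Library.Function_Algebras"
    "Jordan_Normal_Form.Matrix"
begin

section \<open>Vector spaces\<close>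

text \<open>
  Finite-dimensional vector spaces over the field \<open>'k\<close> are taken to be the finite-dimensional
  linear subspaces of the space \<open>nat \<Rightarrow> 'k\<close> of sequences, with pointwise operations.  Every
  finite-dimensional space is isomorphic to one of these, so this is the category of
  finite-dimensional vector spaces up to equivalence, with a type as its universe.
\<close>

definition seq_scale :: "'k::field \<Rightarrow> (nat \<Rightarrow> 'k) \<Rightarrow> (nat \<Rightarrow> 'k)" where
  "seq_scale c x = (\<lambda>a. c * x a)"

global_interpretation seq: vector_space "seq_scale :: 'k::field \<Rightarrow> (nat \<Rightarrow> 'k) \<Rightarrow> (nat \<Rightarrow> 'k)"
  by standard (auto simp: seq_scale_def fun_eq_iff algebra_simps)

definition fd_space :: "(nat \<Rightarrow> 'k::field) set \<Rightarrow> bool" where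
  "fd_space V \<longleftrightarrow> seq.subspace V \<and> (\<exists>B. finite B \<and> seq.span B = V)"

definition linear_between ::
  "(nat \<Rightarrow> 'k::field) set \<Rightarrow> (nat \<Rightarrow> 'k) set \<Rightarrow> ((nat \<Rightarrow> 'k) \<Rightarrow> (nat \<Rightarrow> 'k)) \<Rightarrow> bool" where
  "linear_between V W f \<longleftrightarrow>
     (\<forall>x\<in>V. f x \<in> W) \<and>
     (\<forall>x\<in>V. \<forall>y\<in>V. f (x + y) = f x + f y) \<and>
     (\<forall>c. \<forall>x\<in>V. f (seq_scale c x) = seq_scale c (f x))"

section \<open>Persistence modules\<close>

text \<open>
  The indexing poset \<open>'p\<close> is instantiated to \<open>real ^ 'n\<close> with its product order.  Only the values
  of \<open>str_map M i j\<close> for \<open>i \<le> j\<close> on \<open>fiber M i\<close> are meaningful; likewise for morphisms.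
\<close>

record ('k, 'p) pmod =
  fiber :: "'p \<Rightarrow> (nat \<Rightarrow> 'k) set"
  str_map :: "'p \<Rightarrow> 'p \<Rightarrow> (nat \<Rightarrow> 'k) \<Rightarrow> (nat \<Rightarrow> 'k)"

definition persistence_module :: "('k::field, 'p::order) pmod \<Rightarrow> bool" where
  "persistence_module M \<longleftrightarrow>
     (\<forall>i. fd_space (fiber M i)) \<and>
     (\<forall>i j. i \<le> j \<longrightarrow> linear_between (fiber M i) (fiber M j) (str_map M i j)) \<and>
     (\<forall>i. \<forall>x\<in>fiber M i. str_map M i i x = x) \<and>
     (\<forall>i j l. i \<le> j \<and> j \<le> l \<longrightarrow>
        (\<forall>x\<in>fiber M i. str_map M j l (str_map M i j x) = str_map M i l x))"

type_synonym ('k, 'p) pmor = "'p \<Rightarrow> (nat \<Rightarrow> 'k) \<Rightarrow> (nat \<Rightarrow> 'k)"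

definition morphism ::
  "('k::field, 'p::order) pmod \<Rightarrow> ('k, 'p) pmod \<Rightarrow> ('k, 'p) pmor \<Rightarrow> bool" where
  "morphism M N f \<longleftrightarrow>
     (\<forall>i. linear_between (fiber M i) (fiber N i) (f i)) \<and>
     (\<forall>i j. i \<le> j \<longrightarrow>
        (\<forall>x\<in>fiber M i. f j (str_map M i j x) = str_map N i j (f i x)))"

definition isomorphic :: "('k::field, 'p::order) pmod \<Rightarrow> ('k, 'p) pmod \<Rightarrow> bool" where
  "isomorphic M N \<longleftrightarrow>
     (\<exists>f. morphism M N f \<and> (\<forall>i. bij_betw (f i) (fiber M i) (fiber N i)))"

definition epi :: "('k::field, 'p::order) pmod \<Rightarrow> ('k, 'p) pmod \<Rightarrow> ('k, 'p) pmor \<Rightarrow> bool" where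
  "epi M N f \<longleftrightarrow> morphism M N f \<and> (\<forall>i. f i ` fiber M i = fiber N i)"

definition exact_at ::
  "('k::field, 'p::order) pmod \<Rightarrow> ('k, 'p) pmor \<Rightarrow> ('k, 'p) pmod \<Rightarrow> ('k, 'p) pmor \<Rightarrow> bool" where
  "exact_at L f M g \<longleftrightarrow> (\<forall>i. f i ` fiber L i = {x \<in> fiber M i. g i x = 0})"

text \<open>
  \<open>M\<close> is (isomorphic to) the cokernel of \<open>f : P \<rightarrow> Q\<close>, that is, \<open>P \<rightarrow> Q \<rightarrow> M \<rightarrow> 0\<close> is exact for a
  suitable projection \<open>Q \<rightarrow> M\<close>.
\<close>

definition is_cokernel ::
  "('k::field, 'p::order) pmod \<Rightarrow> ('k, 'p) pmor \<Rightarrow> ('k, 'p) pmod \<Rightarrow> ('k, 'p) pmod \<Rightarrow> bool" where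
  "is_cokernel P f Q M \<longleftrightarrow> (\<exists>g. epi Q M g \<and> exact_at P f Q g)"

section \<open>Free modules and barcodes\<close>

text \<open>
  The direct sum of the modules \<open>F\<^sub>i\<close> for \<open>i\<close> in the list \<open>xs\<close>: the summand \<open>F\<^bsub>xs ! a\<^esub>\<close> occupies the
  coordinate \<open>a\<close>.
\<close>

definition free_module :: "'p::order list \<Rightarrow> ('k::field, 'p) pmod" where
  "free_module xs =
     \<lparr> fiber = (\<lambda>j. {x. \<forall>a. x a \<noteq> 0 \<longrightarrow> a < length xs \<and> xs ! a \<le> j}),
       str_map = (\<lambda>i j x. x) \<rparr>"

definition has_barcode :: "('k::field, 'p::order) pmod \<Rightarrow> 'p multiset \<Rightarrow> bool" where
  "has_barcode P B \<longleftrightarrow> persistence_module P \<and> (\<exists>xs. mset xs = B \<and> isomorphic P (free_module xs))"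

definition free_finite_rank :: "('k::field, 'p::order) pmod \<Rightarrow> bool" where
  "free_finite_rank P \<longleftrightarrow> (\<exists>B. has_barcode P B)"

definition barcode :: "('k::field, 'p::order) pmod \<Rightarrow> 'p multiset" where
  "barcode P = (THE B. has_barcode P B)"

definition free_rank :: "('k::field, 'p::order) pmod \<Rightarrow> nat" where
  "free_rank P = size (barcode P)"

definition finitely_presentable :: "('k::field, 'p::order) pmod \<Rightarrow> bool" where
  "finitely_presentable M \<longleftrightarrow> persistence_module M \<and>
     (\<exists>P Q f. free_finite_rank P \<and> free_finite_rank Q \<and> morphism P Q f \<and> is_cokernel P f Q M)"

section \<open>Betti signed barcode\<close>

type_synonym 'p signed_barcode = "'p multiset \<times> 'p multiset"

definition projective :: "('k::field, 'p::order) pmod \<Rightarrow> bool" where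
  "projective P \<longleftrightarrow> persistence_module P \<and>
     (\<forall>X Y e f. persistence_module X \<and> persistence_module Y \<and> epi X Y e \<and> morphism P Y f \<longrightarrow>
        (\<exists>g. morphism P X g \<and> (\<forall>i. \<forall>x\<in>fiber P i. e i (g i x) = f i x)))"

text \<open>\<open>d 0\<close> is the augmentation \<open>P 0 \<rightarrow> M\<close>, and \<open>d (Suc k)\<close> is the differential \<open>P (Suc k) \<rightarrow> P k\<close>.\<close>

definition projective_resolution ::
  "(nat \<Rightarrow> ('k::field, 'p::order) pmod) \<Rightarrow> (nat \<Rightarrow> ('k, 'p) pmor) \<Rightarrow> ('k, 'p) pmod \<Rightarrow> bool" where
  "projective_resolution P d M \<longleftrightarrow>
     (\<forall>k. projective (P k)) \<and>
     epi (P 0) M (d 0) \<and>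
     (\<forall>k. morphism (P (Suc k)) (P k) (d (Suc k))) \<and>
     (\<forall>k. exact_at (P (Suc k)) (d (Suc k)) (P k) (d k))"

text \<open>
  The terms are of finite rank, so in the comparison of ranks only those terms of other resolutions
  matter that are themselves free of finite rank.
\<close>

definition minimal_projective_resolution ::
  "(nat \<Rightarrow> ('k::field, 'p::order) pmod) \<Rightarrow> (nat \<Rightarrow> ('k, 'p) pmor) \<Rightarrow> ('k, 'p) pmod \<Rightarrow> bool" where
  "minimal_projective_resolution P d M \<longleftrightarrow>
     projective_resolution P d M \<and>
     (\<forall>k. free_finite_rank (P k) \<and>
        (\<forall>P' d'. projective_resolution P' d' M \<and> free_finite_rank (P' k) \<longrightarrow>
           free_rank (P k) \<le> free_rank (P' k)))"

text \<open>
  Minimal resolutions have finite length, so only finitely many of the barcodes in the two unions are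
  nonempty; the unions range over these.
\<close>

definition betti_barcode :: "('k::field, 'p::order) pmod \<Rightarrow> 'p signed_barcode" where
  "betti_barcode M =
     (let P = (SOME P. \<exists>d. minimal_projective_resolution P d M)
      in (\<Sum>k\<in>{k. even k \<and> barcode (P k) \<noteq> {#}}. barcode (P k),
          \<Sum>k\<in>{k. odd k \<and> barcode (P k) \<noteq> {#}}. barcode (P k)))"

section \<open>Minimal Hilbert decomposition signed barcode\<close>

definition Hil :: "('k::field, 'p::order) pmod \<Rightarrow> 'p \<Rightarrow> int" where
  "Hil M i = int (seq.dim (fiber M i))"

text \<open>The modules \<open>P\<close> and \<open>Q\<close> are unique only up to isomorphism, but the pair of their barcodes is unique.\<close>

definition hilbert_barcode :: "('k::field, 'p::order) pmod \<Rightarrow> 'p signed_barcode" where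
  "hilbert_barcode M =
     (THE S. \<exists>(P :: ('k, 'p) pmod) (Q :: ('k, 'p) pmod).
        free_finite_rank P \<and> free_finite_rank Q \<and>
        (\<forall>i. Hil M i = Hil P i - Hil Q i) \<and>
        set_mset (barcode P) \<inter> set_mset (barcode Q) = {} \<and>
        S = (barcode P, barcode Q))"

section \<open>Signed 1-Wasserstein distance\<close>

definition l1_norm :: "real ^ 'n \<Rightarrow> real" where
  "l1_norm x = (\<Sum>a\<in>UNIV. \<bar>vec_nth x a\<bar>)"

text \<open>The elements of a multiset, with copies told apart by an index.\<close>

definition mset_elems :: "'a multiset \<Rightarrow> ('a \<times> nat) set" where
  "mset_elems B = (SIGMA x:set_mset B. {..<count B x})"

definition wasserstein :: "(real ^ 'n) multiset \<Rightarrow> (real ^ 'n) multiset \<Rightarrow> ennreal" where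
  "wasserstein B C =
     (INF h\<in>{h. bij_betw h (mset_elems B) (mset_elems C)}.
        ennreal (\<Sum>u\<in>mset_elems B. l1_norm (fst u - fst (h u))))"

definition signed_wasserstein ::
  "(real ^ 'n) signed_barcode \<Rightarrow> (real ^ 'n) signed_barcode \<Rightarrow> ennreal" where
  "signed_wasserstein B C = wasserstein (fst B + snd C) (fst C + snd B)"

section \<open>1-presentation distance\<close>

text \<open>
  A presentation matrix is a pair \<open>(\<mu>, L)\<close>.  Rows and columns are indexed from 0, and the list \<open>L\<close> of
  labels consists of the labels of the rows followed by those of the columns.
\<close>

type_synonym ('k, 'p) pres_matrix = "'k mat \<times> 'p list"

definition presentation_matrix :: "('k::field, 'p::order) pres_matrix \<Rightarrow> bool" where
  "presentation_matrix = (\<lambda>(\<mu>, L).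
     length L = dim_row \<mu> + dim_col \<mu> \<and>
     (\<forall>i < dim_row \<mu>. \<forall>j < dim_col \<mu>. \<mu> $$ (i, j) \<noteq> 0 \<longrightarrow> L ! i \<le> L ! (dim_row \<mu> + j)))"

definition matrix_morphism :: "'k::field mat \<Rightarrow> ('k, 'p) pmor" where
  "matrix_morphism \<mu> = (\<lambda>_ x i. if i < dim_row \<mu> then \<Sum>j<dim_col \<mu>. \<mu> $$ (i, j) * x j else 0)"

definition presents :: "('k::field, 'p::order) pres_matrix \<Rightarrow> ('k, 'p) pmod \<Rightarrow> bool" where
  "presents = (\<lambda>(\<mu>, L) M.
     presentation_matrix (\<mu>, L) \<and>
     is_cokernel (free_module (drop (dim_row \<mu>) L)) (matrix_morphism \<mu>)
       (free_module (take (dim_row \<mu>) L)) M)"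

definition presentation_predistance ::
  "('k::field, real ^ 'n) pmod \<Rightarrow> ('k, real ^ 'n) pmod \<Rightarrow> ennreal" where
  "presentation_predistance M N =
     Inf {ennreal (\<Sum>i<dim_row \<mu> + dim_col \<mu>. l1_norm (L ! i - L' ! i)) | \<mu> L L'.
            presents (\<mu>, L) M \<and> presents (\<mu>, L') N}"

definition ext_pseudodistance_on :: "'a set \<Rightarrow> ('a \<Rightarrow> 'a \<Rightarrow> ennreal) \<Rightarrow> bool" where
  "ext_pseudodistance_on S d \<longleftrightarrow>
     (\<forall>x\<in>S. d x x = 0) \<and>
     (\<forall>x\<in>S. \<forall>y\<in>S. d x y = d y x) \<and>
     (\<forall>x\<in>S. \<forall>y\<in>S. \<forall>z\<in>S. d x z \<le> d x y + d y z)"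

text \<open>
  Functions into \<open>ennreal\<close> are ordered pointwise.  Nothing is required of \<open>d\<close> off the finitely presentable
  modules, so the greatest \<open>d\<close> is \<open>\<infinity>\<close> there.
\<close>

definition presentation_distance ::
  "('k::field, real ^ 'n) pmod \<Rightarrow> ('k, real ^ 'n) pmod \<Rightarrow> ennreal" where
  "presentation_distance =
     (GREATEST d. ext_pseudodistance_on {M. finitely_presentable M} d \<and>
        (\<forall>M N. finitely_presentable M \<and> finitely_presentable N \<longrightarrow>
           d M N \<le> presentation_predistance M N))"

end

theory Submission
  imports Defs
begin

text \<open>
  All invariants in the statement are read off Hilbert functions.  A finite multiset of points is
  determined by the sum of the indicators of their up-sets (\<open>barcode_Hil_inject\<close>), so a signed
  barcode is determined by its Hilbert function up to a common summand.  The signed 1-Wasserstein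
  distance does not see common summands, since matchings can be short-cut by the triangle inequality
  (\<open>wasserstein_cancel\<close>).

  The equality of the two distances follows once both barcodes of \<open>M\<close> are known to have the Hilbert function
  of \<open>M\<close>.  For the Betti barcode this takes a finite minimal resolution.  Take a minimal cover of
  \<open>M\<close> and a minimal cover of its kernel; in at most two parameters the next kernel is free
  (\<open>kernel_free\<close>), because two filtrations of a vector space have a common adapted basis
  (\<open>adapted_basis_exists\<close>).  In the resulting resolution all kernels lie in the radical, and comparison
  with an arbitrary projective resolution shows that every term has the least possible rank
  (\<open>radical_resolution_minimal\<close>).  Exactness then expresses the Hilbert function of \<open>M\<close> as the
  alternating sum over the Betti barcode (\<open>Hil_betti_barcode\<close>).

  For the inequality, let \<open>M\<close> and \<open>N\<close> have presentations with the same underlying matrix.  The Hilbert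
  function of \<open>M\<close> at \<open>i\<close> is the number of rows with label at most \<open>i\<close> minus the rank of the
  columns with label at most \<open>i\<close> (\<open>Hil_presented\<close>).  Moving a row label contributes the distance it moves.
  Moving a column label along one coordinate, past no other label, changes the rank, if at all, by the
  indicator of an interval in one parameter and of a rectangle, bounded or not, in two parameters; the corners of a bounded
  rectangle are matched in pairs, each at the distance moved (\<open>label_rank_elementary_move\<close>).  An arbitrary
  change of labels is a succession of such moves, whose costs add up to at most \<open>CARD('n)\<close> times
  the total \<open>1\<close>-norm (\<open>Hil_near_of_presentations\<close>).  Hence the signed distance of Betti barcodes, divided by
  \<open>CARD('n)\<close>, is a pseudodistance below the predistance, and so below the greatest one.
\<close>

section \<open>Couplings and the signed Wasserstein distance\<close>

lemma l1_norm_nonneg [simp]: "0 \<le> l1_norm x"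
  by (simp add: l1_norm_def sum_nonneg)

lemma l1_norm_zero [simp]: "l1_norm 0 = 0"
  by (simp add: l1_norm_def)

lemma l1_norm_minus_commute: "l1_norm (x - y) = l1_norm (y - x)"
  by (simp add: l1_norm_def abs_minus_commute)

lemma l1_norm_triangle: "l1_norm (x - z) \<le> l1_norm (x - y) + l1_norm (y - z)"
  unfolding l1_norm_def sum.distrib[symmetric] by (rule sum_mono) auto

definition pair_cost :: "((real ^ 'n) \<times> (real ^ 'n)) multiset \<Rightarrow> real" where
  "pair_cost Z = (\<Sum>p\<in>#Z. l1_norm (fst p - snd p))"

text \<open>
  Bijections between multisets are awkward to compose, because copies of an element carry arbitrary
  indices.  A matching is therefore represented by the multiset of its matched pairs, and \<open>\<epsilon>\<close> is
  only an upper bound of the cost, so that the relation is stable under adding and cancelling.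
\<close>

definition coupled :: "(real ^ 'n) multiset \<Rightarrow> (real ^ 'n) multiset \<Rightarrow> real \<Rightarrow> bool" where
  "coupled A B \<epsilon> \<longleftrightarrow> (\<exists>Z. image_mset fst Z = A \<and> image_mset snd Z = B \<and> pair_cost Z \<le> \<epsilon>)"

lemma pair_cost_add_mset [simp]: "pair_cost (add_mset p Z) = l1_norm (fst p - snd p) + pair_cost Z"
  and pair_cost_empty [simp]: "pair_cost {#} = 0"
  and pair_cost_union [simp]: "pair_cost (Z + Z') = pair_cost Z + pair_cost Z'"
  by (simp_all add: pair_cost_def)

lemma pair_cost_nonneg: "0 \<le> pair_cost Z"
  by (induction Z) auto

lemma coupled_nonneg: "coupled A B \<epsilon> \<Longrightarrow> 0 \<le> \<epsilon>"
  unfolding coupled_def using pair_cost_nonneg order_trans by blast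

lemma coupled_mono: "coupled A B \<epsilon> \<Longrightarrow> \<epsilon> \<le> \<epsilon>' \<Longrightarrow> coupled A B \<epsilon>'"
  unfolding coupled_def by fastforce

lemma coupled_refl: "coupled A A 0"
  unfolding coupled_def
proof (intro exI conjI)
  let ?Z = "image_mset (\<lambda>x. (x, x)) A"
  show "image_mset fst ?Z = A" "image_mset snd ?Z = A" by (simp_all add: image_mset.compositionality comp_def)
  show "pair_cost ?Z \<le> 0" by (induction A) auto
qed

lemma coupled_sym: "coupled A B \<epsilon> \<Longrightarrow> coupled B A \<epsilon>"
  unfolding coupled_def
proof (elim exE conjE)
  fix Z assume Z: "image_mset fst Z = A" "image_mset snd Z = B" "pair_cost Z \<le> \<epsilon>"
  let ?Z = "image_mset prod.swap Z"
  have "pair_cost ?Z = pair_cost Z" by (induction Z) (auto simp: l1_norm_minus_commute)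
  then show "\<exists>Z. image_mset fst Z = B \<and> image_mset snd Z = A \<and> pair_cost Z \<le> \<epsilon>"
    using Z by (intro exI[of _ ?Z]) (auto simp: image_mset.compositionality comp_def)
qed

lemma coupled_add: "coupled A B \<epsilon> \<Longrightarrow> coupled A' B' \<epsilon>' \<Longrightarrow> coupled (A + A') (B + B') (\<epsilon> + \<epsilon>')"
  unfolding coupled_def
proof (elim exE conjE)
  fix Z Z' assume "image_mset fst Z = A" "image_mset snd Z = B" "pair_cost Z \<le> \<epsilon>"
    "image_mset fst Z' = A'" "image_mset snd Z' = B'" "pair_cost Z' \<le> \<epsilon>'"
  then show "\<exists>Z. image_mset fst Z = A + A' \<and> image_mset snd Z = B + B' \<and> pair_cost Z \<le> \<epsilon> + \<epsilon>'"
    by (intro exI[of _ "Z + Z'"]) auto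
qed

lemma coupled_single: "coupled {#x#} {#y#} (l1_norm (x - y))"
  unfolding coupled_def by (rule exI[of _ "{#(x, y)#}"]) simp

text \<open>
  A pair \<open>(x, b)\<close> and a pair \<open>(a, x)\<close> can be merged into \<open>(a, b)\<close> without raising the total cost, by
  the triangle inequality.  This is where the exponent 1 matters: the square of a distance, say, can exceed
  the sum of the squares along a detour.
\<close>

lemma coupled_cancel_single:
  assumes "coupled (add_mset x A) (add_mset x B) \<epsilon>"
  shows "coupled A B \<epsilon>"
proof -
  obtain Z where Z: "image_mset fst Z = add_mset x A" "image_mset snd Z = add_mset x B" "pair_cost Z \<le> \<epsilon>"
    using assms unfolding coupled_def by blast
  from Z(1) obtain p Z1 where p: "Z = add_mset p Z1" "fst p = x" "image_mset fst Z1 = A"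
    by (metis msed_map_invR)
  show ?thesis
  proof (cases "snd p = x")
    case True
    then show ?thesis using Z p unfolding coupled_def
      by (intro exI[of _ Z1]) auto
  next
    case False
    then obtain b B1 where b: "snd p = b" "image_mset snd Z1 = add_mset x B1" "B = add_mset b B1" "b \<noteq> x"
      using Z(2) p(1) by (auto simp: add_eq_conv_ex)
    from b(2) obtain q Z2 where q: "Z1 = add_mset q Z2" "snd q = x" "image_mset snd Z2 = B1"
      by (metis msed_map_invR)
    let ?Z = "add_mset (fst q, b) Z2"
    have "pair_cost ?Z \<le> pair_cost Z"
      using l1_norm_triangle[of "fst q" b x] b p q by simp
    then show ?thesis unfolding coupled_def using Z p b q
      by (intro exI[of _ ?Z]) auto
  qed
qed

lemma coupled_cancel: "coupled (A + X) (B + X) \<epsilon> \<Longrightarrow> coupled A B \<epsilon>"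
  by (induction X) (auto dest: coupled_cancel_single)

lemma mset_elems_add_mset:
  "mset_elems (add_mset a A) = insert (a, count A a) (mset_elems A)" "(a, count A a) \<notin> mset_elems A"
  by (auto simp: mset_elems_def less_Suc_eq split: if_splits)
    (metis count_inI not_less_zero)

lemma finite_mset_elems [simp]: "finite (mset_elems A)"
  by (simp add: mset_elems_def)

lemma mset_elems_empty [simp]: "mset_elems {#} = {}"
  by (simp add: mset_elems_def)

lemma image_fst_mset_elems: "image_mset fst (mset_set (mset_elems A)) = A"
proof (induction A)
  case (add a A)
  then show ?case using mset_elems_add_mset[of a A] by simp
qed simp

text \<open>
  The bijection is built one pair at a time: a new copy of \<open>a\<close> always receives the index
  \<open>count A a\<close>, which is the first one that is still free.
\<close>

lemma bijection_of_pairs: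
  "\<exists>h. bij_betw h (mset_elems (image_mset fst Z)) (mset_elems (image_mset snd Z)) \<and>
     (\<Sum>u\<in>mset_elems (image_mset fst Z). l1_norm (fst u - fst (h u))) = pair_cost Z"
proof (induction Z)
  case empty
  then show ?case by (simp add: bij_betw_def)
next
  case (add p Z)
  let ?A = "image_mset fst Z" and ?B = "image_mset snd Z"
  obtain h where h: "bij_betw h (mset_elems ?A) (mset_elems ?B)"
    "(\<Sum>u\<in>mset_elems ?A. l1_norm (fst u - fst (h u))) = pair_cost Z"
    using add by blast
  let ?a = "(fst p, count ?A (fst p))" and ?b = "(snd p, count ?B (snd p))"
  note A = mset_elems_add_mset[of "fst p" ?A] and B = mset_elems_add_mset[of "snd p" ?B]
  have 1: "bij_betw (h(?a := ?b)) (mset_elems ?A) (mset_elems ?B)"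
    using h(1) A(2) by (subst bij_betw_cong[where g = h]) auto
  have "bij_betw (h(?a := ?b)) (insert ?a (mset_elems ?A)) (insert ?b (mset_elems ?B))"
    using notIn_Un_bij_betw[of ?a "mset_elems ?A" "h(?a := ?b)" "mset_elems ?B"] 1 A(2) B(2) by simp
  moreover have "(\<Sum>u\<in>mset_elems ?A. l1_norm (fst u - fst ((h(?a := ?b)) u))) = pair_cost Z"
    unfolding h(2)[symmetric] using A(2) by (intro sum.cong) auto
  ultimately show ?case using A B
    by (intro exI[of _ "h(?a := ?b)"]) (simp del: fun_upd_apply, simp)
qed

lemma wasserstein_le_of_coupled:
  assumes "coupled A B \<epsilon>"
  shows "wasserstein A B \<le> ennreal \<epsilon>"
proof -
  obtain Z where Z: "image_mset fst Z = A" "image_mset snd Z = B" "pair_cost Z \<le> \<epsilon>"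
    using assms unfolding coupled_def by blast
  obtain h where h: "bij_betw h (mset_elems A) (mset_elems B)"
     "(\<Sum>u\<in>mset_elems A. l1_norm (fst u - fst (h u))) = pair_cost Z"
    using bijection_of_pairs[of Z] Z by auto
  have "wasserstein A B \<le> ennreal (\<Sum>u\<in>mset_elems A. l1_norm (fst u - fst (h u)))"
    unfolding wasserstein_def by (rule INF_lower) (simp add: h)
  then show ?thesis using h(2) Z(3) by (simp add: ennreal_leI order_trans)
qed

lemma coupled_of_bijection:
  assumes "bij_betw h (mset_elems A) (mset_elems B)"
  shows "coupled A B (\<Sum>u\<in>mset_elems A. l1_norm (fst u - fst (h u)))"
  unfolding coupled_def
proof (intro exI conjI)
  let ?Z = "image_mset (\<lambda>u. (fst u, fst (h u))) (mset_set (mset_elems A))"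
  show "image_mset fst ?Z = A" by (simp add: image_mset.compositionality comp_def image_fst_mset_elems)
  have "image_mset snd ?Z = image_mset fst (image_mset h (mset_set (mset_elems A)))"
    by (simp add: image_mset.compositionality comp_def)
  also have "image_mset h (mset_set (mset_elems A)) = mset_set (mset_elems B)"
    using assms by (simp add: bij_betw_def image_mset_mset_set)
  finally show "image_mset snd ?Z = B" by (simp add: image_fst_mset_elems)
  show "pair_cost ?Z \<le> (\<Sum>u\<in>mset_elems A. l1_norm (fst u - fst (h u)))"
    by (simp add: pair_cost_def image_mset.compositionality comp_def sum_unfold_sum_mset)
qed

lemma wasserstein_eq_Inf_coupled: "wasserstein A B = (INF \<epsilon>\<in>{\<epsilon>. coupled A B \<epsilon>}. ennreal \<epsilon>)"
proof (rule antisym)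
  show "wasserstein A B \<le> (INF \<epsilon>\<in>{\<epsilon>. coupled A B \<epsilon>}. ennreal \<epsilon>)"
    by (rule INF_greatest) (simp add: wasserstein_le_of_coupled)
  show "(INF \<epsilon>\<in>{\<epsilon>. coupled A B \<epsilon>}. ennreal \<epsilon>) \<le> wasserstein A B"
    unfolding wasserstein_def
    by (intro INF_greatest INF_lower) (simp add: coupled_of_bijection)
qed

lemma wasserstein_self [simp]: "wasserstein A A = 0"
  using wasserstein_le_of_coupled[OF coupled_refl, of A] by simp

lemma wasserstein_commute: "wasserstein A B = wasserstein B A"
  unfolding wasserstein_eq_Inf_coupled by (rule arg_cong[where f = "\<lambda>S. Inf (ennreal ` S)"]) (auto dest: coupled_sym)

text \<open>
  Invariance under a common summand makes the signed distance a function of the formal difference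
  of the two barcodes; it yields the triangle inequality, and the independence of the choice of a
  signed barcode with given Hilbert function.
\<close>

lemma wasserstein_cancel: "wasserstein (A + X) (B + X) = wasserstein A B"
proof -
  have "coupled (A + X) (B + X) \<epsilon> \<longleftrightarrow> coupled A B \<epsilon>" for \<epsilon>
    using coupled_cancel coupled_add[OF _ coupled_refl, of A B \<epsilon> X] by auto
  then have "{\<epsilon>. coupled (A + X) (B + X) \<epsilon>} = {\<epsilon>. coupled A B \<epsilon>}" by blast
  then show ?thesis unfolding wasserstein_eq_Inf_coupled by simp
qed

lemma coupled_near_wasserstein:
  assumes fin: "wasserstein A B < top_class.top" and e: "0 < e"
  obtains \<epsilon> where "coupled A B \<epsilon>" "ennreal \<epsilon> < wasserstein A B + ennreal e"
proof -
  have "wasserstein A B < wasserstein A B + ennreal e"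
    using fin e ennreal_add_left_cancel_less[of "wasserstein A B" 0 "ennreal e"] by simp
  then have "(INF \<epsilon>\<in>{\<epsilon>. coupled A B \<epsilon>}. ennreal \<epsilon>) < wasserstein A B + ennreal e"
    by (simp only: wasserstein_eq_Inf_coupled[symmetric])
  then show thesis using that unfolding INF_less_iff by blast
qed

lemma wasserstein_add_le: "wasserstein (A + A') (B + B') \<le> wasserstein A B + wasserstein A' B'"
proof (rule ennreal_le_epsilon)
  fix e :: real assume fin: "wasserstein A B + wasserstein A' B' < top_class.top" and "0 < e"
  then have "wasserstein A B < top_class.top" "wasserstein A' B' < top_class.top" "0 < e / 2"
    by (auto simp: ennreal_add_less_top)
  then obtain \<epsilon> \<epsilon>' where *: "coupled A B \<epsilon>" "coupled A' B' \<epsilon>'"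
    "ennreal \<epsilon> < wasserstein A B + ennreal (e/2)" "ennreal \<epsilon>' < wasserstein A' B' + ennreal (e/2)"
    by (meson coupled_near_wasserstein)
  have half: "ennreal (e/2) + ennreal (e/2) = ennreal e" using \<open>0 < e\<close> by (simp flip: ennreal_plus)
  have "wasserstein (A + A') (B + B') \<le> ennreal (\<epsilon> + \<epsilon>')"
    using * by (intro wasserstein_le_of_coupled coupled_add)
  also have "\<dots> = ennreal \<epsilon> + ennreal \<epsilon>'" using * by (simp add: coupled_nonneg ennreal_plus)
  also have "\<dots> \<le> (wasserstein A B + ennreal (e/2)) + (wasserstein A' B' + ennreal (e/2))"
    using * by (intro add_mono) auto
  also have "\<dots> = wasserstein A B + wasserstein A' B' + ennreal e"
    unfolding half[symmetric] by (simp only: ac_simps)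
  finally show "wasserstein (A + A') (B + B') \<le> wasserstein A B + wasserstein A' B' + ennreal e" .
qed

lemma signed_wasserstein_triangle:
  "signed_wasserstein S U \<le> signed_wasserstein S T + signed_wasserstein T U"
proof -
  have "signed_wasserstein S U = wasserstein ((fst S + snd U) + (fst T + snd T)) ((fst U + snd S) + (fst T + snd T))"
    by (simp add: signed_wasserstein_def wasserstein_cancel)
  also have "\<dots> = wasserstein ((fst S + snd T) + (fst T + snd U)) ((fst T + snd S) + (fst U + snd T))"
    by (simp add: ac_simps)
  also have "\<dots> \<le> signed_wasserstein S T + signed_wasserstein T U"
    unfolding signed_wasserstein_def by (rule wasserstein_add_le)
  finally show ?thesis .
qed

lemma signed_wasserstein_commute: "signed_wasserstein S T = signed_wasserstein T S"
  unfolding signed_wasserstein_def by (rule wasserstein_commute)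

lemma signed_wasserstein_self: "signed_wasserstein S S = 0"
  by (simp add: signed_wasserstein_def)

text \<open>
  The hypotheses say that \<open>S\<close> and \<open>S'\<close>, and likewise \<open>T\<close> and \<open>T'\<close>, have the same formal difference.
\<close>

lemma signed_wasserstein_cong:
  assumes S: "fst S + snd S' = fst S' + snd S" and T: "fst T + snd T' = fst T' + snd T"
  shows "signed_wasserstein S T = signed_wasserstein S' T'"
proof -
  have "signed_wasserstein S T =
      wasserstein ((fst S + snd T) + (snd S' + fst T')) ((fst T + snd S) + (snd S' + fst T'))"
    by (simp add: signed_wasserstein_def wasserstein_cancel)
  also have "(fst S + snd T) + (snd S' + fst T') = (fst S + snd S') + (fst T' + snd T)" by (simp add: ac_simps)
  also have "\<dots> = (fst S' + snd T') + (snd S + fst T)" unfolding S T[symmetric] by (simp add: ac_simps)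
  also have "(fst T + snd S) + (snd S' + fst T') = (fst T' + snd S') + (snd S + fst T)" by (simp add: ac_simps)
  finally show ?thesis by (simp add: signed_wasserstein_def wasserstein_cancel)
qed

section \<open>Hilbert functions of barcodes\<close>

definition barcode_Hil :: "'p::order multiset \<Rightarrow> 'p \<Rightarrow> int" where
  "barcode_Hil B i = int (size {#b \<in># B. b \<le> i#})"

lemma barcode_Hil_empty [simp]: "barcode_Hil {#} i = 0"
  and barcode_Hil_union [simp]: "barcode_Hil (A + B) i = barcode_Hil A i + barcode_Hil B i"
  and barcode_Hil_add_mset [simp]: "barcode_Hil (add_mset b B) i = (if b \<le> i then 1 else 0) + barcode_Hil B i"
  by (simp_all add: barcode_Hil_def)

text \<open>
  At a minimal element \<open>m\<close> of \<open>A + B\<close> the Hilbert functions are the multiplicities of \<open>m\<close>, so \<open>m\<close>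
  can be removed from both sides.
\<close>

lemma barcode_Hil_inject:
  assumes "\<And>i. barcode_Hil A i = barcode_Hil B i"
  shows "A = B"
  using assms
proof (induction "size A + size B" arbitrary: A B rule: less_induct)
  case less
  show ?case
  proof (cases "A + B = {#}")
    case True then show ?thesis by simp
  next
    case False
    then have ne: "set_mset (A + B) \<noteq> {}" by (metis set_mset_eq_empty_iff)
    obtain m where m: "m \<in># A + B" "\<And>b. b \<in># A + B \<Longrightarrow> b \<le> m \<Longrightarrow> b = m"
      using finite_has_minimal[OF finite_set_mset ne] by metis
    have "{#b \<in># X. b \<le> m#} = {#b \<in># X. b = m#}" if "X \<subseteq># A + B" for X
      using m(2) mset_subset_eqD[OF that] by (intro filter_mset_cong) auto
    from this[of A] this[of B] have "count A m = count B m"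
      using less.prems[of m] by (simp add: barcode_Hil_def filter_eq_replicate_mset)
    then have "m \<in># A" "m \<in># B" using m(1) by (auto simp: count_greater_zero_iff[symmetric] simp del: count_greater_zero_iff)
    then obtain A' B' where AB: "A = add_mset m A'" "B = add_mset m B'" by (meson mset_add)
    have "A' = B'"
      using less.prems unfolding AB by (intro less.hyps) (auto simp: AB)
    then show ?thesis by (simp add: AB)
  qed
qed

section \<open>Finite-dimensional spaces of sequences\<close>

interpretation seq_pair: vector_space_pair
  "seq_scale :: 'k::field \<Rightarrow> (nat \<Rightarrow> 'k) \<Rightarrow> (nat \<Rightarrow> 'k)" seq_scale ..

lemma seq_scale_apply: "seq_scale c x a = c * x a"
  by (simp add: seq_scale_def)

lemma sum_seq_apply: "(\<Sum>a\<in>A. f a :: nat \<Rightarrow> 'k::field) b = (\<Sum>a\<in>A. f a b)"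
  by (induction A rule: infinite_finite_induct) (auto simp: plus_fun_apply)

lemmas seq_apply = seq_scale_apply plus_fun_apply minus_apply uminus_apply sum_seq_apply

text \<open>
  Vectors are functions, and eta-expanded sums of vectors would be rewritten pointwise by the
  default simplification rules; the pointwise rules are used on demand only.
\<close>

declare plus_fun_apply [simp del] minus_apply [simp del] uminus_apply [simp del]

definition unit_seq :: "nat \<Rightarrow> nat \<Rightarrow> 'k::field" where
  "unit_seq a = (\<lambda>b. if b = a then 1 else 0)"

lemma unit_seq_apply [simp]: "unit_seq a b = (if b = a then 1 else 0)"
  by (simp add: unit_seq_def)

lemma seq_expand:
  assumes "finite S" "\<And>a. x a \<noteq> 0 \<Longrightarrow> a \<in> S"
  shows "x = (\<Sum>a\<in>S. seq_scale (x a) (unit_seq a))"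
proof
  fix b
  have "(\<Sum>a\<in>S. x a * (if b = a then 1 else 0)) = (\<Sum>a\<in>S. if b = a then x a else 0)"
    by (intro sum.cong) auto
  also have "\<dots> = x b" using assms by (auto simp: sum.delta')
  finally show "x b = (\<Sum>a\<in>S. seq_scale (x a) (unit_seq a)) b"
    by (simp add: seq_apply)
qed

lemma linear_betweenD:
  assumes "linear_between V W f"
  shows linear_between_in: "x \<in> V \<Longrightarrow> f x \<in> W"
    and linear_between_add: "x \<in> V \<Longrightarrow> y \<in> V \<Longrightarrow> f (x + y) = f x + f y"
    and linear_between_scale: "x \<in> V \<Longrightarrow> f (seq_scale c x) = seq_scale c (f x)"
  using assms by (auto simp: linear_between_def)

lemma linear_between_0:
  assumes "linear_between V W f" "seq.subspace V"
  shows "f 0 = 0"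
  using linear_between_scale[OF assms(1) seq.subspace_0[OF assms(2)], of 0] by simp

lemma linear_between_diff:
  assumes "linear_between V W f" "seq.subspace V" "x \<in> V" "y \<in> V"
  shows "f (x - y) = f x - f y"
proof -
  have "f (x + seq_scale (-1) y) = f x + seq_scale (-1) (f y)"
    using assms linear_between_add[OF assms(1)] linear_between_scale[OF assms(1)] seq.subspace_scale by metis
  then show ?thesis by (simp add: seq.scale_minus_left)
qed

lemma linear_between_sum:
  assumes "linear_between V W f" "seq.subspace V" "\<And>a. a \<in> A \<Longrightarrow> u a \<in> V"
  shows "f (\<Sum>a\<in>A. u a) = (\<Sum>a\<in>A. f (u a))"
  using assms(3)
proof (induction A rule: infinite_finite_induct)
  case (insert a A)
  then show ?case
    using linear_between_add[OF assms(1), of "u a" "sum u A"] seq.subspace_sum[OF assms(2), of A u] by auto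
qed (simp_all add: linear_between_0[OF assms(1,2)])

lemma linear_between_sum_scale:
  assumes "linear_between V W f" "seq.subspace V" "\<And>a. a \<in> A \<Longrightarrow> u a \<in> V"
  shows "f (\<Sum>a\<in>A. seq_scale (c a) (u a)) = (\<Sum>a\<in>A. seq_scale (c a) (f (u a)))"
proof -
  have "f (\<Sum>a\<in>A. seq_scale (c a) (u a)) = (\<Sum>a\<in>A. f (seq_scale (c a) (u a)))"
    using assms by (intro linear_between_sum) (auto intro: seq.subspace_scale)
  also have "\<dots> = (\<Sum>a\<in>A. seq_scale (c a) (f (u a)))"
    using assms by (intro sum.cong) (auto simp: linear_between_scale[OF assms(1)])
  finally show ?thesis .
qed

lemma subspace_kernel_between:
  assumes "linear_between V W f" "seq.subspace V"
  shows "seq.subspace {x \<in> V. f x = 0}"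
  using assms linear_betweenD[OF assms(1)] linear_between_0[OF assms]
  by (intro seq.subspaceI)
    (auto simp: seq.subspace_0[OF assms(2)] seq.subspace_add[OF assms(2)] seq.subspace_scale[OF assms(2)])

lemma linear_between_extend:
  assumes f: "linear_between V W f" and V: "seq.subspace V"
  obtains g where "Vector_Spaces.linear seq_scale seq_scale g" "\<And>x. x \<in> V \<Longrightarrow> g x = f x"
proof -
  obtain B where B: "B \<subseteq> V" "seq.independent B" "V \<subseteq> seq.span B"
    using seq.basis_exists[of V] by metis
  obtain g where g: "Vector_Spaces.linear seq_scale seq_scale g" "\<forall>x\<in>B. g x = f x"
    using seq_pair.linear_independent_extend[OF B(2)] by blast
  interpret g: Vector_Spaces.linear seq_scale seq_scale g by (rule g(1))
  have "seq.subspace {x \<in> V. g x = f x}"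
    using V linear_betweenD[OF f] linear_between_0[OF f V]
    by (intro seq.subspaceI)
      (auto simp: g.add g.scale seq.subspace_0[OF V] seq.subspace_add[OF V] seq.subspace_scale[OF V])
  then have "seq.span B \<subseteq> {x \<in> V. g x = f x}"
    using B g(2) by (intro seq.span_minimal) auto
  then show thesis using that g(1) B(3) by blast
qed

lemma fd_space_subspaceD: "fd_space V \<Longrightarrow> seq.subspace V"
  by (simp add: fd_space_def)

lemma fd_space_sub:
  assumes "fd_space V" "U \<subseteq> V" "seq.subspace U"
  shows "fd_space U"
proof -
  obtain S where S: "finite S" "seq.span S = V" using assms(1) by (auto simp: fd_space_def)
  obtain B where B: "B \<subseteq> U" "seq.independent B" "U \<subseteq> seq.span B"
    using seq.basis_exists[of U] by metis
  have "finite B" using seq.independent_span_bound[OF S(1) B(2)] B(1) assms(2) S(2) by auto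
  moreover have "seq.span B = U" using B assms(3) seq.span_subspace by blast
  ultimately show ?thesis using assms(3) by (auto simp: fd_space_def)
qed

text \<open>
  The ambient sequence space is infinite-dimensional, so the dimension formula is derived for a map
  that is linear on the finite-dimensional subspace \<open>V\<close> only: extend a basis \<open>B\<close> of the kernel to a
  basis \<open>C\<close> of \<open>V\<close>; then the map is injective on the span of \<open>C - B\<close>.
\<close>

lemma rank_nullity:
  assumes V: "fd_space V" and f: "linear_between V W f"
  shows "seq.dim V = seq.dim {x \<in> V. f x = 0} + seq.dim (f ` V)"
proof -
  let ?K = "{x \<in> V. f x = 0}"
  have sV: "seq.subspace V" using V by (rule fd_space_subspaceD)
  obtain S where S: "finite S" "seq.span S = V" using V by (auto simp: fd_space_def)
  obtain B where B: "B \<subseteq> ?K" "seq.independent B" "?K \<subseteq> seq.span B" "card B = seq.dim ?K"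
    by (rule seq.basis_exists)
  obtain C where C: "B \<subseteq> C" "C \<subseteq> V" "seq.independent C" "V \<subseteq> seq.span C"
    using seq.maximal_independent_subset_extend[of B V] B(1,2) by blast
  have fin: "finite C" using seq.independent_span_bound[OF S(1) C(3)] C(2) S(2) by auto
  have spanC: "seq.span C = V" using C sV seq.span_subspace by blast
  obtain g where g: "Vector_Spaces.linear seq_scale seq_scale g" "\<And>x. x \<in> V \<Longrightarrow> g x = f x"
    using linear_between_extend[OF f sV] by blast
  interpret g: Vector_Spaces.linear seq_scale seq_scale g by (rule g(1))
  let ?D = "C - B"
  have indD: "seq.independent ?D" using C(3) seq.independent_mono by blast
  have zero: "x = 0" if x: "x \<in> seq.span ?D" "g x = 0" for x
  proof -
    have xV: "x \<in> V" using x(1) seq.span_mono[of ?D C] spanC by blast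
    then have "x \<in> seq.span B" using B(3) g(2) x(2) by auto
    then have rB: "seq.representation C x = seq.representation B x"
      using C by (intro seq.representation_extend) auto
    have rD: "seq.representation C x = seq.representation ?D x"
      using C x(1) by (intro seq.representation_extend) auto
    have r0: "seq.representation C x b = 0" for b
      using seq.representation_ne_zero[of B x b] seq.representation_ne_zero[of ?D x b] rB rD by auto
    have "(\<Sum>b | seq.representation C x b \<noteq> 0. seq_scale (seq.representation C x b) b) = x"
      using C(3) spanC xV by (intro seq.sum_nonzero_representation_eq) auto
    then show "x = 0" using r0 by simp
  qed
  have inj: "inj_on g (seq.span ?D)"
    using zero by (subst g.inj_on_iff_eq_0) auto
  have ind: "seq.independent (g ` ?D)" using g.independent_injective_image[OF indD inj] .
  have "f ` V = g ` V" using g(2) by auto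
  also have "\<dots> = seq.span (g ` C)" using spanC g.span_image by metis
  also have "\<dots> = seq.span (g ` ?D)"
  proof (rule antisym)
    have "g b = 0" if "b \<in> B" for b using that B(1) g(2) by auto
    then have "g ` C \<subseteq> insert 0 (g ` ?D)" by auto
    then show "seq.span (g ` C) \<subseteq> seq.span (g ` ?D)"
      by (metis seq.span_insert_0 seq.span_mono)
    show "seq.span (g ` ?D) \<subseteq> seq.span (g ` C)" by (intro seq.span_mono) auto
  qed
  finally have "seq.dim (f ` V) = card (g ` ?D)" using seq.dim_span_eq_card_independent[OF ind] by simp
  also have "\<dots> = card ?D" by (rule card_image[OF inj_on_subset[OF inj seq.span_superset]])
  also have "\<dots> = card C - card B" using C(1) fin by (intro card_Diff_subset) (auto intro: finite_subset)
  finally have "seq.dim (f ` V) = card C - card B" .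
  moreover have "seq.dim V = card C" using spanC seq.dim_span_eq_card_independent[OF C(3)] by simp
  moreover have "card B \<le> card C" using C(1) fin by (intro card_mono)
  ultimately show ?thesis using B(4) by simp
qed

lemma dim_subspace_le:
  assumes "fd_space V" "U \<subseteq> V"
  shows "seq.dim U \<le> seq.dim V"
proof -
  obtain S where S: "finite S" "seq.span S = V" using assms(1) by (auto simp: fd_space_def)
  obtain B where B: "B \<subseteq> V" "seq.independent B" "V \<subseteq> seq.span B" "card B = seq.dim V"
    using seq.basis_exists[of V] by metis
  have "finite B" using seq.independent_span_bound[OF S(1) B(2)] B(1) S(2) by auto
  then show ?thesis using seq.dim_le_card[of U B] B assms(2) by auto
qed

lemma dim_zero_space: "seq.dim {0 :: nat \<Rightarrow> 'k::field} = 0"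
proof -
  have "seq.dim (seq.span {} :: (nat \<Rightarrow> 'k) set) = 0"
    using seq.dim_span_eq_card_independent[OF seq.independent_empty] by simp
  then show ?thesis by simp
qed

lemma dim_le_of_injective:
  assumes "fd_space V" "fd_space W" "linear_between V W f" "\<And>x. x \<in> V \<Longrightarrow> f x = 0 \<Longrightarrow> x = 0"
  shows "seq.dim V \<le> seq.dim W"
proof -
  have "{x \<in> V. f x = 0} = {0}"
    using assms linear_between_0[OF assms(3)] fd_space_subspaceD[OF assms(1)] seq.subspace_0 by auto
  then have "seq.dim {x \<in> V. f x = 0} = 0"
    by (simp add: dim_zero_space)
  then have "seq.dim V = seq.dim (f ` V)" using rank_nullity[OF assms(1,3)] by simp
  also have "\<dots> \<le> seq.dim W" using assms by (intro dim_subspace_le) (auto simp: linear_between_def)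
  finally show ?thesis .
qed

definition coord_space :: "nat set \<Rightarrow> (nat \<Rightarrow> 'k::field) set" where
  "coord_space S = {x. \<forall>a. x a \<noteq> 0 \<longrightarrow> a \<in> S}"

lemma subspace_coord_space: "seq.subspace (coord_space S)"
  by (rule seq.subspaceI) (auto simp: coord_space_def seq_apply, metis add_0)

lemma unit_seq_in_coord_space: "a \<in> S \<Longrightarrow> unit_seq a \<in> coord_space S"
  by (auto simp: coord_space_def)

lemma inj_unit_seq: "inj (unit_seq :: nat \<Rightarrow> nat \<Rightarrow> 'k::field)"
  by (rule injI) (metis unit_seq_apply zero_neq_one)

lemma coord_space_basis:
  assumes "finite S"
  shows "seq.span (unit_seq ` S) = (coord_space S :: (nat \<Rightarrow> 'k::field) set)"
    and "seq.independent (unit_seq ` S :: (nat \<Rightarrow> 'k) set)"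
proof -
  have "x \<in> seq.span (unit_seq ` S)" if "x \<in> coord_space S" for x :: "nat \<Rightarrow> 'k"
  proof -
    have "(\<Sum>a\<in>S. seq_scale (x a) (unit_seq a)) \<in> seq.span (unit_seq ` S)"
      by (intro seq.span_sum seq.span_scale seq.span_base) auto
    then show ?thesis using seq_expand[OF assms, of x] that by (simp add: coord_space_def)
  qed
  then show "seq.span (unit_seq ` S) = (coord_space S :: (nat \<Rightarrow> 'k) set)"
    using seq.span_minimal[OF _ subspace_coord_space, of "unit_seq ` S" S] unit_seq_in_coord_space by fastforce
  show "seq.independent (unit_seq ` S :: (nat \<Rightarrow> 'k) set)"
  proof (rule seq.independent_if_scalars_zero)
    show "finite (unit_seq ` S)" using assms by simp
    fix f :: "(nat \<Rightarrow> 'k) \<Rightarrow> 'k" and x :: "nat \<Rightarrow> 'k"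
    assume sum: "(\<Sum>x\<in>unit_seq ` S. seq_scale (f x) x) = 0" and "x \<in> unit_seq ` S"
    then obtain a where a: "a \<in> S" "x = unit_seq a" by auto
    have "0 = (\<Sum>x\<in>unit_seq ` S. seq_scale (f x) x) a" using sum by simp
    also have "\<dots> = (\<Sum>b\<in>S. f (unit_seq b) * (if a = b then 1 else 0))"
      by (simp add: seq_apply sum.reindex[OF inj_on_subset[OF inj_unit_seq subset_UNIV]])
    also have "\<dots> = (\<Sum>b\<in>S. if a = b then f (unit_seq b) else 0)" by (intro sum.cong) auto
    also have "\<dots> = f x" using a assms by (simp add: sum.delta)
    finally show "f x = 0" by simp
  qed
qed

lemma fd_coord_space: "finite S \<Longrightarrow> fd_space (coord_space S)"
  unfolding fd_space_def using subspace_coord_space coord_space_basis(1) by blast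

lemma dim_coord_space:
  assumes "finite S"
  shows "seq.dim (coord_space S :: (nat \<Rightarrow> 'k::field) set) = card S"
proof -
  have "seq.dim (coord_space S :: (nat \<Rightarrow> 'k) set) = card (unit_seq ` S :: (nat \<Rightarrow> 'k) set)"
    using seq.dim_span_eq_card_independent coord_space_basis[OF assms] by metis
  then show ?thesis by (simp add: card_image[OF inj_on_subset[OF inj_unit_seq subset_UNIV]])
qed

section \<open>Morphisms, kernels and lifting\<close>

lemma persistence_moduleD:
  assumes "persistence_module M"
  shows fiber_fd: "fd_space (fiber M i)"
    and fiber_subspace: "seq.subspace (fiber M i)"
    and str_map_linear: "i \<le> j \<Longrightarrow> linear_between (fiber M i) (fiber M j) (str_map M i j)"
    and str_map_trans: "i \<le> j \<Longrightarrow> j \<le> l \<Longrightarrow> x \<in> fiber M i \<Longrightarrow> str_map M j l (str_map M i j x) = str_map M i l x"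
  using assms by (auto simp: persistence_module_def fd_space_def)

lemma str_map_in:
  "persistence_module M \<Longrightarrow> i \<le> j \<Longrightarrow> x \<in> fiber M i \<Longrightarrow> str_map M i j x \<in> fiber M j"
  using str_map_linear linear_between_in by blast

lemma morphismD:
  assumes "morphism M N f"
  shows morphism_linear: "linear_between (fiber M i) (fiber N i) (f i)"
    and morphism_in: "x \<in> fiber M i \<Longrightarrow> f i x \<in> fiber N i"
    and morphism_str: "i \<le> j \<Longrightarrow> x \<in> fiber M i \<Longrightarrow> f j (str_map M i j x) = str_map N i j (f i x)"
  using assms by (auto simp: morphism_def linear_between_def)

lemma morphism_add_scale:
  assumes "morphism M N f"
  shows morphism_add: "x \<in> fiber M i \<Longrightarrow> y \<in> fiber M i \<Longrightarrow> f i (x + y) = f i x + f i y"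
    and morphism_scale: "x \<in> fiber M i \<Longrightarrow> f i (seq_scale c x) = seq_scale c (f i x)"
  using linear_between_add[OF morphism_linear[OF assms]] linear_between_scale[OF morphism_linear[OF assms]] by auto

lemma morphism_diff:
  "morphism M N f \<Longrightarrow> persistence_module M \<Longrightarrow> x \<in> fiber M i \<Longrightarrow> y \<in> fiber M i \<Longrightarrow> f i (x - y) = f i x - f i y"
  using linear_between_diff[OF morphism_linear fiber_subspace] by blast

lemma morphism_zero: "morphism M N f \<Longrightarrow> persistence_module M \<Longrightarrow> f i 0 = 0"
  using linear_between_0[OF morphism_linear fiber_subspace] by blast

lemma morphism_comp:
  assumes "morphism L M f" "morphism M N g"
  shows "morphism L N (\<lambda>i x. g i (f i x))"
  using assms unfolding morphism_def linear_between_def by auto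

lemma morphism_id: "morphism M M (\<lambda>i x. x)"
  by (simp add: morphism_def linear_between_def)

lemma morphism_minus:
  assumes M: "persistence_module M" and N: "persistence_module N" and f: "morphism M N f" and g: "morphism M N g"
  shows "morphism M N (\<lambda>i x. f i x - g i x)"
  unfolding morphism_def linear_between_def
proof (intro conjI allI impI ballI)
  fix i x assume x: "x \<in> fiber M i"
  show "f i x - g i x \<in> fiber N i"
    using x by (intro seq.subspace_diff fiber_subspace N morphism_in[OF f] morphism_in[OF g])
  show "f i (seq_scale c x) - g i (seq_scale c x) = seq_scale c (f i x - g i x)" for c
    using x by (simp add: morphism_scale[OF f] morphism_scale[OF g] seq.scale_right_diff_distrib)
  show "f i (x + y) - g i (x + y) = f i x - g i x + (f i y - g i y)" if "y \<in> fiber M i" for y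
    using x that by (simp add: morphism_add[OF f] morphism_add[OF g])
  show "f j (str_map M i j x) - g j (str_map M i j x) = str_map N i j (f i x - g i x)" if "i \<le> j" for j
    using x that morphism_in[OF f x] morphism_in[OF g x]
    by (simp add: morphism_str[OF f] morphism_str[OF g]
        linear_between_diff[OF str_map_linear[OF N that] fiber_subspace[OF N]])
qed

definition ker_module :: "('k::field, 'p::order) pmod \<Rightarrow> ('k, 'p) pmor \<Rightarrow> ('k, 'p) pmod" where
  "ker_module M f = \<lparr> fiber = (\<lambda>i. {x \<in> fiber M i. f i x = 0}), str_map = str_map M \<rparr>"

lemma ker_module_simps [simp]:
  "fiber (ker_module M f) i = {x \<in> fiber M i. f i x = 0}" "str_map (ker_module M f) = str_map M"
  by (simp_all add: ker_module_def)

lemma persistence_module_ker: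
  assumes M: "persistence_module M" and N: "persistence_module N" and f: "morphism M N f"
  shows "persistence_module (ker_module M f)"
proof -
  have "fd_space {x \<in> fiber M i. f i x = 0}" for i
    by (intro fd_space_sub[OF fiber_fd[OF M]] subspace_kernel_between[OF morphism_linear[OF f] fiber_subspace[OF M]]) auto
  moreover have "linear_between {x \<in> fiber M i. f i x = 0} {x \<in> fiber M j. f j x = 0} (str_map M i j)" if "i \<le> j" for i j
  proof -
    have "f j (str_map M i j x) = 0" if "x \<in> fiber M i" "f i x = 0" for x
      using that \<open>i \<le> j\<close> morphism_str[OF f] linear_between_0[OF str_map_linear[OF N \<open>i \<le> j\<close>] fiber_subspace[OF N]] by simp
    then show ?thesis using str_map_linear[OF M that] by (auto simp: linear_between_def)
  qed
  ultimately show ?thesis using M by (auto simp: persistence_module_def)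
qed

lemma morphism_into_ker:
  "morphism L M g \<Longrightarrow> (\<And>i x. x \<in> fiber L i \<Longrightarrow> f i (g i x) = 0) \<Longrightarrow> morphism L (ker_module M f) g"
  by (simp add: morphism_def linear_between_def)

lemma morphism_out_of_ker: "morphism L (ker_module M f) g \<Longrightarrow> morphism L M g"
  by (simp add: morphism_def linear_between_def)

lemma projective_lift_epi:
  assumes "projective P" "persistence_module X" "persistence_module Y" "epi X Y e" "morphism P Y f"
  shows "\<exists>g. morphism P X g \<and> (\<forall>i. \<forall>x\<in>fiber P i. e i (g i x) = f i x)"
  using assms unfolding projective_def by simp

text \<open>
  The form of projectivity used in comparing resolutions: \<open>\<phi>\<close> maps into the kernel of \<open>g\<close>, which is
  covered by \<open>A\<close>.
\<close>

lemma projective_lift: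
  assumes P: "projective P" and A: "persistence_module A" and B: "persistence_module B" and C: "persistence_module C"
    and f: "morphism A B f" and g: "morphism B C g" and ex: "exact_at A f B g"
    and \<phi>: "morphism P B \<phi>" and 0: "\<And>i x. x \<in> fiber P i \<Longrightarrow> g i (\<phi> i x) = 0"
  shows "\<exists>\<psi>. morphism P A \<psi> \<and> (\<forall>i. \<forall>x\<in>fiber P i. f i (\<psi> i x) = \<phi> i x)"
proof (rule projective_lift_epi[OF P A])
  show "persistence_module (ker_module B g)" using persistence_module_ker[OF B C g] .
  show "epi A (ker_module B g) f"
    unfolding epi_def
  proof (intro conjI allI)
    show "morphism A (ker_module B g) f"
      using f by (rule morphism_into_ker) (use ex in \<open>auto simp: exact_at_def\<close>)
    show "f i ` fiber A i = fiber (ker_module B g) i" for i using ex by (simp add: exact_at_def)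
  qed
  show "morphism P (ker_module B g) \<phi>" using \<phi> 0 by (rule morphism_into_ker)
qed

lemma projective_persistence: "projective P \<Longrightarrow> persistence_module P"
  by (simp add: projective_def)

section \<open>Free modules\<close>

lemma free_module_simps [simp]:
  "fiber (free_module xs) j = coord_space {a. a < length xs \<and> xs ! a \<le> j}"
  "str_map (free_module xs) i j x = x"
  by (simp_all add: free_module_def coord_space_def)

lemma free_fiber_mono:
  fixes i j :: "'p::order"
  assumes ij: "i \<le> j" and x: "x \<in> coord_space {a. a < length xs \<and> xs ! a \<le> i}"
  shows "x \<in> coord_space {a. a < length xs \<and> xs ! a \<le> j}"
  unfolding coord_space_def mem_Collect_eq
proof (intro allI impI)
  fix a assume "x a \<noteq> 0"
  then have "a < length xs" "xs ! a \<le> i" using x by (auto simp: coord_space_def)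
  then show "a < length xs \<and> xs ! a \<le> j" using order_trans[OF _ ij] by simp
qed

lemma persistence_module_free: "persistence_module (free_module xs)"
  unfolding persistence_module_def
  by (auto simp: linear_between_def intro: free_fiber_mono fd_coord_space)

lemma barcode_Hil_mset: "barcode_Hil (mset xs) j = int (card {a. a < length xs \<and> xs ! a \<le> j})"
  by (simp add: barcode_Hil_def length_filter_conv_card flip: mset_filter)

lemma Hil_free: "Hil (free_module xs :: ('k::field, 'p::order) pmod) j = barcode_Hil (mset xs) j"
  by (simp add: Hil_def dim_coord_space barcode_Hil_mset)

lemma Hil_isomorphic:
  assumes M: "persistence_module M" and N: "persistence_module N" and "isomorphic M N"
  shows "Hil M i = Hil N i"
proof -
  obtain f where f: "morphism M N f" "bij_betw (f i) (fiber M i) (fiber N i)"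
    using assms(3) unfolding isomorphic_def by blast
  have 0: "f i 0 = 0" using morphism_zero[OF f(1) M] .
  have inj: "x \<in> fiber M i \<Longrightarrow> f i x = 0 \<Longrightarrow> x = 0" for x
    using f(2) 0 seq.subspace_0[OF fiber_subspace[OF M, of i]] by (metis bij_betw_def inj_onD)
  have "seq.dim (fiber M i) = seq.dim {x \<in> fiber M i. f i x = 0} + seq.dim (f i ` fiber M i)"
    using rank_nullity[OF fiber_fd[OF M] morphism_linear[OF f(1)]] .
  also have "{x \<in> fiber M i. f i x = 0} = {0}"
    using inj 0 seq.subspace_0[OF fiber_subspace[OF M, of i]] by auto
  also have "f i ` fiber M i = fiber N i" using f(2) by (simp add: bij_betw_def)
  also have "seq.dim {0 :: nat \<Rightarrow> 'a} = 0"
    by (rule dim_zero_space)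
  finally show ?thesis by (simp add: Hil_def)
qed

lemma has_barcode_unique:
  fixes P :: "('k::field, 'p::order) pmod"
  assumes "has_barcode P B" "has_barcode P C"
  shows "B = C"
proof (rule barcode_Hil_inject)
  fix i
  have "Hil P i = barcode_Hil D i" if D: "has_barcode P D" for D
    using D Hil_isomorphic persistence_module_free Hil_free unfolding has_barcode_def by metis
  then show "barcode_Hil B i = barcode_Hil C i" using assms by metis
qed

lemma barcode_eq: "has_barcode P B \<Longrightarrow> barcode P = B"
  unfolding barcode_def using has_barcode_unique by blast

lemma Hil_of_barcode:
  "has_barcode P B \<Longrightarrow> Hil P i = barcode_Hil B i"
  using Hil_isomorphic persistence_module_free Hil_free unfolding has_barcode_def by metis

lemma has_barcode_free: "has_barcode (free_module xs) (mset xs)"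
  unfolding has_barcode_def isomorphic_def
  by (intro conjI persistence_module_free exI[of _ xs] exI[of _ "\<lambda>i x. x"] morphism_id allI refl)
    (simp add: bij_betw_def)

lemma free_finite_rank_barcode: "free_finite_rank P \<Longrightarrow> has_barcode P (barcode P)"
  unfolding free_finite_rank_def using barcode_eq by blast

text \<open>The morphism out of a free module that sends the generator \<open>a\<close> to \<open>v a\<close>.\<close>

definition from_gens :: "('k::field, 'p::order) pmod \<Rightarrow> 'p list \<Rightarrow> (nat \<Rightarrow> nat \<Rightarrow> 'k) \<Rightarrow> ('k, 'p) pmor" where
  "from_gens X xs v = (\<lambda>j x. \<Sum>a<length xs. seq_scale (x a) (str_map X (xs ! a) j (v a)))"

text \<open>
  For \<open>x\<close> of degree \<open>j\<close> only generators of degree at most \<open>j\<close> contribute.  The other terms of the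
  sum in the definition evaluate the structure map outside its domain, but with coefficient 0.
\<close>

lemma from_gens_restrict:
  assumes "x \<in> coord_space {a. a < length xs \<and> xs ! a \<le> j}"
  shows "from_gens X xs v j x = (\<Sum>a | a < length xs \<and> xs ! a \<le> j. seq_scale (x a) (str_map X (xs ! a) j (v a)))"
  unfolding from_gens_def using assms
  by (intro sum.mono_neutral_right) (auto simp: coord_space_def)

lemma morphism_from_gens:
  fixes X :: "('k::field, 'p::order) pmod"
  assumes X: "persistence_module X" and v: "\<And>a. a < length xs \<Longrightarrow> v a \<in> fiber X (xs ! a)"
  shows "morphism (free_module xs) X (from_gens X xs v)"
  unfolding morphism_def linear_between_def
proof (intro conjI allI impI ballI)
  fix j and x :: "nat \<Rightarrow> 'k" assume x: "x \<in> fiber (free_module xs) j"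
  then have r: "from_gens X xs v j x = (\<Sum>a | a < length xs \<and> xs ! a \<le> j. seq_scale (x a) (str_map X (xs ! a) j (v a)))"
    by (intro from_gens_restrict) simp
  show "from_gens X xs v j x \<in> fiber X j" unfolding r
    using v by (intro seq.subspace_sum seq.subspace_scale fiber_subspace[OF X]) (auto intro: str_map_in[OF X])
  show "from_gens X xs v j (seq_scale c x) = seq_scale c (from_gens X xs v j x)" for c
    by (simp add: from_gens_def seq_scale_apply seq.scale_sum_right)
  show "from_gens X xs v j (x + y) = from_gens X xs v j x + from_gens X xs v j y" for y
    by (simp add: from_gens_def plus_fun_apply seq.scale_left_distrib sum.distrib)
  fix l assume jl: "j \<le> l"
  have "str_map X j l (from_gens X xs v j x) =
      (\<Sum>a | a < length xs \<and> xs ! a \<le> j. seq_scale (x a) (str_map X j l (str_map X (xs ! a) j (v a))))"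
    unfolding r by (rule linear_between_sum_scale[OF str_map_linear[OF X jl] fiber_subspace[OF X]])
      (auto intro: str_map_in[OF X] v)
  also have "\<dots> = (\<Sum>a | a < length xs \<and> xs ! a \<le> j. seq_scale (x a) (str_map X (xs ! a) l (v a)))"
    using jl v by (intro sum.cong) (auto simp: str_map_trans[OF X])
  also have "\<dots> = from_gens X xs v l x"
    unfolding from_gens_def using x
    by (intro sum.mono_neutral_left) (auto simp: coord_space_def)
  finally show "from_gens X xs v l (str_map (free_module xs) j l x) = str_map X j l (from_gens X xs v j x)" by simp
qed

lemma unit_seq_in_free:
  "a < length xs \<Longrightarrow> xs ! a \<le> j \<Longrightarrow> unit_seq a \<in> fiber (free_module xs) j"
  by (auto intro: unit_seq_in_coord_space)

lemma morphism_free_expand: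
  assumes f: "morphism (free_module xs) X f" and X: "persistence_module X" and x: "x \<in> fiber (free_module xs) j"
  shows "f j x = (\<Sum>a | a < length xs \<and> xs ! a \<le> j. seq_scale (x a) (str_map X (xs ! a) j (f (xs ! a) (unit_seq a))))"
proof -
  let ?S = "{a. a < length xs \<and> xs ! a \<le> j}"
  have "x = (\<Sum>a\<in>?S. seq_scale (x a) (unit_seq a))"
    using x by (intro seq_expand) (auto simp: coord_space_def)
  then have "f j x = (\<Sum>a\<in>?S. seq_scale (x a) (f j (unit_seq a)))"
    using linear_between_sum_scale[OF morphism_linear[OF f] fiber_subspace[OF persistence_module_free], of ?S unit_seq j x]
      unit_seq_in_free by (metis (no_types, lifting) mem_Collect_eq)
  also have "\<dots> = (\<Sum>a\<in>?S. seq_scale (x a) (str_map X (xs ! a) j (f (xs ! a) (unit_seq a))))"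
  proof (intro sum.cong refl)
    fix a assume a: "a \<in> ?S"
    have "f j (unit_seq a) = f j (str_map (free_module xs) (xs ! a) j (unit_seq a))" by simp
    also have "\<dots> = str_map X (xs ! a) j (f (xs ! a) (unit_seq a))"
      using a unit_seq_in_free[of a xs "xs ! a"] by (intro morphism_str[OF f]) auto
    finally show "seq_scale (x a) (f j (unit_seq a)) = seq_scale (x a) (str_map X (xs ! a) j (f (xs ! a) (unit_seq a)))" by simp
  qed
  finally show ?thesis .
qed

lemma projective_free: "projective (free_module xs :: ('k::field, 'p::order) pmod)"
  unfolding projective_def
proof (intro conjI allI impI persistence_module_free)
  fix X Y :: "('k::field, 'p::order) pmod" and e f
  assume "persistence_module X \<and> persistence_module Y \<and> epi X Y e \<and> morphism (free_module xs) Y f"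
  then have X: "persistence_module X" and Y: "persistence_module Y" and e: "epi X Y e"
    and f: "morphism (free_module xs) Y f" by auto
  have e': "morphism X Y e" using e by (simp add: epi_def)
  have "\<exists>u. a < length xs \<longrightarrow> u \<in> fiber X (xs ! a) \<and> e (xs ! a) u = f (xs ! a) (unit_seq a)" for a
  proof (cases "a < length xs")
    case True
    then have "f (xs ! a) (unit_seq a) \<in> fiber Y (xs ! a)" using morphism_in[OF f] unit_seq_in_free by blast
    then show ?thesis using e unfolding epi_def by (metis imageE)
  qed simp
  then obtain v where v: "\<And>a. a < length xs \<Longrightarrow> v a \<in> fiber X (xs ! a) \<and> e (xs ! a) (v a) = f (xs ! a) (unit_seq a)"
    by metis
  have g: "morphism (free_module xs) X (from_gens X xs v)" using v by (intro morphism_from_gens X) auto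
  have "e j (from_gens X xs v j x) = f j x" if x: "x \<in> fiber (free_module xs) j" for j x
  proof -
    let ?S = "{a. a < length xs \<and> xs ! a \<le> j}"
    have "e j (from_gens X xs v j x) = (\<Sum>a\<in>?S. seq_scale (x a) (e j (str_map X (xs ! a) j (v a))))"
      using x v by (subst from_gens_restrict)
        (auto intro!: linear_between_sum_scale[OF morphism_linear[OF e'] fiber_subspace[OF X]] str_map_in[OF X])
    also have "\<dots> = (\<Sum>a\<in>?S. seq_scale (x a) (str_map Y (xs ! a) j (f (xs ! a) (unit_seq a))))"
      using v by (intro sum.cong) (auto simp: morphism_str[OF e'])
    also have "\<dots> = f j x" using morphism_free_expand[OF f Y x] by simp
    finally show ?thesis .
  qed
  then show "\<exists>g. morphism (free_module xs) X g \<and> (\<forall>i. \<forall>x\<in>fiber (free_module xs) i. e i (g i x) = f i x)"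
    using g by blast
qed

section \<open>Minimal covers\<close>

text \<open>
  The degree \<open>j\<close> part of the submodule generated by the images of all lower degrees.
\<close>

definition radical :: "'p::order list \<Rightarrow> 'p \<Rightarrow> (nat \<Rightarrow> 'k::field) set" where
  "radical xs j = coord_space {a. a < length xs \<and> xs ! a < j}"

text \<open>
  Minimality is expressed by the position of the kernel.  This is the form in which it enters the
  comparison of resolutions, and it makes sense without counting generators.
\<close>

definition minimal_cover :: "'p list \<Rightarrow> ('k::field, 'p::order) pmod \<Rightarrow> ('k, 'p) pmor \<Rightarrow> bool" where
  "minimal_cover xs M g \<longleftrightarrow> epi (free_module xs) M g \<and>
     (\<forall>j. \<forall>x\<in>fiber (free_module xs) j. g j x = 0 \<longrightarrow> x \<in> radical xs j)"

lemma epi_morphism: "epi M N f \<Longrightarrow> morphism M N f"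
  by (simp add: epi_def)

lemma epi_surj: "epi M N f \<Longrightarrow> y \<in> fiber N i \<Longrightarrow> \<exists>x\<in>fiber M i. f i x = y"
  unfolding epi_def by (metis imageE)

text \<open>
  The inclusion of the free module without its \<open>a\<close>-th summand.
\<close>

definition insert_zero :: "nat \<Rightarrow> (nat \<Rightarrow> 'k::field) \<Rightarrow> nat \<Rightarrow> 'k" where
  "insert_zero a x = (\<lambda>c. if c < a then x c else if c = a then 0 else x (c - 1))"

lemma morphism_insert_zero:
  fixes xs :: "'p::order list"
  assumes "a < length xs"
  shows "morphism (free_module (take a xs @ drop (Suc a) xs)) (free_module xs) (\<lambda>_. insert_zero a)"
    and "w \<in> fiber (free_module xs) i \<Longrightarrow> w a = 0 \<Longrightarrow>
      \<exists>x \<in> fiber (free_module (take a xs @ drop (Suc a) xs)) i. insert_zero a x = w"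
proof -
  let ?ys = "take a xs @ drop (Suc a) xs"
  have ys: "?ys ! b = xs ! (if b < a then b else Suc b)" if "b < length ?ys" for b
    using that assms by (auto simp: nth_append min_def)
  have len: "length ?ys = length xs - 1" using assms by simp
  have in_fiber: "insert_zero a x \<in> fiber (free_module xs) i" if x: "x \<in> fiber (free_module ?ys) i" for x i
  proof -
    have *: "b < length ?ys \<and> xs ! (if b < a then b else Suc b) \<le> i" if "x b \<noteq> 0" for b
      using x that ys by (auto simp: coord_space_def)
    have "c < length xs \<and> xs ! c \<le> i" if c: "insert_zero a x c \<noteq> 0" for c
    proof (cases "c < a")
      case True then show ?thesis using c *[of c] assms by (auto simp: insert_zero_def)
    next
      case False
      then have "c \<noteq> a" "x (c - 1) \<noteq> 0" using c by (auto simp: insert_zero_def split: if_splits)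
      moreover have "\<not> c - 1 < a" "Suc (c - 1) = c" using False \<open>c \<noteq> a\<close> by auto
      ultimately show ?thesis using *[of "c - 1"] len by auto
    qed
    then show ?thesis by (auto simp: coord_space_def)
  qed
  show "morphism (free_module ?ys) (free_module xs) (\<lambda>_. insert_zero a)"
    unfolding morphism_def linear_between_def
    using in_fiber by (auto simp: insert_zero_def fun_eq_iff seq_apply)
  show "\<exists>x \<in> fiber (free_module ?ys) i. insert_zero a x = w" if w: "w \<in> fiber (free_module xs) i" "w a = 0"
  proof
    let ?x = "\<lambda>b. w (if b < a then b else Suc b)"
    have "b < length ?ys \<and> ?ys ! b \<le> i" if "?x b \<noteq> 0" for b
    proof -
      have "(if b < a then b else Suc b) < length xs \<and> xs ! (if b < a then b else Suc b) \<le> i"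
        using w(1) that by (auto simp: coord_space_def)
      moreover from this have "b < length ?ys" using assms(1) len by (auto split: if_splits)
      ultimately show ?thesis using ys by metis
    qed
    then show "?x \<in> fiber (free_module ?ys) i" by (auto simp: coord_space_def)
    show "insert_zero a ?x = w"
    proof
      fix c
      show "insert_zero a ?x c = w c" using w(2) by (cases "c < a"; cases "c = a") (auto simp: insert_zero_def)
    qed
  qed
qed

text \<open>
  A cover with the least number of generators is minimal: if a relation \<open>x\<close> of degree \<open>j\<close> involves a
  generator \<open>a\<close> of the same degree \<open>j\<close>, then \<open>a\<close> is a combination of the other generators and can
  be dropped.
\<close>

lemma minimal_cover_exists:
  fixes M :: "('k::field, 'p::order) pmod"
  assumes M: "persistence_module M" and g0: "epi (free_module xs0) M g0"
  obtains xs g where "minimal_cover xs M g"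
proof -
  let ?P = "\<lambda>xs. \<exists>g. epi (free_module xs) M g"
  obtain xs where xs: "?P xs" "\<And>ys. ?P ys \<Longrightarrow> length xs \<le> length ys"
    using ex_has_least_nat[of ?P xs0 length] g0 by auto
  obtain g where g: "epi (free_module xs) M g" using xs(1) by blast
  note gm = epi_morphism[OF g]
  have "x \<in> radical xs j" if x: "x \<in> fiber (free_module xs) j" and gx: "g j x = 0" for j x
  proof (rule ccontr)
    assume "x \<notin> radical xs j"
    then obtain a where "x a \<noteq> 0" "\<not> (a < length xs \<and> xs ! a < j)"
      by (auto simp: radical_def coord_space_def)
    then have a: "x a \<noteq> 0" "a < length xs" "xs ! a = j"
      using x by (auto simp: coord_space_def order.order_iff_strict)
    let ?ys = "take a xs @ drop (Suc a) xs"
    let ?\<iota> = "insert_zero a :: (nat \<Rightarrow> 'k) \<Rightarrow> nat \<Rightarrow> 'k"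
    note \<iota> = morphism_insert_zero[OF a(2)]
    have "epi (free_module ?ys) M (\<lambda>i x. g i (?\<iota> x))"
      unfolding epi_def
    proof (intro conjI allI antisym subsetI)
      show m: "morphism (free_module ?ys) M (\<lambda>i x. g i (?\<iota> x))"
        using morphism_comp[OF \<iota>(1) gm] .
      fix i z
      { assume "z \<in> (\<lambda>x. g i (?\<iota> x)) ` fiber (free_module ?ys) i"
        then show "z \<in> fiber M i" using morphism_in[OF m] by blast }
      assume "z \<in> fiber M i"
      then obtain w where w: "w \<in> fiber (free_module xs) i" "g i w = z" using epi_surj[OF g] by blast
      have "\<exists>w'\<in>fiber (free_module xs) i. w' a = 0 \<and> g i w' = z"
      proof (cases "w a = 0")
        case True then show ?thesis using w by blast
      next
        case False
        then have ji: "j \<le> i" using w(1) a by (auto simp: coord_space_def)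
        let ?c = "w a / x a"
        have xi: "x \<in> fiber (free_module xs) i" using x ji free_fiber_mono by auto
        have cxi: "seq_scale ?c x \<in> fiber (free_module xs) i"
          by (intro seq.subspace_scale fiber_subspace persistence_module_free xi)
        have "g i x = str_map M j i (g j x)" using morphism_str[OF gm ji x] by simp
        then have "g i x = 0" using gx linear_between_0[OF str_map_linear[OF M ji] fiber_subspace[OF M]] by simp
        then have "g i (w - seq_scale ?c x) = z"
          using w cxi by (simp add: morphism_diff[OF gm persistence_module_free] morphism_scale[OF gm xi]
              del: free_module_simps)
        moreover have "(w - seq_scale ?c x) a = 0" using a by (simp add: seq_apply)
        moreover have "w - seq_scale ?c x \<in> fiber (free_module xs) i"
          using w(1) cxi by (intro seq.subspace_diff fiber_subspace persistence_module_free)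
        ultimately show ?thesis by (intro bexI[of _ "w - seq_scale ?c x"] conjI)
      qed
      then obtain w' where w': "w' \<in> fiber (free_module xs) i" "w' a = 0" "g i w' = z" by blast
      obtain u where "u \<in> fiber (free_module ?ys) i" "?\<iota> u = w'" using \<iota>(2)[OF w'(1,2)] by (elim bexE) (rule that)
      then show "z \<in> (\<lambda>x. g i (?\<iota> x)) ` fiber (free_module ?ys) i"
        using w'(3) by (intro image_eqI[of _ _ u]) simp_all
    qed
    then have "length xs \<le> length ?ys" using xs(2) by blast
    then show False using a(2) by simp
  qed
  then show thesis using that g unfolding minimal_cover_def by blast
qed

section \<open>Finite generation of kernels\<close>

lemma isomorphic_sym:
  assumes M: "persistence_module M" and N: "persistence_module N" and "isomorphic M N"
  shows "isomorphic N M"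
proof -
  obtain f where f: "morphism M N f" and b: "\<And>i. bij_betw (f i) (fiber M i) (fiber N i)"
    using assms(3) unfolding isomorphic_def by blast
  define g where "g i = inv_into (fiber M i) (f i)" for i
  have gb: "bij_betw (g i) (fiber N i) (fiber M i)" for i
    unfolding g_def using bij_betw_inv_into[OF b] .
  have fg: "f i (g i y) = y" if "y \<in> fiber N i" for i y
    unfolding g_def by (rule bij_betw_inv_into_right[OF b that])
  have gin: "g i y \<in> fiber M i" if "y \<in> fiber N i" for i y using gb that by (auto simp: bij_betw_def)
  have inj: "x = x'" if "f i x = f i x'" "x \<in> fiber M i" "x' \<in> fiber M i" for i x x'
    using that b[of i] by (auto simp: bij_betw_def inj_on_def)
  have "morphism N M g"
    unfolding morphism_def linear_between_def
  proof (intro conjI allI impI ballI)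
    fix i y assume y: "y \<in> fiber N i"
    show "g i y \<in> fiber M i" using gin y .
    show "g i (y + z) = g i y + g i z" if z: "z \<in> fiber N i" for z
    proof (rule inj[of i])
      show "f i (g i (y + z)) = f i (g i y + g i z)"
        using y z by (simp add: fg gin morphism_add[OF f] seq.subspace_add[OF fiber_subspace[OF N]])
    qed (use y z in \<open>auto intro!: gin seq.subspace_add fiber_subspace M N\<close>)
    show "g i (seq_scale c y) = seq_scale c (g i y)" for c
    proof (rule inj[of i])
      show "f i (g i (seq_scale c y)) = f i (seq_scale c (g i y))"
        using y by (simp add: fg gin morphism_scale[OF f] seq.subspace_scale[OF fiber_subspace[OF N]])
    qed (use y in \<open>auto intro!: gin seq.subspace_scale fiber_subspace M N\<close>)
    show "g j (str_map N i j y) = str_map M i j (g i y)" if ij: "i \<le> j" for j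
    proof (rule inj[of j])
      show "f j (g j (str_map N i j y)) = f j (str_map M i j (g i y))"
        using y ij by (simp add: fg gin morphism_str[OF f] str_map_in[OF N])
    qed (use y ij in \<open>auto intro!: gin str_map_in M N\<close>)
  qed
  then show ?thesis unfolding isomorphic_def using gb by blast
qed

lemma finitely_presentable_free_presentation:
  assumes "finitely_presentable M"
  obtains zs ys r q where "morphism (free_module zs) (free_module ys) r" "epi (free_module ys) M q"
    "exact_at (free_module zs) r (free_module ys) q"
proof -
  obtain P Q f g where PQ: "free_finite_rank P" "free_finite_rank Q" and f: "morphism P Q f"
    and g: "epi Q M g" and ex: "exact_at P f Q g"
    using assms unfolding finitely_presentable_def is_cokernel_def by blast
  obtain zs where zs: "persistence_module P" "isomorphic P (free_module zs)"
    using PQ(1) unfolding free_finite_rank_def has_barcode_def by blast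
  obtain ys where ys: "persistence_module Q" "isomorphic Q (free_module ys)"
    using PQ(2) unfolding free_finite_rank_def has_barcode_def by blast
  obtain a where a: "morphism (free_module zs) P a" "\<And>i. bij_betw (a i) (fiber (free_module zs) i) (fiber P i)"
    using isomorphic_sym[OF zs(1) persistence_module_free zs(2)] unfolding isomorphic_def by blast
  obtain b where b: "morphism (free_module ys) Q b" "\<And>i. bij_betw (b i) (fiber (free_module ys) i) (fiber Q i)"
    using isomorphic_sym[OF ys(1) persistence_module_free ys(2)] unfolding isomorphic_def by blast
  let ?q = "\<lambda>i x. g i (b i x)"
  have bi: "b i ` fiber (free_module ys) i = fiber Q i" and ai: "a i ` fiber (free_module zs) i = fiber P i" for i
    using a(2) b(2) by (auto simp only: bij_betw_def)
  have q: "epi (free_module ys) M ?q"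
    unfolding epi_def using morphism_comp[OF b(1) epi_morphism[OF g]] g
    by (metis bi epi_def image_image)
  \<comment> \<open>The map between the covers is the lift of \<open>f\<close> along the surjection \<open>b\<close>.\<close>
  have eb: "epi (free_module ys) Q b" using b(1) bi unfolding epi_def by blast
  have fa: "morphism (free_module zs) Q (\<lambda>i x. f i (a i x))" using morphism_comp[OF a(1) f] .
  obtain r where r: "morphism (free_module zs) (free_module ys) r"
    "\<And>i x. x \<in> fiber (free_module zs) i \<Longrightarrow> b i (r i x) = f i (a i x)"
    using projective_lift_epi[OF projective_free persistence_module_free ys(1) eb fa] by blast
  have "r i ` fiber (free_module zs) i = {y \<in> fiber (free_module ys) i. ?q i y = 0}" for i
  proof (intro antisym subsetI)
    fix y assume "y \<in> r i ` fiber (free_module zs) i"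
    then obtain x where x: "x \<in> fiber (free_module zs) i" "y = r i x" by blast
    have "f i (a i x) \<in> {y \<in> fiber Q i. g i y = 0}"
      using ex ai x(1) unfolding exact_at_def by blast
    then show "y \<in> {y \<in> fiber (free_module ys) i. ?q i y = 0}"
      using x r(2)[OF x(1)] morphism_in[OF r(1) x(1)] by simp
  next
    fix y assume y: "y \<in> {y \<in> fiber (free_module ys) i. ?q i y = 0}"
    then have "b i y \<in> f i ` fiber P i" using ex bi unfolding exact_at_def by blast
    then have "b i y \<in> f i ` (a i ` fiber (free_module zs) i)" unfolding ai .
    then obtain x where x: "x \<in> fiber (free_module zs) i" "b i y = f i (a i x)" by (elim imageE) simp
    then have "b i y = b i (r i x)" using r(2) by simp
    then have "y = r i x" using b(2)[of i] y morphism_in[OF r(1) x(1)] unfolding bij_betw_def inj_on_def by blast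
    then show "y \<in> r i ` fiber (free_module zs) i" using x by blast
  qed
  then show thesis using that r(1) q unfolding exact_at_def by blast
qed

lemma morphism_plus:
  assumes N: "persistence_module N" and f: "morphism M N f" and g: "morphism M N g"
  shows "morphism M N (\<lambda>i x. f i x + g i x)"
  unfolding morphism_def linear_between_def
proof (intro conjI allI impI ballI)
  fix i x assume x: "x \<in> fiber M i"
  show "f i x + g i x \<in> fiber N i"
    using x by (intro seq.subspace_add fiber_subspace N morphism_in[OF f] morphism_in[OF g])
  show "f i (seq_scale c x) + g i (seq_scale c x) = seq_scale c (f i x + g i x)" for c
    using x by (simp add: morphism_scale[OF f] morphism_scale[OF g] seq.scale_right_distrib)
  show "f i (x + y) + g i (x + y) = f i x + g i x + (f i y + g i y)" if "y \<in> fiber M i" for y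
    using x that by (simp add: morphism_add[OF f] morphism_add[OF g])
  show "f j (str_map M i j x) + g j (str_map M i j x) = str_map N i j (f i x + g i x)" if "i \<le> j" for j
    using x that morphism_in[OF f x] morphism_in[OF g x]
    by (simp add: morphism_str[OF f] morphism_str[OF g] linear_between_add[OF str_map_linear[OF N that]])
qed

lemma morphism_copair:
  fixes X :: "('k::field, 'p::order) pmod"
  assumes X: "persistence_module X" and \<alpha>: "morphism (free_module zs) X \<alpha>" and \<beta>: "morphism (free_module xs) X \<beta>"
  obtains \<gamma> where "morphism (free_module (zs @ xs)) X \<gamma>"
    "\<And>i u y. u \<in> fiber (free_module zs) i \<Longrightarrow> y \<in> fiber (free_module xs) i \<Longrightarrow>
        \<exists>x \<in> fiber (free_module (zs @ xs)) i. \<gamma> i x = \<alpha> i u + \<beta> i y"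
proof -
  define \<pi>1 where "\<pi>1 = (\<lambda>(x :: nat \<Rightarrow> 'k) a. if a < length zs then x a else 0)"
  define \<pi>2 where "\<pi>2 = (\<lambda>(x :: nat \<Rightarrow> 'k) a. x (a + length zs))"
  have app: "a < length zs + length xs \<and> (zs @ xs) ! a \<le> i" if "x a \<noteq> 0" "x \<in> fiber (free_module (zs @ xs)) i" for x :: "nat \<Rightarrow> 'k" and a i
    using that by (auto simp: coord_space_def)
  have 1: "morphism (free_module (zs @ xs)) (free_module zs) (\<lambda>_. \<pi>1)"
  proof -
    have "\<pi>1 x \<in> fiber (free_module zs) i" if "x \<in> fiber (free_module (zs @ xs)) i" for x :: "nat \<Rightarrow> 'k" and i
      using app[OF _ that] by (fastforce simp: coord_space_def \<pi>1_def nth_append split: if_splits)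
    then show ?thesis unfolding morphism_def linear_between_def by (auto simp: \<pi>1_def fun_eq_iff seq_apply)
  qed
  have 2: "morphism (free_module (zs @ xs)) (free_module xs) (\<lambda>_. \<pi>2)"
  proof -
    have "\<pi>2 x \<in> fiber (free_module xs) i" if "x \<in> fiber (free_module (zs @ xs)) i" for x :: "nat \<Rightarrow> 'k" and i
      using app[OF _ that] by (fastforce simp: coord_space_def \<pi>2_def nth_append split: if_splits)
    then show ?thesis unfolding morphism_def linear_between_def by (auto simp: \<pi>2_def fun_eq_iff seq_apply)
  qed
  let ?\<gamma> = "\<lambda>i x. \<alpha> i (\<pi>1 x) + \<beta> i (\<pi>2 x)"
  have "morphism (free_module (zs @ xs)) X ?\<gamma>"
    using morphism_plus[OF X morphism_comp[OF 1 \<alpha>] morphism_comp[OF 2 \<beta>]] .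
  moreover have "\<exists>x \<in> fiber (free_module (zs @ xs)) i. ?\<gamma> i x = \<alpha> i u + \<beta> i y"
    if u: "u \<in> fiber (free_module zs) i" and y: "y \<in> fiber (free_module xs) i" for i u y
  proof
    let ?x = "\<lambda>a. if a < length zs then u a else y (a - length zs)"
    show "?x \<in> fiber (free_module (zs @ xs)) i"
      using u y by (auto simp: coord_space_def nth_append)
    have "\<pi>1 ?x = u" "\<pi>2 ?x = y" using u by (auto simp: \<pi>1_def \<pi>2_def coord_space_def fun_eq_iff)
    then show "\<alpha> i (\<pi>1 ?x) + \<beta> i (\<pi>2 ?x) = \<alpha> i u + \<beta> i y" by simp
  qed
  ultimately show thesis using that by blast
qed

text \<open>
  The argument behind Schanuel's lemma.  Compare \<open>p\<close> with a finite presentation \<open>r, q\<close> of \<open>M\<close> by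
  lifts \<open>s\<close> and \<open>t\<close> in both directions.  For \<open>y\<close> in the kernel of \<open>p\<close> the vector \<open>s y\<close> is a relation
  \<open>r u\<close>, so \<open>y = t (r u) + (y - t (s y))\<close>; hence the kernel is generated by the images of the given
  relations together with the vectors \<open>e - t (s e)\<close> for the generators \<open>e\<close>.
\<close>

lemma kernel_of_cover_finitely_generated:
  fixes M :: "('k::field, 'p::order) pmod"
  assumes fp: "finitely_presentable M" and p: "epi (free_module xs) M p"
  obtains zs \<rho> where "epi (free_module zs) (ker_module (free_module xs) p) \<rho>"
proof -
  have M: "persistence_module M" using fp by (simp add: finitely_presentable_def)
  obtain zs ys r q where r: "morphism (free_module zs) (free_module ys) r" and q: "epi (free_module ys) M q"
    and ex: "exact_at (free_module zs) r (free_module ys) q"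
    using finitely_presentable_free_presentation[OF fp] by blast
  note F = persistence_module_free
  note pm = epi_morphism[OF p] and qm = epi_morphism[OF q]
  obtain s where s: "morphism (free_module xs) (free_module ys) s"
    "\<And>i x. x \<in> fiber (free_module xs) i \<Longrightarrow> q i (s i x) = p i x"
    using projective_lift_epi[OF projective_free F M q pm] by blast
  obtain t where t: "morphism (free_module ys) (free_module xs) t"
    "\<And>i x. x \<in> fiber (free_module ys) i \<Longrightarrow> p i (t i x) = q i x"
    using projective_lift_epi[OF projective_free F M p qm] by blast
  let ?K = "ker_module (free_module xs) p"
  have K: "persistence_module ?K" using persistence_module_ker[OF F M pm] .
  have qr: "q i (r i u) = 0" if "u \<in> fiber (free_module zs) i" for i u
    using ex that unfolding exact_at_def by blast
  have \<alpha>: "morphism (free_module zs) ?K (\<lambda>i u. t i (r i u))"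
    using morphism_comp[OF r t(1)]
    by (rule morphism_into_ker) (simp add: t(2) qr morphism_in[OF r] del: free_module_simps)
  have \<beta>: "morphism (free_module xs) ?K (\<lambda>i y. y - t i (s i y))"
  proof (rule morphism_into_ker)
    show "morphism (free_module xs) (free_module xs) (\<lambda>i y. y - t i (s i y))"
      using morphism_minus[OF F F morphism_id morphism_comp[OF s(1) t(1)]] .
    fix i and y :: "nat \<Rightarrow> 'k" assume y: "y \<in> fiber (free_module xs) i"
    then have "t i (s i y) \<in> fiber (free_module xs) i" by (intro morphism_in[OF t(1)] morphism_in[OF s(1)])
    then show "p i (y - t i (s i y)) = 0"
      using y by (simp add: morphism_diff[OF pm F] t(2) s(2) morphism_in[OF s(1)] del: free_module_simps)
  qed
  obtain \<gamma> where \<gamma>: "morphism (free_module (zs @ xs)) ?K \<gamma>"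
    "\<And>i u y. u \<in> fiber (free_module zs) i \<Longrightarrow> y \<in> fiber (free_module xs) i \<Longrightarrow>
        \<exists>x \<in> fiber (free_module (zs @ xs)) i. \<gamma> i x = t i (r i u) + (y - t i (s i y))"
    using morphism_copair[OF K \<alpha> \<beta>] by blast
  have "\<exists>x \<in> fiber (free_module (zs @ xs)) i. \<gamma> i x = y" if y: "y \<in> fiber ?K i" for i y
  proof -
    from y have yF: "y \<in> fiber (free_module xs) i" and py: "p i y = 0" by (simp_all del: free_module_simps)
    have "q i (s i y) = 0" using s(2)[OF yF] py by simp
    then have "s i y \<in> r i ` fiber (free_module zs) i"
      using ex morphism_in[OF s(1) yF] unfolding exact_at_def by blast
    then obtain u where u: "u \<in> fiber (free_module zs) i" "r i u = s i y" by auto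
    show ?thesis using \<gamma>(2)[OF u(1) yF] u(2) by simp
  qed
  then have "epi (free_module (zs @ xs)) ?K \<gamma>"
    unfolding epi_def using \<gamma>(1) morphism_in[OF \<gamma>(1)] by (blast intro: antisym)
  then show thesis using that by blast
qed

section \<open>Comparison of projective resolutions\<close>

text \<open>
  The target of the differential \<open>d k\<close>, which spares a case distinction on the augmentation.
\<close>

definition augmented :: "(nat \<Rightarrow> ('k, 'p) pmod) \<Rightarrow> ('k, 'p) pmod \<Rightarrow> nat \<Rightarrow> ('k, 'p) pmod" where
  "augmented P M k = (case k of 0 \<Rightarrow> M | Suc m \<Rightarrow> P m)"

lemma projective_resolutionD:
  assumes "projective_resolution P d M" "persistence_module M"
  shows resolution_projective: "projective (P k)"
    and resolution_module: "persistence_module (P k)"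
    and augmented_module: "persistence_module (augmented P M k)"
    and resolution_differential: "morphism (P (Suc k)) (P k) (d (Suc k))"
    and augmented_differential: "morphism (P k) (augmented P M k) (d k)"
    and resolution_epi: "epi (P 0) M (d 0)"
    and resolution_exact: "exact_at (P (Suc k)) (d (Suc k)) (P k) (d k)"
proof -
  note res = assms(1)[unfolded projective_resolution_def]
  show 1: "projective (P k)" and "morphism (P (Suc k)) (P k) (d (Suc k))" and e: "epi (P 0) M (d 0)"
    and "exact_at (P (Suc k)) (d (Suc k)) (P k) (d k)" for k using res by simp_all
  show "persistence_module (P k)" using projective_persistence[OF 1] .
  show "persistence_module (augmented P M k)"
    using assms(2) projective_persistence[OF 1] by (cases k) (simp_all add: augmented_def)
  show "morphism (P k) (augmented P M k) (d k)"
    using res epi_morphism[OF e] by (cases k) (simp_all add: augmented_def)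
qed

lemma exact_zero: "exact_at L f M g \<Longrightarrow> x \<in> fiber L i \<Longrightarrow> g i (f i x) = 0"
  unfolding exact_at_def by blast

lemma resolution_lift:
  assumes res: "projective_resolution P d M" and M: "persistence_module M" and Q: "projective Q"
    and \<phi>: "morphism Q (P k) \<phi>" and 0: "\<And>i x. x \<in> fiber Q i \<Longrightarrow> d k i (\<phi> i x) = 0"
  shows "\<exists>\<psi>. morphism Q (P (Suc k)) \<psi> \<and> (\<forall>i. \<forall>x\<in>fiber Q i. d (Suc k) i (\<psi> i x) = \<phi> i x)"
  by (rule projective_lift[OF Q resolution_module[OF res M] resolution_module[OF res M] augmented_module[OF res M]
      resolution_differential[OF res M] augmented_differential[OF res M] resolution_exact[OF res M] \<phi> 0])

text \<open>
  Each step of the construction depends on the previous one only through the fact that the previous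
  map carries cycles to cycles, which is therefore the invariant of the dependent choice.
\<close>

lemma chain_map_exists:
  assumes res: "projective_resolution P d M" and res': "projective_resolution P' d' M" and M: "persistence_module M"
  obtains f where "\<forall>k. morphism (P k) (P' k) (f k)"
    "\<forall>i. \<forall>x\<in>fiber (P 0) i. d' 0 i (f 0 i x) = d 0 i x"
    "\<forall>k i. \<forall>x\<in>fiber (P (Suc k)) i. d' (Suc k) i (f (Suc k) i x) = f k i (d (Suc k) i x)"
proof -
  let ?A = "\<lambda>k \<phi>. morphism (P k) (P' k) \<phi> \<and>
      (\<forall>i. \<forall>x\<in>fiber (P k) i. d k i x = 0 \<longrightarrow> d' k i (\<phi> i x) = 0) \<and>
      (k = 0 \<longrightarrow> (\<forall>i. \<forall>x\<in>fiber (P 0) i. d' 0 i (\<phi> i x) = d 0 i x))"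
  let ?B = "\<lambda>k \<phi> \<phi>'. \<forall>i. \<forall>x\<in>fiber (P (Suc k)) i. d' (Suc k) i (\<phi>' i x) = \<phi> i (d (Suc k) i x)"
  have "\<exists>f. \<forall>k. ?A k (f k) \<and> ?B k (f k) (f (Suc k))"
  proof (rule dependent_nat_choice)
    have "\<exists>\<phi>. morphism (P 0) (P' 0) \<phi> \<and> (\<forall>i. \<forall>x\<in>fiber (P 0) i. d' 0 i (\<phi> i x) = d 0 i x)"
      using projective_lift_epi[OF resolution_projective[OF res M] resolution_module[OF res' M] M
          resolution_epi[OF res' M] epi_morphism[OF resolution_epi[OF res M]]] .
    then show "\<exists>\<phi>. ?A 0 \<phi>" by auto
  next
    fix \<phi> k assume A: "?A k \<phi>"
    then have \<phi>: "morphism (P k) (P' k) \<phi>" by blast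
    have "\<exists>\<psi>. morphism (P (Suc k)) (P' (Suc k)) \<psi> \<and>
        (\<forall>i. \<forall>x\<in>fiber (P (Suc k)) i. d' (Suc k) i (\<psi> i x) = \<phi> i (d (Suc k) i x))"
    proof (rule resolution_lift[OF res' M resolution_projective[OF res M]])
      show "morphism (P (Suc k)) (P' k) (\<lambda>i x. \<phi> i (d (Suc k) i x))"
        using morphism_comp[OF resolution_differential[OF res M] \<phi>] .
      show "d' k i (\<phi> i (d (Suc k) i x)) = 0" if "x \<in> fiber (P (Suc k)) i" for i x
        using A that morphism_in[OF resolution_differential[OF res M] that]
          exact_zero[OF resolution_exact[OF res M] that] by blast
    qed
    then obtain \<psi> where \<psi>: "morphism (P (Suc k)) (P' (Suc k)) \<psi>" "?B k \<phi> \<psi>" by blast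
    have "d' (Suc k) i (\<psi> i x) = 0" if "x \<in> fiber (P (Suc k)) i" "d (Suc k) i x = 0" for i x
      using \<psi>(2) that morphism_zero[OF \<phi> resolution_module[OF res M]] by simp
    then show "\<exists>\<psi>. ?A (Suc k) \<psi> \<and> ?B k \<phi> \<psi>" using \<psi> by auto
  qed
  then obtain f where f: "\<forall>k. ?A k (f k) \<and> ?B k (f k) (f (Suc k))" by (rule exE)
  show thesis
  proof (rule that)
    show "\<forall>k. morphism (P k) (P' k) (f k)" using f by simp
    show "\<forall>i. \<forall>x\<in>fiber (P 0) i. d' 0 i (f 0 i x) = d 0 i x" using spec[OF f, of 0] by simp
    show "\<forall>k i. \<forall>x\<in>fiber (P (Suc k)) i. d' (Suc k) i (f (Suc k) i x) = f k i (d (Suc k) i x)"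
      using f by simp
  qed
qed

text \<open>
  Here the invariant is that \<open>\<phi> - d h\<close> vanishes on cycles, so that
  \<open>\<phi> - h d\<close> takes values in cycles one step further.
\<close>

lemma null_homotopy_exists:
  assumes res: "projective_resolution P d M" and M: "persistence_module M"
    and \<phi>: "\<And>k. morphism (P k) (P k) (\<phi> k)"
    and \<phi>0: "\<And>i x. x \<in> fiber (P 0) i \<Longrightarrow> d 0 i (\<phi> 0 i x) = 0"
    and \<phi>d: "\<And>k i x. x \<in> fiber (P (Suc k)) i \<Longrightarrow> d (Suc k) i (\<phi> (Suc k) i x) = \<phi> k i (d (Suc k) i x)"
  obtains h where "\<forall>k. morphism (P k) (P (Suc k)) (h k)"
    "\<forall>i. \<forall>x\<in>fiber (P 0) i. d 1 i (h 0 i x) = \<phi> 0 i x"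
    "\<forall>k i. \<forall>x\<in>fiber (P (Suc k)) i.
       d (Suc (Suc k)) i (h (Suc k) i x) = \<phi> (Suc k) i x - h k i (d (Suc k) i x)"
proof -
  note Pm = resolution_module[OF res M] and dm = resolution_differential[OF res M]
    and ex = resolution_exact[OF res M]
  let ?A = "\<lambda>k \<eta>. morphism (P k) (P (Suc k)) \<eta> \<and>
      (\<forall>i. \<forall>x\<in>fiber (P k) i. d k i x = 0 \<longrightarrow> d (Suc k) i (\<eta> i x) = \<phi> k i x) \<and>
      (k = 0 \<longrightarrow> (\<forall>i. \<forall>x\<in>fiber (P 0) i. d 1 i (\<eta> i x) = \<phi> 0 i x))"
  let ?B = "\<lambda>k \<eta> \<eta>'. \<forall>i. \<forall>x\<in>fiber (P (Suc k)) i. d (Suc (Suc k)) i (\<eta>' i x) = \<phi> (Suc k) i x - \<eta> i (d (Suc k) i x)"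
  have "\<exists>h. \<forall>k. ?A k (h k) \<and> ?B k (h k) (h (Suc k))"
  proof (rule dependent_nat_choice)
    have "\<exists>\<eta>. morphism (P 0) (P (Suc 0)) \<eta> \<and> (\<forall>i. \<forall>x\<in>fiber (P 0) i. d (Suc 0) i (\<eta> i x) = \<phi> 0 i x)"
      using \<phi>0 by (intro resolution_lift[OF res M resolution_projective[OF res M] \<phi>])
    then show "\<exists>\<eta>. ?A 0 \<eta>" by auto
  next
    fix \<eta> k assume A: "?A k \<eta>"
    then have \<eta>: "morphism (P k) (P (Suc k)) \<eta>" by blast
    have "\<exists>\<psi>. morphism (P (Suc k)) (P (Suc (Suc k))) \<psi> \<and>
        (\<forall>i. \<forall>x\<in>fiber (P (Suc k)) i. d (Suc (Suc k)) i (\<psi> i x) = \<phi> (Suc k) i x - \<eta> i (d (Suc k) i x))"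
    proof (rule resolution_lift[OF res M resolution_projective[OF res M]])
      show "morphism (P (Suc k)) (P (Suc k)) (\<lambda>i x. \<phi> (Suc k) i x - \<eta> i (d (Suc k) i x))"
        using morphism_minus[OF Pm Pm \<phi> morphism_comp[OF dm \<eta>]] .
      fix i x assume x: "x \<in> fiber (P (Suc k)) i"
      let ?y = "d (Suc k) i x"
      have y: "?y \<in> fiber (P k) i" using morphism_in[OF dm x] .
      have "d (Suc k) i (\<phi> (Suc k) i x - \<eta> i ?y) = d (Suc k) i (\<phi> (Suc k) i x) - d (Suc k) i (\<eta> i ?y)"
        using morphism_in[OF \<phi> x] morphism_in[OF \<eta> y] by (intro morphism_diff[OF dm Pm])
      also have "d (Suc k) i (\<eta> i ?y) = \<phi> k i ?y"
        using A y exact_zero[OF ex x] by blast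
      finally show "d (Suc k) i (\<phi> (Suc k) i x - \<eta> i ?y) = 0" by (simp only: \<phi>d[OF x] diff_self)
    qed
    then obtain \<psi> where \<psi>: "morphism (P (Suc k)) (P (Suc (Suc k))) \<psi>" "?B k \<eta> \<psi>" by blast
    have "d (Suc (Suc k)) i (\<psi> i x) = \<phi> (Suc k) i x" if "x \<in> fiber (P (Suc k)) i" "d (Suc k) i x = 0" for i x
      using \<psi>(2) that morphism_zero[OF \<eta> Pm] by simp
    then show "\<exists>\<psi>. ?A (Suc k) \<psi> \<and> ?B k \<eta> \<psi>" using \<psi> by auto
  qed
  then obtain h where h: "\<forall>k. ?A k (h k) \<and> ?B k (h k) (h (Suc k))" by (rule exE)
  show thesis
  proof (rule that)
    show "\<forall>k. morphism (P k) (P (Suc k)) (h k)" using h by simp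
    show "\<forall>i. \<forall>x\<in>fiber (P 0) i. d 1 i (h 0 i x) = \<phi> 0 i x" using spec[OF h, of 0] by simp
    show "\<forall>k i. \<forall>x\<in>fiber (P (Suc k)) i.
        d (Suc (Suc k)) i (h (Suc k) i x) = \<phi> (Suc k) i x - h k i (d (Suc k) i x)"
      using h by simp
  qed
qed

section \<open>Minimality of resolutions\<close>

lemma radical_subspace: "seq.subspace (radical xs j)"
  by (simp add: radical_def subspace_coord_space)

text \<open>
  A generator of degree less than \<open>j\<close> is sent to a combination of generators of degree less than \<open>j\<close>.
\<close>

lemma morphism_radical:
  assumes f: "morphism (free_module xs) (free_module ys) f" and x: "x \<in> radical xs j"
  shows "f j x \<in> radical ys j"
proof -
  have xF: "x \<in> fiber (free_module xs) j" using x by (auto simp: radical_def coord_space_def less_imp_le)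
  have "seq_scale (x a) (f (xs ! a) (unit_seq a)) \<in> radical ys j" if a: "a < length xs" "xs ! a \<le> j" for a
  proof (cases "x a = 0")
    case True
    then show ?thesis using seq.subspace_0[OF radical_subspace] by simp
  next
    case False
    then have less: "xs ! a < j" using x by (auto simp: radical_def coord_space_def)
    have "f (xs ! a) (unit_seq a) \<in> fiber (free_module ys) (xs ! a)"
      using morphism_in[OF f] unit_seq_in_free[OF a(1) order_refl] by blast
    then have "f (xs ! a) (unit_seq a) \<in> radical ys j"
      using less by (auto simp: radical_def coord_space_def intro: le_less_trans)
    then show ?thesis by (intro seq.subspace_scale radical_subspace)
  qed
  then show ?thesis
    unfolding morphism_free_expand[OF f persistence_module_free xF]
    by (intro seq.subspace_sum radical_subspace) auto
qed

text \<open>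
  An endomorphism with values in the radical is strictly triangular for the order of the labels, so it has
  no nonzero fixed vectors.
\<close>

lemma radical_endomorphism_fixes_only_zero:
  assumes \<phi>: "morphism (free_module xs) (free_module xs) \<phi>"
    and rad: "\<And>j x. x \<in> fiber (free_module xs) j \<Longrightarrow> \<phi> j x \<in> radical xs j"
    and x: "x \<in> fiber (free_module xs) j" and fixed: "\<phi> j x = x"
  shows "x = 0"
proof (rule ccontr)
  assume "x \<noteq> 0"
  then obtain a0 where "x a0 \<noteq> 0" by (auto simp: fun_eq_iff)
  let ?S = "{a. x a \<noteq> 0}"
  have S: "?S \<subseteq> {..<length xs}" using x by (auto simp: coord_space_def)
  have "finite ((!) xs ` ?S)" "(!) xs ` ?S \<noteq> {}"
    using finite_subset[OF S] \<open>x a0 \<noteq> 0\<close> by auto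
  then obtain m where m: "m \<in> (!) xs ` ?S" "\<And>b. b \<in> (!) xs ` ?S \<Longrightarrow> m \<le> b \<Longrightarrow> b = m"
    using finite_has_maximal by metis
  then obtain a where a: "x a \<noteq> 0" "xs ! a = m" by blast
  have "x a = (\<Sum>b | b < length xs \<and> xs ! b \<le> j. x b * \<phi> (xs ! b) (unit_seq b) a)"
    by (subst fixed[symmetric], subst morphism_free_expand[OF \<phi> persistence_module_free x])
      (simp add: seq_apply)
  also have "\<dots> = 0"
  proof (intro sum.neutral ballI)
    fix b assume b: "b \<in> {b. b < length xs \<and> xs ! b \<le> j}"
    show "x b * \<phi> (xs ! b) (unit_seq b) a = 0"
    proof (rule ccontr)
      assume nz: "x b * \<phi> (xs ! b) (unit_seq b) a \<noteq> 0"
      have "\<phi> (xs ! b) (unit_seq b) \<in> radical xs (xs ! b)"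
        using b unit_seq_in_free[of b xs] by (intro rad) auto
      then have "xs ! a < xs ! b" using nz by (auto simp: radical_def coord_space_def)
      moreover have "xs ! b \<in> (!) xs ` ?S" using nz by auto
      ultimately show False using m(2)[of "xs ! b"] a(2) by (metis less_imp_le less_irrefl)
    qed
  qed
  finally show False using a(1) by simp
qed

lemma finite_upper_bound: "finite S \<Longrightarrow> \<exists>J. \<forall>i\<in>S. i \<le> (J :: 'p::semilattice_sup)"
proof (induction S rule: finite_induct)
  case (insert a S)
  then obtain J where "\<forall>i\<in>S. i \<le> J" by blast
  then show ?case by (intro exI[of _ "sup a J"]) (auto intro: le_supI2)
qed simp

lemma barcode_Hil_le_size: "barcode_Hil B i \<le> int (size B)"
  by (simp add: barcode_Hil_def size_filter_mset_lesseq)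

lemma free_rank_free [simp]: "free_rank (free_module xs) = length xs"
  by (simp add: free_rank_def barcode_eq[OF has_barcode_free])

text \<open>
  Let \<open>f\<close> and \<open>g\<close> be comparison maps to another resolution and back.  Then \<open>x - g (f x)\<close> is
  null-homotopic, hence of the form \<open>d (h x) + h (d x)\<close>; by assumption the image of every
  differential lies in the radical, and morphisms preserve the radical, so \<open>x - g (f x)\<close> lies in
  the radical.  Therefore \<open>f x = 0\<close> forces \<open>x = 0\<close>.  In a degree above all labels the
  injectivity of \<open>f\<close> compares the ranks.
\<close>

lemma radical_resolution_minimal:
  fixes M :: "('k::field, 'p::semilattice_sup) pmod"
  assumes res: "projective_resolution (\<lambda>k. free_module (xs k)) d M" and M: "persistence_module M"
    and rad: "\<And>k j x. x \<in> fiber (free_module (xs k)) j \<Longrightarrow> d k j x = 0 \<Longrightarrow> x \<in> radical (xs k) j"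
  shows "minimal_projective_resolution (\<lambda>k. free_module (xs k)) d M"
  unfolding minimal_projective_resolution_def
proof (intro conjI allI impI res)
  let ?P = "\<lambda>k. free_module (xs k) :: ('k, 'p) pmod"
  fix k
  show "free_finite_rank (?P k)" unfolding free_finite_rank_def using has_barcode_free by blast
  fix P' d' assume "projective_resolution P' d' M \<and> free_finite_rank (P' k)"
  then have res': "projective_resolution P' d' M" and fr: "free_finite_rank (P' k)" by auto
  note Pm = resolution_module[OF res M] and Pm' = resolution_module[OF res' M]
    and dm = resolution_differential[OF res M] and dm' = resolution_differential[OF res' M]
  obtain f where f': "\<forall>k. morphism (?P k) (P' k) (f k)"
    "\<forall>i. \<forall>x\<in>fiber (?P 0) i. d' 0 i (f 0 i x) = d 0 i x"
    "\<forall>k i. \<forall>x\<in>fiber (?P (Suc k)) i. d' (Suc k) i (f (Suc k) i x) = f k i (d (Suc k) i x)"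
    by (rule chain_map_exists[OF res res' M])
  note f = f'[rule_format]
  obtain g where g': "\<forall>k. morphism (P' k) (?P k) (g k)"
    "\<forall>i. \<forall>x\<in>fiber (P' 0) i. d 0 i (g 0 i x) = d' 0 i x"
    "\<forall>k i. \<forall>x\<in>fiber (P' (Suc k)) i. d (Suc k) i (g (Suc k) i x) = g k i (d' (Suc k) i x)"
    by (rule chain_map_exists[OF res' res M])
  note g = g'[rule_format]
  define \<phi> where "\<phi> k i x = x - g k i (f k i x)" for k i x
  have gf: "morphism (?P k) (?P k) (\<lambda>i x. g k i (f k i x))" for k using morphism_comp[OF f(1) g(1)] .
  have \<phi>: "morphism (?P k) (?P k) (\<phi> k)" for k
    unfolding \<phi>_def using morphism_minus[OF Pm Pm morphism_id gf] .
  have d\<phi>0: "d 0 i (\<phi> 0 i x) = 0" if x: "x \<in> fiber (?P 0) i" for i x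
    using x morphism_diff[OF epi_morphism[OF resolution_epi[OF res M]] Pm x morphism_in[OF gf x]]
      f(2)[OF x] g(2)[OF morphism_in[OF f(1) x]] by (simp add: \<phi>_def)
  have d\<phi>: "d (Suc k) i (\<phi> (Suc k) i x) = \<phi> k i (d (Suc k) i x)" if x: "x \<in> fiber (?P (Suc k)) i" for k i x
    using morphism_diff[OF dm Pm x morphism_in[OF gf x]]
      f(3)[OF x] g(3)[OF morphism_in[OF f(1) x]] by (simp add: \<phi>_def)
  obtain h where h': "\<forall>k. morphism (?P k) (?P (Suc k)) (h k)"
    "\<forall>i. \<forall>x\<in>fiber (?P 0) i. d 1 i (h 0 i x) = \<phi> 0 i x"
    "\<forall>k i. \<forall>x\<in>fiber (?P (Suc k)) i.
       d (Suc (Suc k)) i (h (Suc k) i x) = \<phi> (Suc k) i x - h k i (d (Suc k) i x)"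
    by (rule null_homotopy_exists[where P = ?P and d = d and M = M and \<phi> = \<phi>, OF res M \<phi> d\<phi>0 d\<phi>])
  note h = h'[rule_format]
  have dh: "d (Suc k) i (h k i x) \<in> radical (xs k) i" if x: "x \<in> fiber (?P k) i" for k i x
  proof (rule rad)
    have hx: "h k i x \<in> fiber (?P (Suc k)) i" using morphism_in[OF h(1) x] .
    show "d (Suc k) i (h k i x) \<in> fiber (?P k) i" using morphism_in[OF dm hx] .
    show "d k i (d (Suc k) i (h k i x)) = 0" using exact_zero[OF resolution_exact[OF res M] hx] .
  qed
  have \<phi>rad: "\<phi> k i x \<in> radical (xs k) i" if x: "x \<in> fiber (?P k) i" for i x
  proof (cases k)
    case 0
    then show ?thesis using h(2) dh[of x k i] x by simp
  next
    case (Suc m)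
    have x': "x \<in> fiber (?P (Suc m)) i" using x Suc by simp
    have "d (Suc m) i x \<in> fiber (?P m) i" using morphism_in[OF dm x'] .
    moreover have "d m i (d (Suc m) i x) = 0" using exact_zero[OF resolution_exact[OF res M] x'] .
    ultimately have "d (Suc m) i x \<in> radical (xs m) i" by (rule rad)
    then have "h m i (d (Suc m) i x) \<in> radical (xs (Suc m)) i" by (rule morphism_radical[OF h(1)])
    moreover have "\<phi> k i x = d (Suc k) i (h k i x) + h m i (d (Suc m) i x)"
      using h(3)[OF x'] Suc by simp
    ultimately show ?thesis using dh[OF x] Suc by (simp add: seq.subspace_add[OF radical_subspace])
  qed
  obtain J where J: "\<forall>i\<in>set (xs k). i \<le> J" using finite_upper_bound[of "set (xs k)"] by auto
  have "f k J x = 0 \<Longrightarrow> x = 0" if x: "x \<in> fiber (?P k) J" for x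
  proof (rule radical_endomorphism_fixes_only_zero[OF \<phi> \<phi>rad x])
    assume "f k J x = 0"
    then show "\<phi> k J x = x" using morphism_zero[OF g(1) Pm'] by (simp add: \<phi>_def)
  qed
  then have "seq.dim (fiber (?P k) J) \<le> seq.dim (fiber (P' k) J)"
    by (intro dim_le_of_injective[OF fiber_fd[OF Pm] fiber_fd[OF Pm'] morphism_linear[OF f(1)]])
  then have "Hil (?P k) J \<le> Hil (P' k) J" by (simp add: Hil_def)
  also have "\<dots> \<le> int (free_rank (P' k))"
    using Hil_of_barcode[OF free_finite_rank_barcode[OF fr]] barcode_Hil_le_size by (simp add: free_rank_def)
  finally have "Hil (?P k) J \<le> int (free_rank (P' k))" .
  moreover have "Hil (?P k) J = int (length (xs k))"
  proof -
    have "{a. a < length (xs k) \<and> xs k ! a \<le> J} = {..<length (xs k)}" using J by auto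
    then show ?thesis by (simp add: Hil_free barcode_Hil_mset)
  qed
  ultimately show "free_rank (?P k) \<le> free_rank (P' k)" by simp
qed

section \<open>Kernels of maps of free modules in at most two parameters\<close>

text \<open>
  A valuation \<open>dg a\<close> on \<open>W\<close> amounts to a filtration of \<open>W\<close>, and the lemma is the classical fact
  that two filtrations of a vector space have a common adapted basis; it fails for three of them.

  A basis for which the sum of all valuations of its elements is least is adapted.  Otherwise some
  \<open>x\<close> is smaller in a direction \<open>a\<close> than some basis element occurring in it.  Let \<open>y\<close> be the part of the
  expansion of \<open>x\<close> that is supported on the elements \<open>S\<close> of largest value in direction \<open>a\<close>.  As \<open>y\<close> is the
  difference of \<open>x\<close> and a combination of elements of smaller value, it is smaller than the elements of
  \<open>S\<close> in direction \<open>a\<close>, and in the one remaining direction it is at most the largest value on \<open>S\<close>.  An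
  element of \<open>S\<close> at which this largest value is attained can be exchanged for \<open>y\<close>.
\<close>

lemma adapted_basis_exists:
  fixes dg :: "'c::finite \<Rightarrow> (nat \<Rightarrow> 'k::field) \<Rightarrow> nat"
  assumes W: "fd_space W" and card: "CARD('c) \<le> 2"
    and add: "\<And>a x y. dg a (x + y) \<le> max (dg a x) (dg a y)"
    and scale: "\<And>a c x. dg a (seq_scale c x) \<le> dg a x"
    and zero: "\<And>a. dg a 0 = 0"
  obtains B where "finite B" "seq.independent B" "seq.span B = W"
    "\<And>a x b. x \<in> W \<Longrightarrow> seq.representation B x b \<noteq> 0 \<Longrightarrow> dg a b \<le> dg a x"
proof -
  have dg_sum: "dg a (\<Sum>b\<in>A. seq_scale (r b) b) \<le> m" if "\<And>b. b \<in> A \<Longrightarrow> dg a b \<le> m" for a A r m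
    using that
  proof (induction A rule: infinite_finite_induct)
    case (insert b A)
    have "dg a (seq_scale (r b) b + (\<Sum>b\<in>A. seq_scale (r b) b)) \<le>
        max (dg a (seq_scale (r b) b)) (dg a (\<Sum>b\<in>A. seq_scale (r b) b))" by (rule add)
    also have "\<dots> \<le> m" using insert scale[of a "r b" b] order_trans by auto
    finally show ?case using insert by simp
  qed (simp_all add: zero)
  have dg_diff: "dg a (x - y) \<le> max (dg a x) (dg a y)" for a x y
    using add[of a x "seq_scale (-1) y"] scale[of a "-1" y] by (simp add: max_def split: if_splits)
  \<comment> \<open>A basis at which \<open>\<Phi>\<close> is least will turn out to be adapted.\<close>
  define \<Phi> where "\<Phi> B = (\<Sum>b\<in>B. \<Sum>a\<in>UNIV. dg a b)" for B
  let ?basis = "\<lambda>B. finite B \<and> seq.independent B \<and> seq.span B = W"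
  have sW: "seq.subspace W" using W by (rule fd_space_subspaceD)
  have "\<exists>B. ?basis B"
  proof -
    obtain S where S: "finite S" "seq.span S = W" using W by (auto simp: fd_space_def)
    obtain B where B: "B \<subseteq> W" "seq.independent B" "W \<subseteq> seq.span B" "card B = seq.dim W"
      by (rule seq.basis_exists)
    have "finite B" using seq.independent_span_bound[OF S(1) B(2)] B(1) S(2) by auto
    moreover have "seq.span B = W" using B sW seq.span_subspace by blast
    ultimately show ?thesis using B(2) by blast
  qed
  then obtain B where B: "?basis B" and min: "\<And>B'. ?basis B' \<Longrightarrow> \<Phi> B \<le> \<Phi> B'"
    using ex_has_least_nat[of ?basis _ \<Phi>] by blast
  have BW: "B \<subseteq> W" using B seq.span_superset by blast
  have "dg a b \<le> dg a x" if x: "x \<in> W" and b: "seq.representation B x b \<noteq> 0" for a x b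
  proof (rule ccontr)
    assume "\<not> dg a b \<le> dg a x"
    define r where "r = seq.representation B x"
    define S0 where "S0 = {b. r b \<noteq> 0}"
    have S0B: "S0 \<subseteq> B" unfolding S0_def r_def using seq.representation_ne_zero by blast
    then have fin0: "finite S0" using B finite_subset by blast
    have xsum: "x = (\<Sum>b\<in>S0. seq_scale (r b) b)"
      unfolding S0_def r_def using B x by (subst seq.sum_nonzero_representation_eq) auto
    define p where "p = Max (dg a ` S0)"
    have b0: "b \<in> S0" using b by (simp add: S0_def r_def)
    have le_p: "dg a b' \<le> p" if "b' \<in> S0" for b' unfolding p_def using fin0 that by simp
    have xp: "dg a x < p" using le_p[OF b0] \<open>\<not> dg a b \<le> dg a x\<close> by simp
    define S where "S = {b \<in> S0. dg a b = p}"
    have fin: "finite S" using fin0 by (simp add: S_def)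
    have "p \<in> dg a ` S0" unfolding p_def using fin0 b0 by (intro Max_in) auto
    then have ne: "S \<noteq> {}" by (auto simp: S_def)
    \<comment> \<open>There is at most one direction besides \<open>a\<close>, so a single element can be maximal in all of them.\<close>
    have "\<exists>b0\<in>S. \<forall>c. c \<noteq> a \<longrightarrow> (\<forall>b\<in>S. dg c b \<le> dg c b0)"
    proof (cases "\<exists>c. c \<noteq> a")
      case False
      then show ?thesis using ne by blast
    next
      case True
      then obtain c where c: "c \<noteq> a" by blast
      have uniq: "c' = c" if "c' \<noteq> a" for c'
      proof (rule ccontr)
        assume "c' \<noteq> c"
        then have "card {a, c, c'} = 3" using c that by simp
        then show False using card_mono[of UNIV "{a, c, c'}"] card by simp
      qed
      have "Max (dg c ` S) \<in> dg c ` S" using fin ne by (intro Max_in) auto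
      then obtain b0 where "b0 \<in> S" "dg c b0 = Max (dg c ` S)" by auto
      then have "b0 \<in> S \<and> (\<forall>b\<in>S. dg c b \<le> dg c b0)" using fin by simp
      then show ?thesis using uniq by blast
    qed
    then obtain b0 where b0: "b0 \<in> S" "\<And>c b. c \<noteq> a \<Longrightarrow> b \<in> S \<Longrightarrow> dg c b \<le> dg c b0" by blast
    have b0B: "b0 \<in> B" and rb0: "r b0 \<noteq> 0" and db0: "dg a b0 = p" using b0(1) S0B by (auto simp: S_def S0_def)
    define y where "y = (\<Sum>b\<in>S. seq_scale (r b) b)"
    define z where "z = (\<Sum>b\<in>S0 - S. seq_scale (r b) b)"
    have "x = y + z"
      unfolding xsum y_def z_def using fin0 by (subst sum.subset_diff[of S]) (auto simp: S_def add.commute)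
    then have yx: "y = x - z" by simp
    have "dg a z \<le> p - 1"
      unfolding z_def
    proof (rule dg_sum)
      fix b' assume "b' \<in> S0 - S"
      then show "dg a b' \<le> p - 1" using le_p[of b'] by (auto simp: S_def)
    qed
    then have ya: "dg a y < dg a b0" using dg_diff[of a x z] xp unfolding yx db0 by linarith
    have yc: "dg c y \<le> dg c b0" for c
    proof (cases "c = a")
      case True then show ?thesis using ya by simp
    next
      case False then show ?thesis unfolding y_def using b0(2) by (intro dg_sum) auto
    qed
    have y_split: "y = seq_scale (r b0) b0 + (\<Sum>b\<in>S - {b0}. seq_scale (r b) b)"
      unfolding y_def using fin b0(1) by (rule sum.remove)
    let ?C = "B - {b0}"
    have restC: "(\<Sum>b\<in>S - {b0}. seq_scale (r b) b) \<in> seq.span ?C"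
      using S0B by (intro seq.span_sum seq.span_scale seq.span_base) (auto simp: S_def)
    have b0_eq: "b0 = seq_scale (1 / r b0) (y - (\<Sum>b\<in>S - {b0}. seq_scale (r b) b))"
      using rb0 unfolding y_split by simp
    have b0C: "b0 \<notin> seq.span ?C" using B b0B unfolding seq.dependent_def by blast
    have yC: "y \<notin> seq.span ?C"
    proof
      assume "y \<in> seq.span ?C"
      then have "seq_scale (1 / r b0) (y - (\<Sum>b\<in>S - {b0}. seq_scale (r b) b)) \<in> seq.span ?C"
        using restC by (intro seq.span_scale seq.span_diff)
      then show False using b0_eq b0C by simp
    qed
    let ?B' = "insert y ?C"
    have "?basis ?B'"
    proof (intro conjI)
      show "finite ?B'" using B by simp
      show "seq.independent ?B'"
        using seq.independent_insertI[OF yC] seq.independent_mono[of B ?C] B by blast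
      have "y \<in> W" unfolding y_def using S0B BW by (intro seq.subspace_sum[OF sW] seq.subspace_scale[OF sW]) (auto simp: S_def)
      then have 1: "seq.span ?B' \<subseteq> W" using BW by (intro seq.span_minimal sW) auto
      have "y \<in> seq.span ?B'" by (intro seq.span_base) simp
      moreover have "(\<Sum>b\<in>S - {b0}. seq_scale (r b) b) \<in> seq.span ?B'"
        using restC seq.span_mono[of ?C ?B'] by blast
      ultimately have "seq_scale (1 / r b0) (y - (\<Sum>b\<in>S - {b0}. seq_scale (r b) b)) \<in> seq.span ?B'"
        by (intro seq.span_scale seq.span_diff)
      then have "b0 \<in> seq.span ?B'" using b0_eq by simp
      then have "B \<subseteq> seq.span ?B'" using seq.span_superset[of ?B'] by blast
      then have "seq.span B \<subseteq> seq.span ?B'" by (rule seq.span_minimal) (rule seq.subspace_span)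
      then show "seq.span ?B' = W" using 1 B by blast
    qed
    then have "\<Phi> B \<le> \<Phi> ?B'" by (rule min)
    also have "\<Phi> ?B' = (\<Sum>a\<in>UNIV. dg a y) + \<Phi> ?C"
      unfolding \<Phi>_def using B yC seq.span_base[of y ?C] by (subst sum.insert) auto
    also have "\<dots> < (\<Sum>a\<in>UNIV. dg a b0) + \<Phi> ?C"
      using yc ya by (intro add_strict_right_mono sum_strict_mono_ex1) auto
    also have "\<dots> = \<Phi> B"
      unfolding \<Phi>_def using B b0B by (subst sum.remove[of B b0]) auto
    finally show False by simp
  qed
  then show thesis using that B by blast
qed

text \<open>
  The structure maps of a free module are inclusions of coordinate spaces, so its kernel submodule
  consists of the intersections of a fixed space \<open>W\<close> with coordinate spaces: a vector of \<open>W\<close> lives in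
  degree \<open>j\<close> exactly when all labels in its support are at most \<open>j\<close>, which is a condition on each
  coordinate of the parameter space separately.  A basis of \<open>W\<close> that is adapted to the valuations
  that take the largest label in the support in a given direction is a basis of the kernel as a free module.
\<close>

lemma kernel_free:
  fixes xs ys :: "(real ^ 'n) list" and f :: "('k::field, real ^ 'n) pmor"
  assumes card: "CARD('n) \<le> 2" and f: "morphism (free_module xs) (free_module ys) f"
  obtains zs \<psi> where "morphism (free_module zs) (free_module xs) \<psi>"
    "exact_at (free_module zs) \<psi> (free_module xs) f"
    "\<And>j x. x \<in> fiber (free_module zs) j \<Longrightarrow> \<psi> j x = 0 \<Longrightarrow> x = 0"
proof -
  let ?F = "free_module xs :: ('k, real ^ 'n) pmod"
  let ?N = "length xs"
  note F = persistence_module_free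
  \<comment> \<open>In a degree \<open>J\<close> above all labels every vector of the free module is present.\<close>
  obtain J where J: "\<And>i. i \<in> set xs \<Longrightarrow> i \<le> J" using finite_upper_bound[of "set xs"] by auto
  define W where "W = {x \<in> fiber ?F J. f J x = 0}"
  have "fd_space W"
    unfolding W_def
    by (rule fd_space_sub[OF fiber_fd[OF F, of xs J] _ subspace_kernel_between[OF morphism_linear[OF f] fiber_subspace[OF F]]]) auto
  have sW: "seq.subspace W" using \<open>fd_space W\<close> by (rule fd_space_subspaceD)
  have fiberJ: "x \<in> fiber ?F J" if "x \<in> fiber ?F j" for x j
    using that J by (auto simp: coord_space_def)
  have fJ: "f j x = f J x" if x: "x \<in> fiber ?F j" for x j
  proof -
    have "f (sup j J) x = f j x" "f (sup j J) x = f J x"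
      using morphism_str[OF f _ x, of "sup j J"] morphism_str[OF f _ fiberJ[OF x], of "sup j J"] by simp_all
    then show ?thesis by simp
  qed
  have kernel_iff: "x \<in> fiber ?F j \<and> f j x = 0 \<longleftrightarrow> x \<in> W \<and> x \<in> fiber ?F j" for x j
  proof (cases "x \<in> fiber ?F j")
    case True
    then show ?thesis using fJ[OF True] fiberJ[OF True] by (simp add: W_def del: free_module_simps)
  qed simp
  have kernel: "{x \<in> fiber ?F j. f j x = 0} = W \<inter> fiber ?F j" for j
    by (intro equalityI subsetI) (simp_all only: mem_Collect_eq Int_iff kernel_iff)
  have supp: "s < ?N" if "x \<in> W" "x s \<noteq> 0" for x s
    using that unfolding W_def by (simp add: coord_space_def)
  \<comment> \<open>An adapted basis minimizes a sum of natural numbers, so labels are replaced by their ranks in each direction.\<close>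
  define lv where "lv a s = card {t. t < ?N \<and> vec_nth (xs ! t) a \<le> vec_nth (xs ! s) a}" for a s
  define dg where "dg a x = Max (insert 0 (lv a ` {s. s < ?N \<and> x s \<noteq> 0}))" for a and x :: "nat \<Rightarrow> 'k"
  have dg_le: "dg a x \<le> m \<longleftrightarrow> (\<forall>s. s < ?N \<and> x s \<noteq> 0 \<longrightarrow> lv a s \<le> m)" for a x m
    unfolding dg_def by (subst Max_le_iff) auto
  have le_dg: "s < ?N \<Longrightarrow> x s \<noteq> 0 \<Longrightarrow> lv a s \<le> dg a x" for a x s
    using dg_le[of a x "dg a x"] by simp
  obtain B where B: "finite B" "seq.independent B" "seq.span B = W"
    and adapted: "\<And>a x b. x \<in> W \<Longrightarrow> seq.representation B x b \<noteq> 0 \<Longrightarrow> dg a b \<le> dg a x"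
  proof (rule adapted_basis_exists[OF \<open>fd_space W\<close> card, of dg])
    show "dg a (x + y) \<le> max (dg a x) (dg a y)" for a x y
      unfolding dg_le
    proof (intro allI impI)
      fix s assume "s < ?N \<and> (x + y) s \<noteq> 0"
      then have "s < ?N" "x s \<noteq> 0 \<or> y s \<noteq> 0" by (auto simp: seq_apply)
      then show "lv a s \<le> max (dg a x) (dg a y)" using le_dg[of s x a] le_dg[of s y a] by (auto simp: le_max_iff_disj)
    qed
    show "dg a (seq_scale c x) \<le> dg a x" for a c x
      unfolding dg_le using le_dg by (auto simp: seq_apply)
    show "dg a 0 = 0" for a using dg_le[of a 0 0] by simp
  qed blast
  have BW: "B \<subseteq> W" using B(3) seq.span_superset by blast
  have in_fiber_of_dg: "b \<in> fiber ?F j"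
    if b: "b \<in> W" and x: "x \<in> fiber ?F j" and le: "\<And>a. dg a b \<le> dg a x" for b x j
  proof -
    have "xs ! s \<le> j" if s: "b s \<noteq> 0" for s
      unfolding Finite_Cartesian_Product.less_eq_vec_def
    proof (rule allI, rule ccontr)
      fix a assume "\<not> vec_nth (xs ! s) a \<le> vec_nth j a"
      have sN: "s < ?N" using supp[OF b s] .
      have lv_less: "lv a t < lv a s" if "x t \<noteq> 0" for t
      proof -
        have "xs ! t \<le> j" using x that by (simp add: coord_space_def)
        then have "vec_nth (xs ! t) a < vec_nth (xs ! s) a"
          using \<open>\<not> vec_nth (xs ! s) a \<le> vec_nth j a\<close> by (auto simp: Finite_Cartesian_Product.less_eq_vec_def not_le intro: le_less_trans)
        then have "{u. u < ?N \<and> vec_nth (xs ! u) a \<le> vec_nth (xs ! t) a} \<subseteq> {u. u < ?N \<and> vec_nth (xs ! u) a \<le> vec_nth (xs ! s) a} - {s}"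
          by auto
        then have "{u. u < ?N \<and> vec_nth (xs ! u) a \<le> vec_nth (xs ! t) a} \<subset> {u. u < ?N \<and> vec_nth (xs ! u) a \<le> vec_nth (xs ! s) a}"
          using sN by auto
        then show ?thesis unfolding lv_def by (intro psubset_card_mono) simp_all
      qed
      have "0 < lv a s" using sN unfolding lv_def by (auto simp: card_gt_0_iff)
      have "dg a x \<le> lv a s - 1"
        unfolding dg_le
      proof (intro allI impI)
        fix t assume "t < ?N \<and> x t \<noteq> 0"
        then show "lv a t \<le> lv a s - 1" using lv_less[of t] by linarith
      qed
      then have "dg a x < lv a s" using \<open>0 < lv a s\<close> by simp
      also have "\<dots> \<le> dg a b" using le_dg[where x = b and s = s, OF sN s] .
      finally show False using le[of a] by simp
    qed
    then show ?thesis using supp[OF b] by (auto simp: coord_space_def)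
  qed
  define deg where "deg b = (\<chi> a. Max ((\<lambda>s. vec_nth (xs ! s) a) ` {s. b s \<noteq> 0}))" for b :: "nat \<Rightarrow> 'k"
  have deg: "deg b \<le> j \<longleftrightarrow> b \<in> fiber ?F j" if b: "b \<in> B" for b j
  proof -
    have bN: "\<And>s. b s \<noteq> 0 \<Longrightarrow> s < ?N" using supp b BW by blast
    then have "{s. b s \<noteq> 0} \<subseteq> {..<?N}" by auto
    then have fin: "finite {s. b s \<noteq> 0}" by (rule finite_subset) simp
    have "b \<noteq> 0" using B(2) b seq.dependent_zero by blast
    then have ne: "{s. b s \<noteq> 0} \<noteq> {}" by (auto simp: fun_eq_iff)
    have "deg b \<le> j \<longleftrightarrow> (\<forall>a. \<forall>s. b s \<noteq> 0 \<longrightarrow> vec_nth (xs ! s) a \<le> vec_nth j a)"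
      unfolding deg_def Finite_Cartesian_Product.less_eq_vec_def using fin ne by (simp add: Max_le_iff)
    then show ?thesis using bN by (auto simp: coord_space_def Finite_Cartesian_Product.less_eq_vec_def)
  qed
  obtain bs where bs: "set bs = B" "distinct bs" using finite_distinct_list[OF B(1)] by blast
  let ?zs = "map deg bs" and ?L = "length bs"
  have bij: "bij_betw ((!) bs) {..<?L} B" using bij_betw_nth[OF bs(2)] bs(1) by simp
  define \<psi> where "\<psi> = from_gens ?F ?zs ((!) bs)"
  have \<psi>_eq: "\<psi> j x = (\<Sum>k<?L. seq_scale (x k) (bs ! k))" for j x
    by (simp add: \<psi>_def from_gens_def)
  have \<psi>: "morphism (free_module ?zs) ?F \<psi>"
    unfolding \<psi>_def
  proof (rule morphism_from_gens[OF F])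
    fix k assume "k < length ?zs"
    then show "bs ! k \<in> fiber ?F (?zs ! k)" using deg[of "bs ! k" "deg (bs ! k)"] bs(1) nth_mem by auto
  qed
  have \<psi>_sum: "(\<Sum>k<?L. seq_scale (c (bs ! k)) (bs ! k)) = (\<Sum>b\<in>B. seq_scale (c b) b)" for c
    using sum.reindex_bij_betw[OF bij, of "\<lambda>b. seq_scale (c b) b"] .
  have inj: "x = 0" if x: "x \<in> fiber (free_module ?zs) j" and x0: "\<psi> j x = 0" for j x
  proof
    fix k
    show "x k = 0 k"
    proof (cases "k < ?L")
      case False then show ?thesis using x by (auto simp: coord_space_def)
    next
      case True
      define c where "c b = x (inv_into {..<?L} ((!) bs) b)" for b
      have cx: "c (bs ! k) = x k" if "k < ?L" for k
        unfolding c_def using bij_betw_inv_into_left[OF bij, of k] that by simp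
      have "(\<Sum>b\<in>B. seq_scale (c b) b) = 0"
        using x0 unfolding \<psi>_eq \<psi>_sum[of c, symmetric] by (simp add: cx)
      then have "c (bs ! k) = 0"
        using seq.independentD[OF B(2) B(1) order_refl] True bs(1) by auto
      then show ?thesis using cx[OF True] by simp
    qed
  qed
  have "\<psi> j ` fiber (free_module ?zs) j = {x \<in> fiber ?F j. f j x = 0}" for j
    unfolding kernel
  proof (intro antisym subsetI)
    fix y assume "y \<in> \<psi> j ` fiber (free_module ?zs) j"
    then obtain x where x: "x \<in> fiber (free_module ?zs) j" "y = \<psi> j x" by blast
    have "\<psi> j x \<in> W" unfolding \<psi>_eq
      using BW bs(1) by (intro seq.subspace_sum[OF sW] seq.subspace_scale[OF sW]) auto
    then show "y \<in> W \<inter> fiber ?F j" using x morphism_in[OF \<psi> x(1)] by blast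
  next
    fix x assume x: "x \<in> W \<inter> fiber ?F j"
    define r where "r = seq.representation B x"
    let ?u = "\<lambda>k. if k < ?L then r (bs ! k) else 0"
    have "(\<Sum>b\<in>B. seq_scale (r b) b) = x"
      unfolding r_def using B x by (intro seq.sum_representation_eq) auto
    then have \<psi>u: "x = \<psi> j ?u" unfolding \<psi>_eq \<psi>_sum[of r, symmetric] by (auto intro!: sum.cong)
    have "deg b \<le> j" if "b \<in> B" "r b \<noteq> 0" for b
      using deg[OF that(1)] in_fiber_of_dg[of b x j] adapted that x BW unfolding r_def by blast
    then have "?u \<in> fiber (free_module ?zs) j"
      using bs(1) by (auto simp: coord_space_def)
    with \<psi>u show "x \<in> \<psi> j ` fiber (free_module ?zs) j" by (rule image_eqI)
  qed
  then have "exact_at (free_module ?zs) \<psi> ?F f" by (simp add: exact_at_def)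
  then show thesis using that \<psi> inj by blast
qed

section \<open>Transport between Hilbert functions\<close>

text \<open>
  The transport cost of the formal difference of two Hilbert functions.  It is phrased for functions,
  and not for signed barcodes, because the intermediate functions in the argument below are never
  written as signed barcodes; only differences of consecutive ones are.
\<close>

definition near :: "(real ^ 'n \<Rightarrow> int) \<Rightarrow> (real ^ 'n \<Rightarrow> int) \<Rightarrow> real \<Rightarrow> bool" where
  "near F G \<epsilon> \<longleftrightarrow> (\<exists>A B. (\<forall>i. F i - G i = barcode_Hil A i - barcode_Hil B i) \<and> coupled A B \<epsilon>)"

lemma nearI: "(\<And>i. F i - G i = barcode_Hil A i - barcode_Hil B i) \<Longrightarrow> coupled A B \<epsilon> \<Longrightarrow> near F G \<epsilon>"
  unfolding near_def by blast

lemma near_refl: "near F F 0"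
  by (rule nearI[OF _ coupled_refl[of "{#}"]]) simp

lemma near_sym: "near F G \<epsilon> \<Longrightarrow> near G F \<epsilon>"
  unfolding near_def
proof (elim exE conjE)
  fix A B assume "\<forall>i. F i - G i = barcode_Hil A i - barcode_Hil B i" "coupled A B \<epsilon>"
  then show "\<exists>A B. (\<forall>i. G i - F i = barcode_Hil A i - barcode_Hil B i) \<and> coupled A B \<epsilon>"
    by (intro exI[of _ B] exI[of _ A]) (auto intro: coupled_sym simp: algebra_simps eq_diff_eq)
qed

lemma near_mono: "near F G \<epsilon> \<Longrightarrow> \<epsilon> \<le> \<epsilon>' \<Longrightarrow> near F G \<epsilon>'"
  unfolding near_def using coupled_mono by blast

lemma near_combine:
  assumes "near F G \<epsilon>" "near F' G' \<epsilon>'" and eq: "\<And>i. H i - K i = (F i - G i) + (F' i - G' i)"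
  shows "near H K (\<epsilon> + \<epsilon>')"
proof -
  obtain A B where AB: "\<And>i. F i - G i = barcode_Hil A i - barcode_Hil B i" "coupled A B \<epsilon>"
    using assms(1) unfolding near_def by blast
  obtain A' B' where AB': "\<And>i. F' i - G' i = barcode_Hil A' i - barcode_Hil B' i" "coupled A' B' \<epsilon>'"
    using assms(2) unfolding near_def by blast
  show ?thesis
    by (rule nearI[OF _ coupled_add[OF AB(2) AB'(2)]]) (simp add: eq AB(1) AB'(1))
qed

lemma near_trans: "near F G \<epsilon> \<Longrightarrow> near G H \<epsilon>' \<Longrightarrow> near F H (\<epsilon> + \<epsilon>')"
  by (rule near_combine) auto

lemma near_diff: "near F G \<epsilon> \<Longrightarrow> near F' G' \<epsilon>' \<Longrightarrow> near (\<lambda>i. F i - F' i) (\<lambda>i. G i - G' i) (\<epsilon> + \<epsilon>')"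
  by (rule near_combine[OF _ near_sym]) auto

lemma near_barcode_Hil:
  fixes xs ys :: "(real ^ 'n) list"
  assumes "length xs = length ys"
  shows "near (barcode_Hil (mset xs)) (barcode_Hil (mset ys)) (\<Sum>i<length xs. l1_norm (xs ! i - ys ! i))"
proof (rule nearI)
  have "pair_cost (mset (zip xs ys)) = (\<Sum>i<length xs. l1_norm (xs ! i - ys ! i))"
    using assms by (simp add: pair_cost_def sum_mset_sum_list sum_list_sum_nth atLeast0LessThan flip: mset_map)
  then show "coupled (mset xs) (mset ys) (\<Sum>i<length xs. l1_norm (xs ! i - ys ! i))"
    unfolding coupled_def using assms
    by (intro exI[of _ "mset (zip xs ys)"]) (simp flip: mset_map)
qed simp

text \<open>
  The formal difference of \<open>S\<close> and \<open>T\<close> is that of the barcodes which witness the closeness of \<open>F\<close> and \<open>G\<close>.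
\<close>

lemma signed_wasserstein_le_of_near:
  assumes near: "near F G \<epsilon>"
    and S: "\<And>i. F i = barcode_Hil (fst S) i - barcode_Hil (snd S) i"
    and T: "\<And>i. G i = barcode_Hil (fst T) i - barcode_Hil (snd T) i"
  shows "signed_wasserstein S T \<le> ennreal \<epsilon>"
proof -
  obtain A B where AB: "\<And>i. F i - G i = barcode_Hil A i - barcode_Hil B i" "coupled A B \<epsilon>"
    using near unfolding near_def by blast
  \<comment> \<open>Adding \<open>?Y\<close> to \<open>A\<close> and \<open>B\<close> and cancelling \<open>B\<close> turns \<open>A, B\<close> into \<open>?Z, ?Y\<close>.\<close>
  let ?Z = "fst S + snd T" and ?Y = "fst T + snd S"
  have ZY: "?Z + B = A + ?Y"
  proof (rule barcode_Hil_inject)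
    show "barcode_Hil (?Z + B) i = barcode_Hil (A + ?Y) i" for i
      using AB(1)[of i] S[of i] T[of i] by simp
  qed
  have "coupled (A + ?Y) (B + ?Y) \<epsilon>" using coupled_add[OF AB(2) coupled_refl, of ?Y] by simp
  then have "coupled (?Z + B) (?Y + B) \<epsilon>" unfolding ZY by (simp add: add.commute)
  then have "coupled ?Z ?Y \<epsilon>" by (rule coupled_cancel)
  then show ?thesis unfolding signed_wasserstein_def by (rule wasserstein_le_of_coupled)
qed

section \<open>Rank functions of labelled vectors\<close>

lemma dim_insert_seq:
  "seq.dim (insert x S) = seq.dim S + (if x \<in> seq.span S then 0 else (1::nat))" if "finite S"
proof (cases "x \<in> seq.span S")
  case True
  then show ?thesis using seq.span_eq_dim[OF seq.span_redundant] by simp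
next
  case False
  obtain B where B: "B \<subseteq> S" "seq.independent B" "S \<subseteq> seq.span B" "card B = seq.dim S"
    by (rule seq.basis_exists)
  have "x \<notin> seq.span B" using False seq.span_mono[OF B(1)] by blast
  then have "seq.independent (insert x B)" using B(2) by (rule seq.independent_insertI)
  moreover have "insert x S \<subseteq> seq.span (insert x B)"
    using B(3) seq.span_mono[of B "insert x B"] seq.span_base[of x "insert x B"] by blast
  ultimately have "card (insert x B) = seq.dim (insert x S)"
    using B(1) by (intro seq.basis_card_eq_dim) auto
  moreover have "x \<notin> B" using \<open>x \<notin> seq.span B\<close> seq.span_base by blast
  moreover have "finite B" using that B(1) finite_subset by blast
  ultimately show ?thesis using B(4) False by simp
qed

text \<open>
  The dimension in degree \<open>i\<close> of the submodule of relations of a presentation, when \<open>v k\<close> are the columns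
  and \<open>c k\<close> their labels.  The labels of the rows do not enter, so columns can be moved freely,
  without preserving the validity of a presentation.
\<close>

definition label_rank :: "(nat \<Rightarrow> nat \<Rightarrow> 'k::field) \<Rightarrow> nat \<Rightarrow> (nat \<Rightarrow> real ^ 'n) \<Rightarrow> real ^ 'n \<Rightarrow> int" where
  "label_rank v m c i = int (seq.dim (v ` {k. k < m \<and> c k \<le> i}))"

definition set_coord :: "real ^ 'n \<Rightarrow> 'n \<Rightarrow> real \<Rightarrow> real ^ 'n" where
  "set_coord p a x = (\<chi> d. if d = a then x else vec_nth p d)"

lemma set_coord_nth [simp]: "vec_nth (set_coord p a x) d = (if d = a then x else vec_nth p d)"
  by (simp add: set_coord_def)

lemma set_coord_set_coord [simp]: "set_coord (set_coord p a x) a x' = set_coord p a x'"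
  and set_coord_self: "vec_nth p a = x \<Longrightarrow> set_coord p a x = p"
  by (auto simp: Finite_Cartesian_Product.vec_eq_iff)

lemma l1_norm_single_coord:
  assumes "\<And>d. d \<noteq> a \<Longrightarrow> vec_nth p d = vec_nth q d"
  shows "l1_norm (p - q) = \<bar>vec_nth p a - vec_nth q a\<bar>"
proof -
  have "l1_norm (p - q) = (\<Sum>d\<in>UNIV. if d = a then \<bar>vec_nth p a - vec_nth q a\<bar> else 0)"
    unfolding l1_norm_def using assms by (intro sum.cong) auto
  then show ?thesis by simp
qed

text \<open>
  Increasing the label of \<open>v j\<close> lowers the rank exactly at those degrees at which \<open>v j\<close> has been
  withdrawn and is not in the span of the other available vectors.
\<close>

lemma label_rank_move:
  fixes c :: "nat \<Rightarrow> real ^ 'n"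
  assumes j: "j < m" and p: "c j \<le> p"
  shows "label_rank v m c i - label_rank v m (c(j := p)) i =
    (if c j \<le> i \<and> \<not> p \<le> i \<and> v j \<notin> seq.span (v ` {k. k < m \<and> k \<noteq> j \<and> c k \<le> i}) then 1 else 0)"
proof -
  let ?K = "{k. k < m \<and> k \<noteq> j \<and> c k \<le> i}"
  have fin: "finite (v ` ?K)" by simp
  have 1: "v ` {k. k < m \<and> c k \<le> i} = (if c j \<le> i then insert (v j) (v ` ?K) else v ` ?K)"
    using j by auto
  have 2: "v ` {k. k < m \<and> (c(j := p)) k \<le> i} = (if p \<le> i then insert (v j) (v ` ?K) else v ` ?K)"
    using j by auto
  show ?thesis
    unfolding label_rank_def 1 2 using p dim_insert_seq[OF fin, of "v j"] by auto
qed

text \<open>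
  The number of parameters enters the estimate here.  The label \<open>c j\<close> moves in
  direction \<open>a\<close> to \<open>x'\<close> without passing another label.  In the strip that it sweeps out, the span of the other
  available vectors depends on the remaining coordinates only.  With one parameter the rank therefore
  changes on the whole interval or nowhere.  With two parameters \<open>v j\<close> becomes redundant from some height
  \<open>t\<close> onwards, so that the rank changes on a rectangle, possibly empty or unbounded.  The indicator of a
  bounded rectangle is the alternating sum of the up-sets of its four corners; matching
  corners along the two edges in direction \<open>a\<close> costs twice the distance moved.
\<close>

lemma label_rank_elementary_move:
  fixes c :: "nat \<Rightarrow> real ^ 'n"
  assumes card: "CARD('n) \<le> 2" and j: "j < m" and less: "vec_nth (c j) a < x'"
    and free: "\<And>k. k < m \<Longrightarrow> k \<noteq> j \<Longrightarrow> \<not> (vec_nth (c j) a < vec_nth (c k) a \<and> vec_nth (c k) a < x')"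
  shows "near (label_rank v m c) (label_rank v m (c(j := set_coord (c j) a x')))
    (real CARD('n) * (x' - vec_nth (c j) a))"
proof -
  define x where "x = vec_nth (c j) a"
  define p where "p = set_coord (c j) a x'"
  define V where "V i = seq.span (v ` {k. k < m \<and> k \<noteq> j \<and> c k \<le> i})" for i
  define \<delta> where "\<delta> i = label_rank v m c i - label_rank v m (c(j := p)) i" for i
  have le_p: "c j \<le> p" using less by (auto simp: p_def Finite_Cartesian_Product.less_eq_vec_def)
  have \<delta>: "\<delta> i = (if c j \<le> i \<and> \<not> p \<le> i \<and> v j \<notin> V i then 1 else 0)" for i
    unfolding \<delta>_def V_def by (rule label_rank_move[where c = c and j = j and p = p, OF j le_p])
  have split: "q \<le> i \<longleftrightarrow> vec_nth q a \<le> vec_nth i a \<and> (\<forall>d. d \<noteq> a \<longrightarrow> vec_nth q d \<le> vec_nth i d)" for q i :: "real ^ 'n"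
    unfolding Finite_Cartesian_Product.less_eq_vec_def by metis
  have "p \<le> i \<longleftrightarrow> x' \<le> vec_nth i a \<and> (\<forall>d. d \<noteq> a \<longrightarrow> vec_nth (c j) d \<le> vec_nth i d)" for i
    unfolding split[of p] by (simp add: p_def)
  then have slab: "c j \<le> i \<and> \<not> p \<le> i \<longleftrightarrow> c j \<le> i \<and> x \<le> vec_nth i a \<and> vec_nth i a < x'" for i
    unfolding split[of "c j"] x_def by (metis not_le)
  have labels: "c k \<le> i \<longleftrightarrow> vec_nth (c k) a \<le> x \<and> (\<forall>b. b \<noteq> a \<longrightarrow> vec_nth (c k) b \<le> vec_nth i b)"
    if "k < m" "k \<noteq> j" "x \<le> vec_nth i a" "vec_nth i a < x'" for k i
    using free[OF that(1,2)] that(3,4) unfolding split[of "c k"] x_def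
    by (metis le_less_trans not_le order_trans)
  have cost: "l1_norm (c j - p) = x' - x" "1 \<le> CARD('n)"
    using l1_norm_single_coord[of a "c j" p] less by (auto simp: p_def x_def Suc_leI)
  then have cost_le: "x' - x \<le> real CARD('n) * (x' - x)"
    using less mult_right_mono[of 1 "real CARD('n)" "x' - x"] by (simp add: x_def)
  have whole: "near (label_rank v m c) (label_rank v m (c(j := p))) (real CARD('n) * (x' - x))"
    if "\<And>i. c j \<le> i \<Longrightarrow> \<not> p \<le> i \<Longrightarrow> v j \<notin> V i"
  proof (rule nearI[where A = "{#c j#}" and B = "{#p#}"])
    show "coupled {#c j#} {#p#} (real CARD('n) * (x' - x))"
      using coupled_single[of "c j" p] cost_le cost(1) by (auto intro: coupled_mono)
    show "label_rank v m c i - label_rank v m (c(j := p)) i = barcode_Hil {#c j#} i - barcode_Hil {#p#} i" for i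
      using \<delta>[of i] that[of i] le_p unfolding \<delta>_def by auto
  qed
  have none: "near (label_rank v m c) (label_rank v m (c(j := p))) (real CARD('n) * (x' - x))"
    if "\<And>i. c j \<le> i \<Longrightarrow> \<not> p \<le> i \<Longrightarrow> v j \<in> V i"
  proof (rule nearI[where A = "{#}" and B = "{#}"])
    show "coupled {#} {#} (real CARD('n) * (x' - x))"
      using less by (intro coupled_mono[OF coupled_refl]) (simp add: x_def)
    show "label_rank v m c i - label_rank v m (c(j := p)) i = barcode_Hil {#} i - barcode_Hil {#} i" for i
      using \<delta>[of i] that[of i] unfolding \<delta>_def by auto
  qed
  have "near (label_rank v m c) (label_rank v m (c(j := p))) (real CARD('n) * (x' - x))"
  proof (cases "\<exists>b. b \<noteq> a")
    case False
    then have one: "b = a" for b by blast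
    have const: "V i = V (c j)" if i: "c j \<le> i" "\<not> p \<le> i" for i
    proof -
      have "c k \<le> i \<longleftrightarrow> c k \<le> c j" if "k < m" "k \<noteq> j" for k
        using labels[OF that, of i] labels[OF that, of "c j"] slab[of i] i less one x_def by auto
      then have "{k. k < m \<and> k \<noteq> j \<and> c k \<le> i} = {k. k < m \<and> k \<noteq> j \<and> c k \<le> c j}" by blast
      then show ?thesis by (simp add: V_def)
    qed
    show ?thesis
    proof (cases "v j \<in> V (c j)")
      case True
      show ?thesis
      proof (rule none)
        fix i assume "c j \<le> i" "\<not> p \<le> i"
        from const[OF this] show "v j \<in> V i" using True by simp
      qed
    next
      case False
      show ?thesis
      proof (rule whole)
        fix i assume "c j \<le> i" "\<not> p \<le> i"
        from const[OF this] show "v j \<notin> V i" using False by simp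
      qed
    qed
  next
    case True
    then obtain b where b: "b \<noteq> a" by blast
    have two: "d = a \<or> d = b" for d
    proof (rule ccontr)
      assume "\<not> (d = a \<or> d = b)"
      then have "card {a, b, d} = 3" using b by (auto simp: card_insert_if)
      then show False using card_mono[of UNIV "{a, b, d}"] card by simp
    qed
    have card2: "CARD('n) = 2" using card card_mono[of UNIV "{a, b}"] b by (auto simp: card_insert_if)
    have le_iff: "q \<le> i \<longleftrightarrow> vec_nth q a \<le> vec_nth i a \<and> vec_nth q b \<le> vec_nth i b" for q i :: "real ^ 'n"
    proof -
      have "vec_nth q d \<le> vec_nth i d" if "d \<noteq> a" "vec_nth q b \<le> vec_nth i b" for d
        using two[of d] that by simp
      then show ?thesis unfolding split using b by blast
    qed
    define y where "y = vec_nth (c j) b"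
    define K where "K = {k. k < m \<and> k \<noteq> j \<and> vec_nth (c k) a \<le> x}"
    define U where "U s = seq.span (v ` {k \<in> K. vec_nth (c k) b \<le> s})" for s
    have finK: "finite K" by (simp add: K_def)
    have VU: "V i = U (vec_nth i b)" if "c j \<le> i" "\<not> p \<le> i" for i
    proof -
      have i: "x \<le> vec_nth i a" "vec_nth i a < x'" using slab[of i] that by simp_all
      have "c k \<le> i \<longleftrightarrow> vec_nth (c k) a \<le> x \<and> vec_nth (c k) b \<le> vec_nth i b" if k: "k < m" "k \<noteq> j" for k
      proof -
        have "vec_nth (c k) a \<le> vec_nth i a" if "vec_nth (c k) a \<le> x" using that i(1) by simp
        then show ?thesis using labels[OF k i] le_iff[of "c k" i] by blast
      qed
      then have "{k. k < m \<and> k \<noteq> j \<and> c k \<le> i} = {k \<in> K. vec_nth (c k) b \<le> vec_nth i b}"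
        unfolding K_def by blast
      then show ?thesis by (simp add: V_def U_def)
    qed
    have U_mono: "U s \<subseteq> U t" if "s \<le> t" for s t
      unfolding U_def using that by (intro seq.span_mono image_mono) auto
    \<comment> \<open>Where \<open>v j\<close> becomes redundant the height is that of another label, or \<open>y\<close> itself.\<close>
    define C where "C = insert y ((\<lambda>k. vec_nth (c k) b) ` {k \<in> K. y \<le> vec_nth (c k) b})"
    define Th where "Th = {t \<in> C. v j \<in> U t}"
    have finC: "finite C" using finK by (simp add: C_def)
    have U_iff: "v j \<in> U s \<longleftrightarrow> (\<exists>t\<in>Th. t \<le> s)" if s: "y \<le> s" for s
    proof
      assume vs: "v j \<in> U s"
      define t where "t = Max {t \<in> C. t \<le> s}"
      have "t \<in> {t \<in> C. t \<le> s}" unfolding t_def using finC s by (intro Max_in) (auto simp: C_def)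
      then have t: "t \<in> C" "t \<le> s" by auto
      have max: "t' \<le> t" if "t' \<in> C" "t' \<le> s" for t' unfolding t_def using finC that by (intro Max_ge) auto
      have yt: "y \<le> t" using max[of y] s by (simp add: C_def)
      have "vec_nth (c k) b \<le> t" if "k \<in> K" "vec_nth (c k) b \<le> s" for k
        using that max[of "vec_nth (c k) b"] yt by (cases "y \<le> vec_nth (c k) b") (auto simp: C_def)
      then have "U s \<subseteq> U t" unfolding U_def by (intro seq.span_mono image_mono) auto
      then show "\<exists>t\<in>Th. t \<le> s" using t vs by (auto simp: Th_def)
    next
      assume "\<exists>t\<in>Th. t \<le> s"
      then show "v j \<in> U s" using U_mono by (auto simp: Th_def)
    qed
    have in_V: "v j \<in> V i \<longleftrightarrow> (\<exists>t\<in>Th. t \<le> vec_nth i b)" if "c j \<le> i" "\<not> p \<le> i" for i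
      using U_iff[of "vec_nth i b"] VU[OF that] that(1) by (simp add: le_iff y_def)
    show ?thesis
    proof (cases "Th = {}")
      case True
      show ?thesis by (rule whole) (simp add: in_V True)
    next
      case False
      have finTh: "finite Th" using finC by (simp add: Th_def)
      define t where "t = Min Th"
      have "t \<in> Th" unfolding t_def using finTh False by (rule Min_in)
      then have yt: "y \<le> t" by (auto simp: Th_def C_def)
      have ex_t: "(\<exists>t\<in>Th. t \<le> s) \<longleftrightarrow> t \<le> s" for s
        unfolding t_def using finTh False by (simp add: Min_le_iff)
      \<comment> \<open>The two rank functions differ on the rectangle with corners \<open>c j\<close>, \<open>p\<close>, \<open>q'\<close>, \<open>q\<close>.\<close>
      define q where "q = set_coord (c j) b t"
      define q' where "q' = set_coord p b t"
      have nths: "vec_nth q a = x" "vec_nth q b = t" "vec_nth q' a = x'" "vec_nth q' b = t"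
        "vec_nth p a = x'" "vec_nth p b = y" "vec_nth (c j) a = x" "vec_nth (c j) b = y"
        using b by (auto simp: q_def q'_def p_def x_def y_def)
      have "l1_norm (q' - q) = \<bar>vec_nth q' a - vec_nth q a\<bar>"
        by (rule l1_norm_single_coord) (auto simp: q_def q'_def p_def)
      then have cost': "l1_norm (q' - q) = x' - x" using less by (simp add: nths)
      show ?thesis
      proof (rule nearI[where A = "{#c j#} + {#q'#}" and B = "{#p#} + {#q#}"])
        show "coupled ({#c j#} + {#q'#}) ({#p#} + {#q#}) (real CARD('n) * (x' - x))"
          using coupled_add[OF coupled_single[of "c j" p] coupled_single[of q' q]]
          unfolding cost(1) cost' card2 by (rule coupled_mono) simp
        fix i
        have "\<delta> i = (if c j \<le> i \<and> \<not> p \<le> i \<and> \<not> t \<le> vec_nth i b then 1 else 0)"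
          using \<delta>[of i] in_V[of i] ex_t by auto
        also have "\<dots> = barcode_Hil ({#c j#} + {#q'#}) i - barcode_Hil ({#p#} + {#q#}) i"
          using less yt unfolding x_def[symmetric] by (auto simp: le_iff nths)
        finally show "label_rank v m c i - label_rank v m (c(j := p)) i =
            barcode_Hil ({#c j#} + {#q'#}) i - barcode_Hil ({#p#} + {#q#}) i" by (simp add: \<delta>_def)
      qed
    qed
  qed
  then show ?thesis by (simp add: p_def x_def)
qed

text \<open>
  The move is cut at the coordinates of the labels that it passes; the costs add up because the
  pieces lie on one line.
\<close>

lemma label_rank_move_up:
  fixes c :: "nat \<Rightarrow> real ^ 'n"
  assumes card: "CARD('n) \<le> 2" and j: "j < m" and le: "vec_nth (c j) a \<le> x'"
  shows "near (label_rank v m c) (label_rank v m (c(j := set_coord (c j) a x')))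
    (real CARD('n) * (x' - vec_nth (c j) a))"
  using j le
proof (induction "card {k. k < m \<and> k \<noteq> j \<and> vec_nth (c j) a < vec_nth (c k) a \<and> vec_nth (c k) a < x'}"
    arbitrary: c x' rule: less_induct)
  case less
  let ?between = "\<lambda>x x'. {k. k < m \<and> k \<noteq> j \<and> x < vec_nth (c k) a \<and> vec_nth (c k) a < x'}"
  let ?x = "vec_nth (c j) a"
  show ?case
  proof (cases "?x = x'")
    case True
    then show ?thesis using near_refl by (simp add: set_coord_self)
  next
    case False
    then have lt: "?x < x'" using less.prems by simp
    show ?thesis
    proof (cases "?between ?x x' = {}")
      case True
      then show ?thesis using label_rank_elementary_move[where v = v and c = c and j = j and a = a and x' = x',
          OF card less.prems(1) lt] by blast
    next
      case False
      then obtain k where k: "k \<in> ?between ?x x'" by blast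
      define z where "z = vec_nth (c k) a"
      let ?c = "c(j := set_coord (c j) a z)"
      have fin: "finite (?between ?x x')" by simp
      have 1: "near (label_rank v m c) (label_rank v m ?c) (real CARD('n) * (z - ?x))"
      proof (rule less.hyps)
        show "card (?between ?x z) < card (?between ?x x')"
          using k by (intro psubset_card_mono[OF fin]) (auto simp: z_def)
      qed (use k less.prems in \<open>auto simp: z_def\<close>)
      have "near (label_rank v m ?c) (label_rank v m (?c(j := set_coord (?c j) a x')))
          (real CARD('n) * (x' - vec_nth (?c j) a))"
      proof (rule less.hyps)
        have "{k. k < m \<and> k \<noteq> j \<and> vec_nth (?c j) a < vec_nth (?c k) a \<and> vec_nth (?c k) a < x'} = ?between z x'"
          by auto
        moreover have "card (?between z x') < card (?between ?x x')"
          using k by (intro psubset_card_mono[OF fin]) (auto simp: z_def)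
        ultimately show "card {k. k < m \<and> k \<noteq> j \<and> vec_nth (?c j) a < vec_nth (?c k) a \<and> vec_nth (?c k) a < x'}
            < card (?between ?x x')" by simp
      qed (use k less.prems in \<open>auto simp: z_def\<close>)
      then have 2: "near (label_rank v m ?c) (label_rank v m (c(j := set_coord (c j) a x'))) (real CARD('n) * (x' - z))"
        by simp
      show ?thesis using near_trans[OF 1 2] by (simp add: algebra_simps)
    qed
  qed
qed

lemma label_rank_move_coordinate:
  fixes c :: "nat \<Rightarrow> real ^ 'n"
  assumes card: "CARD('n) \<le> 2" and j: "j < m"
  shows "near (label_rank v m c) (label_rank v m (c(j := set_coord (c j) a x')))
    (real CARD('n) * \<bar>x' - vec_nth (c j) a\<bar>)"
proof (cases "vec_nth (c j) a \<le> x'")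
  case True
  then show ?thesis using label_rank_move_up[where v = v and c = c and j = j and a = a and x' = x', OF card j True] by simp
next
  case False
  let ?c = "c(j := set_coord (c j) a x')"
  have "near (label_rank v m ?c) (label_rank v m (?c(j := set_coord (?c j) a (vec_nth (c j) a))))
      (real CARD('n) * (vec_nth (c j) a - vec_nth (?c j) a))"
    using False by (intro label_rank_move_up[where c = ?c and j = j and a = a, OF card j]) simp
  then have "near (label_rank v m ?c) (label_rank v m c) (real CARD('n) * (vec_nth (c j) a - x'))"
    by (simp add: set_coord_self)
  then show ?thesis using False near_sym by simp
qed

lemma label_rank_move_label:
  fixes c :: "nat \<Rightarrow> real ^ 'n"
  assumes card: "CARD('n) \<le> 2" and j: "j < m"
  shows "near (label_rank v m c) (label_rank v m (c(j := p))) (real CARD('n) * l1_norm (c j - p))"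
proof -
  \<comment> \<open>Move the coordinates of the label one after the other; \<open>D\<close> is the set of those already moved.\<close>
  define w where "w D = (\<chi> d. if d \<in> D then vec_nth p d else vec_nth (c j) d)" for D
  have fin: "finite D" for D :: "'n set" by simp
  have "near (label_rank v m c) (label_rank v m (c(j := w D)))
      (real CARD('n) * (\<Sum>d\<in>D. \<bar>vec_nth (c j) d - vec_nth p d\<bar>))" for D
    using fin[of D]
  proof (induction D rule: finite_induct)
    case empty
    have "w {} = c j" by (simp add: w_def Finite_Cartesian_Product.vec_eq_iff)
    then show ?case using near_refl by simp
  next
    case (insert a D)
    have "set_coord (w D) a (vec_nth p a) = w (insert a D)" by (auto simp: w_def Finite_Cartesian_Product.vec_eq_iff)
    moreover have "vec_nth (w D) a = vec_nth (c j) a" using insert by (simp add: w_def)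
    ultimately have "near (label_rank v m (c(j := w D))) (label_rank v m (c(j := w (insert a D))))
        (real CARD('n) * \<bar>vec_nth (c j) a - vec_nth p a\<bar>)"
      using label_rank_move_coordinate[where v = v and c = "c(j := w D)" and j = j and a = a and x' = "vec_nth p a",
          OF card j] by (simp add: abs_minus_commute)
    from near_trans[OF insert.IH this] show ?case
      using insert(1,2) by (simp add: algebra_simps del: fun_upd_apply)
  qed
  from this[of UNIV] show ?thesis by (simp add: w_def l1_norm_def)
qed

lemma label_rank_near:
  fixes c c' :: "nat \<Rightarrow> real ^ 'n"
  assumes card: "CARD('n) \<le> 2"
  shows "near (label_rank v m c) (label_rank v m c') (real CARD('n) * (\<Sum>k<m. l1_norm (c k - c' k)))"
proof -
  \<comment> \<open>Move the labels one after the other; those below \<open>l\<close> are already moved.\<close>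
  define w where "w l k = (if k < l then c' k else c k)" for l k
  have "near (label_rank v m c) (label_rank v m (w l)) (real CARD('n) * (\<Sum>k<l. l1_norm (c k - c' k)))"
    if "l \<le> m" for l
    using that
  proof (induction l)
    case 0
    have "w 0 = c" by (simp add: w_def fun_eq_iff)
    then show ?case using near_refl by simp
  next
    case (Suc l)
    have "(w l)(l := c' l) = w (Suc l)" by (auto simp: w_def fun_eq_iff)
    moreover have "w l l = c l" by (simp add: w_def)
    ultimately have "near (label_rank v m (w l)) (label_rank v m (w (Suc l))) (real CARD('n) * l1_norm (c l - c' l))"
      using label_rank_move_label[where v = v and c = "w l" and j = l and m = m and p = "c' l", OF card] Suc.prems by simp
    from near_trans[OF Suc.IH this] Suc.prems show ?case by (simp add: algebra_simps)
  qed
  moreover have "label_rank v m (w m) = label_rank v m c'"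
  proof -
    have "{k. k < m \<and> w m k \<le> i} = {k. k < m \<and> c' k \<le> i}" for i by (auto simp: w_def)
    then show ?thesis by (simp add: label_rank_def fun_eq_iff)
  qed
  ultimately show ?thesis by (metis order_refl)
qed

section \<open>Hilbert functions of presented modules\<close>

definition mat_column :: "'k::field mat \<Rightarrow> nat \<Rightarrow> nat \<Rightarrow> 'k" where
  "mat_column \<mu> j = (\<lambda>i. if i < dim_row \<mu> then \<mu> $$ (i, j) else 0)"

text \<open>
  The kernel of the projection onto \<open>M\<close> is the image of \<open>f\<close>.
\<close>

lemma Hil_cokernel:
  assumes "persistence_module Q" and ck: "is_cokernel P f Q M"
  shows "Hil Q i = int (seq.dim (f i ` fiber P i)) + Hil M i"
proof -
  obtain g where g: "epi Q M g" "exact_at P f Q g" using ck unfolding is_cokernel_def by blast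
  have "seq.dim (fiber Q i) = seq.dim {x \<in> fiber Q i. g i x = 0} + seq.dim (g i ` fiber Q i)"
    using rank_nullity[OF fiber_fd[OF assms(1)] morphism_linear[OF epi_morphism[OF g(1)]]] .
  then show ?thesis using g by (simp add: Hil_def epi_def exact_at_def)
qed

lemma Hil_presented:
  fixes M :: "('k::field, real ^ 'n) pmod"
  assumes "presents (\<mu>, L) M"
  shows "Hil M i = barcode_Hil (mset (take (dim_row \<mu>) L)) i
    - label_rank (mat_column \<mu>) (dim_col \<mu>) (\<lambda>k. L ! (dim_row \<mu> + k)) i"
proof -
  let ?r = "dim_row \<mu>" and ?c = "dim_col \<mu>"
  have len: "length L = ?r + ?c"
    and ck: "is_cokernel (free_module (drop ?r L)) (matrix_morphism \<mu>) (free_module (take ?r L)) M"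
    using assms by (auto simp: presents_def presentation_matrix_def)
  let ?S = "{k. k < ?c \<and> L ! (?r + k) \<le> i}"
  have fiber: "fiber (free_module (drop ?r L)) i = coord_space ?S" using len by auto
  have lin: "Vector_Spaces.linear seq_scale seq_scale (matrix_morphism \<mu> i)"
    unfolding Vector_Spaces.linear_iff matrix_morphism_def
    using seq.vector_space_axioms
    by (auto simp: seq_apply fun_eq_iff sum.distrib algebra_simps sum_distrib_left intro!: sum.cong)
  interpret l: Vector_Spaces.linear seq_scale seq_scale "matrix_morphism \<mu> i" by (rule lin)
  have "matrix_morphism \<mu> i (unit_seq k) = mat_column \<mu> k" if "k < ?c" for k
  proof
    fix b
    have "(\<Sum>j<?c. \<mu> $$ (b, j) * (if j = k then 1 else 0)) = (\<Sum>j<?c. if j = k then \<mu> $$ (b, j) else 0)"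
      by (intro sum.cong) auto
    also have "\<dots> = \<mu> $$ (b, k)" using that by (simp add: sum.delta)
    finally show "matrix_morphism \<mu> i (unit_seq k) b = mat_column \<mu> k b"
      by (simp add: matrix_morphism_def mat_column_def)
  qed
  then have im: "matrix_morphism \<mu> i ` unit_seq ` ?S = mat_column \<mu> ` ?S" by (auto simp: image_iff)
  have "matrix_morphism \<mu> i ` coord_space ?S = matrix_morphism \<mu> i ` seq.span (unit_seq ` ?S)"
    by (subst coord_space_basis(1)) auto
  also have "\<dots> = seq.span (mat_column \<mu> ` ?S)" using l.span_image[of "unit_seq ` ?S"] im by simp
  finally have "int (seq.dim (matrix_morphism \<mu> i ` fiber (free_module (drop ?r L)) i)) =
      label_rank (mat_column \<mu>) ?c (\<lambda>k. L ! (?r + k)) i"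
    unfolding fiber label_rank_def by simp
  moreover have "Hil (free_module (take ?r L) :: ('k, real ^ 'n) pmod) i = barcode_Hil (mset (take ?r L)) i"
    by (rule Hil_free)
  ultimately show ?thesis using Hil_cokernel[OF persistence_module_free ck, of i] by linarith
qed

lemma sum_lessThan_add: "(\<Sum>i<r + c. f i) = (\<Sum>i<r. f i) + (\<Sum>k<c. f (r + k) :: real)" for r c :: nat
  by (induction c) (simp_all add: add.assoc)

text \<open>
  Each row contributes the distance moved once, each column at most \<open>CARD('n)\<close> times.
\<close>

lemma Hil_near_of_presentations:
  fixes M N :: "('k::field, real ^ 'n) pmod"
  assumes card: "CARD('n) \<le> 2" and M: "presents (\<mu>, L) M" and N: "presents (\<mu>, L') N"
  shows "near (Hil M) (Hil N) (real CARD('n) * (\<Sum>i<dim_row \<mu> + dim_col \<mu>. l1_norm (L ! i - L' ! i)))"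
proof -
  let ?r = "dim_row \<mu>" and ?c = "dim_col \<mu>"
  have len: "length L = ?r + ?c" "length L' = ?r + ?c"
    using M N by (auto simp: presents_def presentation_matrix_def)
  have "near (barcode_Hil (mset (take ?r L))) (barcode_Hil (mset (take ?r L')))
      (\<Sum>i<?r. l1_norm (take ?r L ! i - take ?r L' ! i))"
    using near_barcode_Hil[of "take ?r L" "take ?r L'"] len by simp
  then have rows: "near (barcode_Hil (mset (take ?r L))) (barcode_Hil (mset (take ?r L')))
      (\<Sum>i<?r. l1_norm (L ! i - L' ! i))" by simp
  have "near (Hil M) (Hil N) ((\<Sum>i<?r. l1_norm (L ! i - L' ! i)) +
      real CARD('n) * (\<Sum>k<?c. l1_norm (L ! (?r + k) - L' ! (?r + k))))"
    using near_diff[OF rows label_rank_near[OF card, of "mat_column \<mu>" ?c "\<lambda>k. L ! (?r + k)" "\<lambda>k. L' ! (?r + k)"]]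
    unfolding Hil_presented[OF M, abs_def, symmetric] Hil_presented[OF N, abs_def, symmetric]
    by (simp add: Hil_presented[OF M] Hil_presented[OF N] near_def)
  moreover have "(\<Sum>i<?r. l1_norm (L ! i - L' ! i)) \<le> real CARD('n) * (\<Sum>i<?r. l1_norm (L ! i - L' ! i))"
  proof -
    have "1 \<le> real CARD('n)" by (simp add: Suc_leI)
    then show ?thesis using mult_right_mono[of 1 "real CARD('n)" "\<Sum>i<?r. l1_norm (L ! i - L' ! i)"]
      by (simp add: sum_nonneg)
  qed
  ultimately show ?thesis
    unfolding sum_lessThan_add by (elim near_mono) (simp add: algebra_simps)
qed

section \<open>Betti barcodes\<close>

lemma free_nil_fiber [simp]: "fiber (free_module []) j = {0}"
  by (auto simp: coord_space_def)

text \<open>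
  The resolution has length 2: cover \<open>M\<close> minimally, cover the kernel minimally, and observe that the
  next kernel is free.  From there on the differentials are injective, so their kernels lie in the radical.
\<close>

lemma minimal_resolution_exists:
  fixes M :: "('k::field, real ^ 'n) pmod"
  assumes card: "CARD('n) \<le> 2" and fp: "finitely_presentable M"
  obtains xs d where "minimal_projective_resolution (\<lambda>k. free_module (xs k)) d M" "\<And>k. 3 \<le> k \<Longrightarrow> xs k = []"
proof -
  note F = persistence_module_free
  have M: "persistence_module M" using fp by (simp add: finitely_presentable_def)
  obtain ys q where "epi (free_module ys) M q"
    using finitely_presentable_free_presentation[OF fp] by blast
  then obtain xs0 g0 where c0: "minimal_cover xs0 M g0" using minimal_cover_exists[OF M] by blast
  then have g0: "epi (free_module xs0) M g0" by (simp add: minimal_cover_def)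
  let ?K = "ker_module (free_module xs0) g0"
  have K: "persistence_module ?K" using persistence_module_ker[OF F M epi_morphism[OF g0]] .
  obtain zs \<rho> where "epi (free_module zs) ?K \<rho>"
    using kernel_of_cover_finitely_generated[OF fp g0] by blast
  then obtain xs1 g1 where c1: "minimal_cover xs1 ?K g1" using minimal_cover_exists[OF K] by blast
  then have g1: "epi (free_module xs1) ?K g1" by (simp add: minimal_cover_def)
  have g1m: "morphism (free_module xs1) (free_module xs0) g1"
    using morphism_out_of_ker[OF epi_morphism[OF g1]] .
  obtain xs2 g2 where g2: "morphism (free_module xs2) (free_module xs1) g2"
    "exact_at (free_module xs2) g2 (free_module xs1) g1"
    "\<And>j x. x \<in> fiber (free_module xs2) j \<Longrightarrow> g2 j x = 0 \<Longrightarrow> x = 0"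
    using kernel_free[OF card g1m] by blast
  define xs where "xs k = (if k = 0 then xs0 else if k = 1 then xs1 else if k = 2 then xs2 else [])" for k :: nat
  define d where "d k = (if k = 0 then g0 else if k = 1 then g1 else if k = 2 then g2 else (\<lambda>_ _. 0))" for k :: nat
  have zero: "morphism (free_module []) X (\<lambda>_ _. 0)" if "persistence_module X" for X :: "('k, real ^ 'n) pmod"
    using that by (auto simp: morphism_def linear_between_def seq.subspace_0[OF fiber_subspace[OF that]]
      linear_between_0[OF str_map_linear[OF that] fiber_subspace[OF that]])
  have res: "projective_resolution (\<lambda>k. free_module (xs k)) d M"
    unfolding projective_resolution_def
  proof (intro conjI allI)
    show "projective (free_module (xs k) :: ('k, real ^ 'n) pmod)" for k by (rule projective_free)
    show "epi (free_module (xs 0)) M (d 0)" using g0 by (simp add: xs_def d_def)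
    fix k :: nat
    consider "k = 0" | "k = 1" | "k = 2" | "k \<ge> 3" by linarith
    then have "morphism (free_module (xs (Suc k))) (free_module (xs k)) (d (Suc k)) \<and>
        exact_at (free_module (xs (Suc k))) (d (Suc k)) (free_module (xs k)) (d k)"
    proof cases
      case 1
      then show ?thesis using g1m g1 by (simp add: xs_def d_def exact_at_def epi_def del: free_module_simps)
    next
      case 2
      then show ?thesis using g2(1,2) by (simp add: xs_def d_def numeral_2_eq_2 del: free_module_simps)
    next
      case 3
      have "{x \<in> fiber (free_module xs2) i. g2 i x = 0} = {0}" for i
        using g2(3)[of _ i] morphism_zero[OF g2(1) F] seq.subspace_0[OF fiber_subspace[OF F, of xs2 i]] by blast
      then show ?thesis using 3 zero[OF F] by (simp add: xs_def d_def exact_at_def del: free_module_simps)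
    next
      case 4
      then show ?thesis using zero[OF F] by (auto simp: xs_def d_def exact_at_def simp del: free_module_simps)
    qed
    then show "morphism (free_module (xs (Suc k))) (free_module (xs k)) (d (Suc k))"
      "exact_at (free_module (xs (Suc k))) (d (Suc k)) (free_module (xs k)) (d k)" by auto
  qed
  have "minimal_projective_resolution (\<lambda>k. free_module (xs k)) d M"
  proof (rule radical_resolution_minimal[OF res M])
    fix k j and x :: "nat \<Rightarrow> 'k"
    assume x: "x \<in> fiber (free_module (xs k)) j" and dx: "d k j x = 0"
    consider "k = 0" | "k = 1" | "k = 2" | "k \<ge> 3" by linarith
    then show "x \<in> radical (xs k) j"
    proof cases
      case 1
      then show ?thesis using c0 x dx by (simp add: minimal_cover_def xs_def d_def del: free_module_simps)
    next
      case 2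
      then show ?thesis using c1 x dx by (simp add: minimal_cover_def xs_def d_def del: free_module_simps)
    next
      case 3
      then have "x = 0" using g2(3)[of x j] x dx by (simp add: xs_def d_def del: free_module_simps)
      then show ?thesis using seq.subspace_0[OF radical_subspace] by simp
    next
      case 4
      then have "xs k = []" by (simp add: xs_def)
      then have "x = 0" using x by (simp del: free_module_simps)
      then show ?thesis using seq.subspace_0[OF radical_subspace] by simp
    qed
  qed
  then show thesis using that by (auto simp: xs_def)
qed

text \<open>
  The chosen minimal resolution need not be the one constructed above, but its ranks are bounded by
  the ranks of the latter, so its terms of index at least 3 vanish; then the Hilbert function of \<open>M\<close> is the
  alternating sum of those of the three remaining terms.
\<close>

lemma Hil_betti_barcode:
  fixes M :: "('k::field, real ^ 'n) pmod"
  assumes card: "CARD('n) \<le> 2" and fp: "finitely_presentable M"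
  shows "Hil M i = barcode_Hil (fst (betti_barcode M)) i - barcode_Hil (snd (betti_barcode M)) i"
proof -
  have M: "persistence_module M" using fp by (simp add: finitely_presentable_def)
  obtain xs d0 where xs: "minimal_projective_resolution (\<lambda>k. free_module (xs k)) d0 M" "\<And>k. 3 \<le> k \<Longrightarrow> xs k = []"
    using minimal_resolution_exists[OF card fp] by blast
  define P where "P = (SOME P. \<exists>d. minimal_projective_resolution P d M)"
  have "\<exists>P d. minimal_projective_resolution P d M" using xs(1) by blast
  then have "\<exists>d. minimal_projective_resolution P d M" unfolding P_def by (rule someI_ex)
  then obtain d where d: "minimal_projective_resolution P d M" by blast
  then have res: "projective_resolution P d M" and fr: "\<And>k. free_finite_rank (P k)"
    unfolding minimal_projective_resolution_def by auto
  have empty: "barcode (P k) = {#}" if "3 \<le> k" for k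
  proof -
    have "free_rank (P k) \<le> free_rank (free_module (xs k) :: ('k, real ^ 'n) pmod)"
      using d xs(1) unfolding minimal_projective_resolution_def by blast
    then show ?thesis using xs(2)[OF that] by (simp add: free_rank_def[of "P k"])
  qed
  have small: "k = 0 \<or> k = 1 \<or> k = 2" if "barcode (P k) \<noteq> {#}" for k
    using empty[of k] that by fastforce
  have "(\<Sum>k\<in>{k. even k \<and> barcode (P k) \<noteq> {#}}. barcode (P k)) = (\<Sum>k\<in>{0, 2}. barcode (P k))"
  proof (rule sum.mono_neutral_left)
    show "{k. even k \<and> barcode (P k) \<noteq> {#}} \<subseteq> {0, 2}"
    proof
      fix k assume "k \<in> {k. even k \<and> barcode (P k) \<noteq> {#}}"
      then have "even k" "barcode (P k) \<noteq> {#}" by auto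
      with small[OF this(2)] show "k \<in> {0, 2}" by auto
    qed
  qed auto
  moreover have "(\<Sum>k\<in>{k. odd k \<and> barcode (P k) \<noteq> {#}}. barcode (P k)) = (\<Sum>k\<in>{1}. barcode (P k))"
  proof (rule sum.mono_neutral_left)
    show "{k. odd k \<and> barcode (P k) \<noteq> {#}} \<subseteq> {1}"
    proof
      fix k assume "k \<in> {k. odd k \<and> barcode (P k) \<noteq> {#}}"
      then have "odd k" "barcode (P k) \<noteq> {#}" by auto
      with small[OF this(2)] show "k \<in> {1}" by auto
    qed
  qed auto
  ultimately have betti: "betti_barcode M = (barcode (P 0) + barcode (P 2), barcode (P 1))"
    unfolding betti_barcode_def P_def[symmetric] by simp
  define D where "D k = int (seq.dim (d k i ` fiber (P k) i))" for k
  \<comment> \<open>By exactness the kernel of \<open>d k\<close> is the image of \<open>d (Suc k)\<close>.\<close>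
  have step: "Hil (P k) i = D (Suc k) + D k" for k
  proof -
    have "seq.dim (fiber (P k) i) = seq.dim {x \<in> fiber (P k) i. d k i x = 0} + seq.dim (d k i ` fiber (P k) i)"
      using rank_nullity[OF fiber_fd[OF resolution_module[OF res M]] morphism_linear[OF augmented_differential[OF res M]]] .
    then show ?thesis using resolution_exact[OF res M, of k] by (simp add: Hil_def D_def exact_at_def)
  qed
  have D0: "D 0 = Hil M i" using resolution_epi[OF res M] by (simp add: D_def Hil_def epi_def)
  have H: "Hil (P k) i = barcode_Hil (barcode (P k)) i" for k
    using Hil_of_barcode[OF free_finite_rank_barcode[OF fr]] .
  have "D 3 = 0" using step[of 3] H[of 3] empty[of 3] by (simp add: D_def)
  then show ?thesis
    using step[of 0] step[of 1] step[of 2] D0 unfolding betti by (simp add: H numeral_eq_Suc)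
qed

section \<open>Hilbert decompositions\<close>

lemma disjoint_difference_unique:
  assumes "A + D = C + B" "set_mset A \<inter> set_mset B = {}" "set_mset C \<inter> set_mset D = {}"
  shows "A = C" "B = D"
proof -
  have "count A x = count C x \<and> count B x = count D x" for x
  proof -
    have "count A x + count D x = count C x + count B x" using assms(1) by (metis count_union)
    moreover have "count A x = 0 \<or> count B x = 0" "count C x = 0 \<or> count D x = 0"
      using assms(2,3) by (auto simp: count_eq_zero_iff)
    ultimately show ?thesis by auto
  qed
  then show "A = C" "B = D" by (auto intro: multiset_eqI)
qed

text \<open>
  Cancelling the common part \<open>X \<inter># Y\<close> of a signed barcode for the Hilbert function of \<open>M\<close> gives the
  disjoint pair, which the Hilbert function determines.
\<close>

lemma Hil_hilbert_barcode:
  fixes M :: "('k::field, 'p::order) pmod"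
  assumes H: "\<And>i. Hil M i = barcode_Hil X i - barcode_Hil Y i"
  shows "Hil M i = barcode_Hil (fst (hilbert_barcode M)) i - barcode_Hil (snd (hilbert_barcode M)) i"
proof -
  define A where "A = X - Y"
  define B where "B = Y - X"
  have "X + B = A + Y" unfolding A_def B_def by (rule multiset_eqI) auto
  then have exchange: "barcode_Hil X i + barcode_Hil B i = barcode_Hil A i + barcode_Hil Y i" for i
    by (metis barcode_Hil_union)
  have AB: "Hil M i = barcode_Hil A i - barcode_Hil B i" for i using H[of i] exchange[of i] by linarith
  have disj: "set_mset A \<inter> set_mset B = {}"
    unfolding A_def B_def by (auto simp: in_diff_count)
  obtain as bs where ab: "mset as = A" "mset bs = B" using ex_mset by metis
  have "hilbert_barcode M = (A, B)"
    unfolding hilbert_barcode_def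
  proof (rule the_equality)
    let ?P = "free_module as :: ('k, 'p) pmod" and ?Q = "free_module bs :: ('k, 'p) pmod"
    have P: "barcode ?P = A" and Q: "barcode ?Q = B" using barcode_eq[OF has_barcode_free] ab by metis+
    show "\<exists>(P :: ('k, 'p) pmod) (Q :: ('k, 'p) pmod). free_finite_rank P \<and> free_finite_rank Q \<and>
        (\<forall>i. Hil M i = Hil P i - Hil Q i) \<and> set_mset (barcode P) \<inter> set_mset (barcode Q) = {} \<and>
        (A, B) = (barcode P, barcode Q)"
    proof (rule exI[where x = ?P], rule exI[where x = ?Q], intro conjI)
      show "free_finite_rank ?P" "free_finite_rank ?Q"
        unfolding free_finite_rank_def using has_barcode_free by blast+
      show "\<forall>i. Hil M i = Hil ?P i - Hil ?Q i" using AB ab by (simp add: Hil_free)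
      show "set_mset (barcode ?P) \<inter> set_mset (barcode ?Q) = {}" unfolding P Q by (rule disj)
      show "(A, B) = (barcode ?P, barcode ?Q)" by (simp only: P Q)
    qed
  next
    fix S
    assume "\<exists>(P :: ('k, 'p) pmod) (Q :: ('k, 'p) pmod). free_finite_rank P \<and> free_finite_rank Q \<and>
        (\<forall>i. Hil M i = Hil P i - Hil Q i) \<and> set_mset (barcode P) \<inter> set_mset (barcode Q) = {} \<and>
        S = (barcode P, barcode Q)"
    then obtain P Q :: "('k, 'p) pmod" where PQ: "free_finite_rank P" "free_finite_rank Q"
        "\<And>i. Hil M i = Hil P i - Hil Q i" "set_mset (barcode P) \<inter> set_mset (barcode Q) = {}"
        "S = (barcode P, barcode Q)" by blast
    have "A + barcode Q = barcode P + B"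
    proof (rule barcode_Hil_inject)
      fix i
      show "barcode_Hil (A + barcode Q) i = barcode_Hil (barcode P + B) i"
        using PQ(3)[of i] AB[of i] Hil_of_barcode[OF free_finite_rank_barcode[OF PQ(1)], of i]
          Hil_of_barcode[OF free_finite_rank_barcode[OF PQ(2)], of i] by simp
    qed
    from disjoint_difference_unique[OF this disj PQ(4)] show "S = (A, B)" using PQ(5) by simp
  qed
  then show ?thesis using AB by simp
qed

section \<open>Stability\<close>

text \<open>
  The pointwise supremum of all pseudodistances below the predistance is again one, so the
  greatest one exists and bounds each of them.
\<close>

lemma le_presentation_distance:
  fixes d :: "('k::field, real ^ 'n) pmod \<Rightarrow> ('k, real ^ 'n) pmod \<Rightarrow> ennreal"
  assumes "ext_pseudodistance_on {M. finitely_presentable M} d"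
    and "\<And>M N. finitely_presentable M \<Longrightarrow> finitely_presentable N \<Longrightarrow> d M N \<le> presentation_predistance M N"
  shows "d M N \<le> presentation_distance M N"
proof -
  let ?Q = "\<lambda>d :: ('k, real ^ 'n) pmod \<Rightarrow> ('k, real ^ 'n) pmod \<Rightarrow> ennreal.
     ext_pseudodistance_on {M. finitely_presentable M} d \<and>
     (\<forall>M N. finitely_presentable M \<and> finitely_presentable N \<longrightarrow> d M N \<le> presentation_predistance M N)"
  define D where "D M N = (SUP d\<in>Collect ?Q. d M N)" for M N
  have up: "d' M N \<le> D M N" if "?Q d'" for d' M N
    unfolding D_def using that by (intro SUP_upper) simp
  have "?Q D"
    unfolding ext_pseudodistance_on_def
  proof (intro conjI ballI allI impI)
    fix x y z :: "('k, real ^ 'n) pmod"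
    assume x: "x \<in> {M. finitely_presentable M}"
    show "D x x = 0"
    proof -
      have "D x x \<le> 0" unfolding D_def
        using x by (intro SUP_least) (auto simp: ext_pseudodistance_on_def)
      then show ?thesis by simp
    qed
    assume y: "y \<in> {M. finitely_presentable M}"
    show "D x y = D y x"
      unfolding D_def using x y by (intro SUP_cong) (auto simp: ext_pseudodistance_on_def)
    assume z: "z \<in> {M. finitely_presentable M}"
    show "D x z \<le> D x y + D y z"
    proof -
      have "d' x z \<le> D x y + D y z" if d': "?Q d'" for d'
      proof -
        have "d' x z \<le> d' x y + d' y z" using d' x y z by (auto simp: ext_pseudodistance_on_def)
        also have "\<dots> \<le> D x y + D y z" by (intro add_mono up d')
        finally show ?thesis .
      qed
      then show ?thesis by (subst D_def) (auto intro!: SUP_least)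
    qed
  next
    fix M N :: "('k, real ^ 'n) pmod"
    assume "finitely_presentable M \<and> finitely_presentable N"
    then show "D M N \<le> presentation_predistance M N"
      unfolding D_def by (intro SUP_least) auto
  qed
  then have "presentation_distance = D"
    unfolding presentation_distance_def using up by (intro Greatest_equality) (auto simp: le_fun_def)
  then show ?thesis using up[of d M N] assms by simp
qed

text \<open>
  Division by the number of parameters turns the claimed bound into a comparison of a
  pseudodistance with the predistance, to which the universal property applies.
\<close>

lemma betti_barcode_le_predistance:
  fixes M N :: "('k::field, real ^ 'n) pmod"
  assumes card: "CARD('n) \<le> 2" and M: "finitely_presentable M" and N: "finitely_presentable N"
  shows "signed_wasserstein (betti_barcode M) (betti_barcode N) / of_nat CARD('n) \<le> presentation_predistance M N"
  unfolding presentation_predistance_def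
proof (rule Inf_greatest, elim CollectE exE conjE)
  fix y \<mu> L L'
  assume y: "y = ennreal (\<Sum>i<dim_row \<mu> + dim_col \<mu>. l1_norm (L ! i - L' ! i))"
    and p: "presents (\<mu>, L) M" "presents (\<mu>, L') N"
  let ?s = "\<Sum>i<dim_row \<mu> + dim_col \<mu>. l1_norm (L ! i - L' ! i)"
  have "signed_wasserstein (betti_barcode M) (betti_barcode N) \<le> ennreal (real CARD('n) * ?s)"
    using signed_wasserstein_le_of_near[OF Hil_near_of_presentations[OF card p]
        Hil_betti_barcode[OF card M] Hil_betti_barcode[OF card N]] .
  also have "\<dots> = ennreal ?s * of_nat CARD('n)"
    by (simp add: ennreal_mult sum_nonneg ennreal_of_nat_eq_real_of_nat mult.commute)
  finally have "signed_wasserstein (betti_barcode M) (betti_barcode N) / of_nat CARD('n) \<le>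
      ennreal ?s * of_nat CARD('n) / of_nat CARD('n)" by (rule divide_right_mono_ennreal)
  also have "\<dots> = ennreal ?s" by (rule mult_divide_eq_ennreal) auto
  finally show "signed_wasserstein (betti_barcode M) (betti_barcode N) / of_nat CARD('n) \<le> y"
    unfolding y .
qed

theorem theorem1p5:
  fixes M N :: "('k::field, real ^ 'n) pmod"
  assumes "CARD('n) \<in> {1, 2}"
    and "finitely_presentable M" and "finitely_presentable N"
  shows "signed_wasserstein (hilbert_barcode M) (hilbert_barcode N)
           = signed_wasserstein (betti_barcode M) (betti_barcode N)
         \<and> signed_wasserstein (betti_barcode M) (betti_barcode N)
           \<le> of_nat CARD('n) * presentation_distance M N"
proof
  have card: "CARD('n) \<le> 2" using assms(1) by auto
  have eq: "fst (hilbert_barcode X) + snd (betti_barcode X) = fst (betti_barcode X) + snd (hilbert_barcode X)"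
    if X: "finitely_presentable X" for X :: "('k, real ^ 'n) pmod"
  proof (rule barcode_Hil_inject)
    fix i
    note b = Hil_betti_barcode[OF card X]
    show "barcode_Hil (fst (hilbert_barcode X) + snd (betti_barcode X)) i =
        barcode_Hil (fst (betti_barcode X) + snd (hilbert_barcode X)) i"
      using b[of i] Hil_hilbert_barcode[OF b, of i] by simp
  qed
  show "signed_wasserstein (hilbert_barcode M) (hilbert_barcode N) =
      signed_wasserstein (betti_barcode M) (betti_barcode N)"
    by (rule signed_wasserstein_cong[OF eq[OF assms(2)] eq[OF assms(3)]])
  define d where "d X Y = signed_wasserstein (betti_barcode X) (betti_barcode Y) / of_nat CARD('n)"
    for X Y :: "('k, real ^ 'n) pmod"
  have "ext_pseudodistance_on {M. finitely_presentable M} d"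
    unfolding ext_pseudodistance_on_def
  proof (intro conjI ballI)
    fix X Y Z :: "('k, real ^ 'n) pmod"
    show "d X X = 0" by (simp add: d_def signed_wasserstein_self)
    show "d X Y = d Y X" unfolding d_def by (subst signed_wasserstein_commute) (rule refl)
    show "d X Z \<le> d X Y + d Y Z"
      unfolding d_def add_divide_distrib_ennreal[symmetric]
      by (intro divide_right_mono_ennreal signed_wasserstein_triangle)
  qed
  then have le: "d M N \<le> presentation_distance M N"
    using betti_barcode_le_predistance[OF card] unfolding d_def by (rule le_presentation_distance)
  have "signed_wasserstein (betti_barcode M) (betti_barcode N) = of_nat CARD('n) * d M N"
    unfolding d_def ennreal_times_divide by (subst mult.commute, subst mult_divide_eq_ennreal) auto
  also have "\<dots> \<le> of_nat CARD('n) * presentation_distance M N" by (rule mult_left_mono[OF le]) simp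
  finally show "signed_wasserstein (betti_barcode M) (betti_barcode N) \<le> of_nat CARD('n) * presentation_distance M N" .
qed

end
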